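(* Let $d\ge1$ and $\alpha\ge0$. Consider a stationary ergodic simple point process on $\mathbb R^d$ with law $\hat{\mathbb P}$ and intensity $\rho\in(0,+\infty)$, and a probability measure $\nu$ on $\mathbb R$ with $0$ in its support such that (i) $\nu_{\star,\gamma}$ converges weakly to $\nu^+_{1,\alpha}$ or to $\nu_{1,\alpha}$ as $\gamma\downarrow0$; (ii) the limit $C_*:=\lim_{\gamma\downarrow0}\nu([-\gamma,\gamma])/\gamma^{\alpha+1}$ exists and is in $(0,+\infty)$. Fix $\lambda>0$ and set $\ell(\beta):=\big(\lambda/(C_*\rho)\big)^{\frac1{\alpha+1+d}}\beta^{\frac{\alpha+1}{\alpha+1+d}}$. Then, when $\omega$ is sampled according to $\hat{\mathbb P}_\nu$, the law $\mathbb P^\beta$ of the rescaled marked simple point process $$\omega_{\ell(\beta),\beta}:=\Big\{\Big(\frac{x}{\ell(\beta)},\frac{\beta}{\ell(\beta)}E_x\Big):x\in\widehat\omega,\ |E_x|\le\frac{\ell(\beta)}{\beta}\Big\}$$ converges weakly as $\beta\to+\infty$ to $\mathrm{PPP}[\lambda,\nu^+_{1,\alpha}]$ if $\lim_{\gamma\downarrow0}\nu_{\star,\gamma}=\nu^+_{1,\alpha}$, and to $\mathrm{PPP}[\lambda,\nu_{1,\alpha}]$ if $\lim_{\gamma\downarrow0}\nu_{\star,\gamma}=\nu_{1,\alpha}$.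
   Context: $\hat\Omega$ is the space of locally finite subsets of $\mathbb R^d$, identified with the atomic measures $\sum_{x\in\hat\omega}\delta_x$, with topology such that $\hat\omega_n\to\hat\omega$ iff $\hat\omega_n[f]\to\hat\omega[f]$ for all continuous $f:\mathbb R^d\to\mathbb R$ with bounded support, and its Borel $\sigma$-algebra. $\Omega$ is the space of sets $\omega=\{(x_i,E_{x_i})\}\subset\mathbb R^d\times\mathbb R$ with $\widehat\omega:=\{x_i\}$ in $\hat\Omega$ (each $x\in\widehat\omega$ has one mark $E_x$); $\omega$ is identified with $\sum\delta_{(x_i,E_{x_i})}$ and $\omega_n\to\omega$ iff $\omega_n[f]\to\omega[f]$ for all continuous $f:\mathbb R^d\times\mathbb R\to\mathbb R$ with bounded support. A simple point process (SPP) is a random element of $\hat\Omega$, a marked SPP is a random element of $\Omega$; weak convergence of laws on $\Omega$ is with respect to this topology. An SPP is stationary if its law is invariant under all translations $\hat\omega\mapsto\{x-a:x\in\hat\omega\}$, $a\in\mathbb R^d$; its intensity is the expected number of points in $[0,1]^d$; it is ergodic if it is stationary and translation-invariant events have probability $0$ or $1$. $\hat{\mathbb P}_\nu$ ($\nu$-randomization of $\hat{\mathbb P}$): law of the marked SPP obtained by marking the points of the SPP with law $\hat{\mathbb P}$ by i.i.d. random variables with law $\nu$, independently from all the rest. $\mathrm{PPP}[\lambda,\mu]$: the $\mu$-randomization of the homogeneous Poisson point process on $\mathbb R^d$ with intensity $\lambda$. For $\gamma>0$, $\nu_{\star,\gamma}(B):=\nu(\gamma B\cap[-\gamma,\gamma])/\nu([-\gamma,\gamma])$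 for Borel $B\subset\mathbb R$ (i.e. the law of $X/\gamma$ conditioned on $|X/\gamma|\le1$, where $X\sim\nu$). $\nu^+_{1,\alpha}(dE)=(\alpha+1)E^\alpha\mathbf 1_{[0,1]}(E)\,dE$ and $\nu_{1,\alpha}(dE)=\frac{\alpha+1}2|E|^\alpha\mathbf 1_{[-1,1]}(E)\,dE$. *)

theory Defs
  imports "HOL-Probability.Probability"
begin

text \<open>Only finitely many terms are nonzero if \<^term>\<open>f\<close> has bounded support and
  \<^term>\<open>w\<close> is locally finite.\<close>

definition conf_eval :: "'a set \<Rightarrow> ('a \<Rightarrow> real) \<Rightarrow> real" where
  "conf_eval w f = (\<Sum>x | x \<in> w \<and> f x \<noteq> 0. f x)"

text \<open>The coarsest topology on the set \<^term>\<open>C\<close> of configurations that makes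
  \<^term>\<open>\<lambda>w. conf_eval w f\<close> continuous for every continuous \<^term>\<open>f\<close> with bounded support. For
  both configuration spaces below it is metrizable, hence it is the topology determined by its
  convergent sequences.\<close>

definition vague_topology :: "'a::metric_space set set \<Rightarrow> 'a set topology" where
  "vague_topology C = topology_generated_by
     {{w \<in> C. conf_eval w f \<in> U} | f U.
        continuous_on UNIV f \<and> bounded {x. f x \<noteq> 0} \<and> open U}"

definition borel_of :: "'a topology \<Rightarrow> 'a measure" where
  "borel_of T = sigma (topspace T) {U. openin T U}"

definition configs :: "(real^'n) set set" where
  "configs = {X. \<forall>B. bounded B \<longrightarrow> finite (X \<inter> B)}"

definition marked_configs :: "((real^'n) \<times> real) set set" where
  "marked_configs = {w. fst ` w \<in> configs \<and> inj_on fst w}"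

abbreviation config_space :: "(real^'n) set measure" where
  "config_space \<equiv> borel_of (vague_topology configs)"

abbreviation marked_config_space :: "((real^'n) \<times> real) set measure" where
  "marked_config_space \<equiv> borel_of (vague_topology marked_configs)"

text \<open>Weak convergence along a filter, by testing against bounded continuous functions.\<close>

definition weakly_converges ::
    "'a topology \<Rightarrow> ('i \<Rightarrow> 'a measure) \<Rightarrow> 'a measure \<Rightarrow> 'i filter \<Rightarrow> bool" where
  "weakly_converges T M L F \<longleftrightarrow>
     (\<forall>f. continuous_map T euclideanreal f \<and> bounded (f ` topspace T) \<longrightarrow>
        ((\<lambda>i. integral\<^sup>L (M i) f) \<longlongrightarrow> integral\<^sup>L L f) F)"

definition spp_law :: "(real^'n) set measure \<Rightarrow> bool" where
  "spp_law P \<longleftrightarrow> prob_space P \<and> sets P = sets config_space"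

definition translate :: "real^'n \<Rightarrow> (real^'n) set \<Rightarrow> (real^'n) set" where
  "translate a X = (\<lambda>x. x - a) ` X"

definition stationary :: "(real^'n) set measure \<Rightarrow> bool" where
  "stationary P \<longleftrightarrow> (\<forall>a. distr P config_space (translate a) = P)"

definition ergodic :: "(real^'n) set measure \<Rightarrow> bool" where
  "ergodic P \<longleftrightarrow> stationary P \<and>
     (\<forall>A\<in>sets P. (\<forall>a. translate a -` A \<inter> space P = A) \<longrightarrow> measure P A = 0 \<or> measure P A = 1)"

text \<open>The set \<^term>\<open>cbox 0 1\<close> is the unit cube, \<^term>\<open>1 :: real^'n\<close> being the vector with all
  coordinates equal to 1.\<close>

definition intensity :: "(real^'n) set measure \<Rightarrow> ennreal" where
  "intensity P = (\<integral>\<^sup>+X. of_nat (card (X \<inter> cbox 0 1)) \<partial>P)"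

text \<open>Given the point configuration \<^term>\<open>X\<close>, the marks \<^term>\<open>E\<close> are a family of i.i.d. random
  variables with law \<^term>\<open>\<nu>\<close> indexed by \<^term>\<open>X\<close>.\<close>

definition randomization ::
    "(real^'n) set measure \<Rightarrow> real measure \<Rightarrow> ((real^'n) \<times> real) set measure" where
  "randomization P \<nu> =
     bind P (\<lambda>X. distr (\<Pi>\<^sub>M x\<in>X. \<nu>) marked_config_space (\<lambda>E. (\<lambda>x. (x, E x)) ` X))"

text \<open>The counting probabilities are written out since the library's Poisson distribution excludes
  rate 0, which occurs here for Lebesgue null sets.\<close>

definition poisson_process_law :: "real \<Rightarrow> (real^'n) set measure \<Rightarrow> bool" where
  "poisson_process_law r P \<longleftrightarrow> spp_law P \<and>
     (\<forall>B\<in>sets borel. bounded B \<longrightarrow>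
        (\<forall>k::nat. measure P {X \<in> space P. card (X \<inter> B) = k}
           = (r * measure lborel B) ^ k / fact k * exp (- (r * measure lborel B)))) \<and>
     (\<forall>(m::nat) B. (\<forall>i<m. B i \<in> sets borel \<and> bounded (B i)) \<and> disjoint_family_on B {..<m} \<longrightarrow>
        prob_space.indep_vars P (\<lambda>_. count_space UNIV) (\<lambda>i X. card (X \<inter> B i)) {..<m})"

definition measure_support :: "'a::topological_space measure \<Rightarrow> 'a set" where
  "measure_support M = {x. \<forall>U. open U \<and> x \<in> U \<longrightarrow> emeasure M U > 0}"

text \<open>The law of \<^term>\<open>X / \<gamma>\<close> conditioned on \<^term>\<open>\<bar>X / \<gamma>\<bar> \<le> 1\<close>, where \<^term>\<open>X\<close> has law
  \<^term>\<open>\<nu>\<close>.\<close>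

definition nu_star :: "real measure \<Rightarrow> real \<Rightarrow> real measure" where
  "nu_star \<nu> \<gamma> = distr (uniform_measure \<nu> {-\<gamma>..\<gamma>}) borel (\<lambda>E. E / \<gamma>)"

definition nu1_plus :: "real \<Rightarrow> real measure" where
  "nu1_plus \<alpha> = density lborel (\<lambda>E. ennreal ((\<alpha> + 1) * E powr \<alpha> * indicator {0..1} E))"

definition nu1 :: "real \<Rightarrow> real measure" where
  "nu1 \<alpha> = density lborel (\<lambda>E. ennreal ((\<alpha> + 1) / 2 * \<bar>E\<bar> powr \<alpha> * indicator {-1..1} E))"

definition rescale ::
    "real \<Rightarrow> real \<Rightarrow> ((real^'n) \<times> real) set \<Rightarrow> ((real^'n) \<times> real) set" where
  "rescale l \<beta> w = {(x /\<^sub>R l, \<beta> / l * E) | x E. (x, E) \<in> w \<and> \<bar>E\<bar> \<le> l / \<beta>}"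

end

theory Submission
  imports Defs
begin

text \<open>Two configurations with the same number of points in every dyadic cell of level \<open>k\<close> are
  vaguely close when \<open>k\<close> is large, with no condition on the points lying on cell boundaries.
  Hence a bounded continuous functional is approximated from below by finite sums of indicators of
  cell counts, and weak convergence follows from the convergence of the joint generating functions
  of the cell counts.

  Given the unmarked points, the generating function of the counts in the cells \<open>c \<times> I\<close> of the
  rescaled process is \<open>\<Prod>c. (1 - \<kappa> c) ^ N (l c)\<close>, where \<open>N (l c)\<close> is the number of points in the
  blown up cube and \<open>\<kappa> c\<close> is of order \<open>l ^ (-d)\<close>; the choice of \<open>l\<close> gives
  \<open>\<kappa> c * l ^ d * \<rho> \<rightarrow> lam * (\<Sum>I. \<mu> I * (1 - s c I))\<close>. By the mean ergodic theorem
  \<open>N (l c) / l ^ d\<close> converges in \<open>L\<^sup>1\<close> to \<open>\<rho>\<close> times the volume of \<open>c\<close>, so the limit is the generating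
  function of a randomized Poisson process.

  Only the first moment of \<open>N\<close> is finite. The ergodic theorem is first proved in \<open>L\<^sup>2\<close> for
  truncated counts averaged over lattice cubes and then transferred to \<open>L\<^sup>1\<close>.\<close>

section \<open>Half-open cubes and the vague topology\<close>

text \<open>Generating functions fit because i.i.d. marks act on them multiplicatively: each point
  contributes its own factor, and products over cells can be compared one factor at a time, so L^1
  control of each cell separately is enough. Lower bounds for the two functionals B + \<Phi> and B -
  \<Phi> take the place of a tightness argument.

  Two obstacles shape the rest. The marked law is a \<open>bind\<close> over product measures whose
  index set is the random configuration itself, so the kernel must be shown measurable before the
  \<open>bind\<close> can be evaluated; the passage from generating functions to count indicators is
  therefore stated for an abstract class of functionals and used twice. And ergodicity concerns
  events exactly invariant under every real translation, while the limit of the averages is defined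
  only almost everywhere and comes from integer translations.

  The form of \<open>l\<close> solves (l / \<beta>)^(\<alpha> + 1) * l^d = lam / (C * \<rho>): a
  blown up unit cube holds about \<rho> * l^d points and each survives with probability close to C *
  (l / \<beta>)^(\<alpha> + 1).\<close>

definition hcube :: "'a::euclidean_space \<Rightarrow> real \<Rightarrow> 'a set" where
  "hcube a L = {x. \<forall>b\<in>Basis. a \<bullet> b \<le> x \<bullet> b \<and> x \<bullet> b < a \<bullet> b + L}"

definition lattice :: "int \<Rightarrow> int \<Rightarrow> 'a::euclidean_space set" where
  "lattice m n = {v. \<forall>b\<in>Basis. \<exists>z. v \<bullet> b = of_int z \<and> m \<le> z \<and> z < n}"

definition block :: "real \<Rightarrow> real \<Rightarrow> 'a::euclidean_space set" where
  "block s t = {x. \<forall>b\<in>Basis. s \<le> x \<bullet> b \<and> x \<bullet> b < t}"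

lemma hcube_eq_Int: "hcube a L = (\<Inter>b\<in>Basis. {x. a \<bullet> b \<le> x \<bullet> b} \<inter> {x. x \<bullet> b < a \<bullet> b + L})"
  by (auto simp: hcube_def)

lemma borel_hcube [measurable]: "hcube a L \<in> sets borel"
  unfolding hcube_eq_Int by (intro sets.finite_INT) auto

lemma hcube_subset_cbox: "hcube a L \<subseteq> cbox a (a + L *\<^sub>R One)"
  by (auto simp: hcube_def mem_box inner_simps less_imp_le)

lemma bounded_hcube [simp]: "bounded (hcube a L)"
  using hcube_subset_cbox bounded_cbox bounded_subset by blast

lemma block_subset_cbox: "block s t \<subseteq> cbox (s *\<^sub>R One) (t *\<^sub>R One)"
  by (auto simp: block_def mem_box inner_simps less_imp_le)

lemma bounded_block [simp]: "bounded (block s t)"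
  using block_subset_cbox bounded_cbox bounded_subset by blast

lemma block_eq_hcube: "block s t = hcube (s *\<^sub>R One) (t - s)"
  by (auto simp: block_def hcube_def inner_simps)

lemma hcube_mono: "L \<le> L' \<Longrightarrow> hcube a L \<subseteq> hcube a L'"
  unfolding hcube_def by (intro Collect_mono impI ballI) (meson add_left_mono order_less_le_trans)

lemma borel_block [measurable]: "block s t \<in> sets borel"
  unfolding block_eq_hcube by (rule borel_hcube)

lemma hcube_Times: "hcube (a, b) L = hcube a L \<times> hcube b L"
  by (auto simp: hcube_def Basis_prod_def ball_Un)

lemma latticeE:
  assumes "v \<in> lattice m n" "b \<in> Basis"
  obtains z where "v \<bullet> b = of_int z" "m \<le> z" "z < n"
  using assms unfolding lattice_def by blast

text \<open>Integer coordinate functions parametrize the lattice box, with the coordinatewise floor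
  as inverse; finiteness and cardinality are read off from the function space.\<close>

lemma lattice_bij:
  "bij_betw (\<lambda>g. \<Sum>b\<in>Basis. of_int (g b) *\<^sub>R b) (Basis \<rightarrow>\<^sub>E {m..<n}) (lattice m n :: 'a::euclidean_space set)"
proof (rule bij_betwI[where g = "\<lambda>v. restrict (\<lambda>b. \<lfloor>v \<bullet> b\<rfloor>) Basis"])
  show "(\<lambda>g. \<Sum>b\<in>Basis. of_int (g b) *\<^sub>R b) \<in> (Basis \<rightarrow>\<^sub>E {m..<n}) \<rightarrow> (lattice m n :: 'a set)"
    by (auto simp: lattice_def inner_sum_left_Basis)
  show "(\<lambda>v::'a. restrict (\<lambda>b. \<lfloor>v \<bullet> b\<rfloor>) Basis) \<in> lattice m n \<rightarrow> (Basis \<rightarrow>\<^sub>E {m..<n})"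
    by (intro funcsetI PiE_I) (auto elim!: latticeE)
  show "restrict (\<lambda>b. \<lfloor>(\<Sum>b\<in>Basis. of_int (g b) *\<^sub>R b) \<bullet> b\<rfloor>) Basis = g"
    if "g \<in> Basis \<rightarrow>\<^sub>E {m..<n}" for g :: "'a \<Rightarrow> int"
    using that by (auto simp: inner_sum_left_Basis fun_eq_iff PiE_def extensional_def)
  show "(\<Sum>b\<in>Basis. of_int (restrict (\<lambda>b. \<lfloor>v \<bullet> b\<rfloor>) Basis b) *\<^sub>R b) = v"
    if v: "v \<in> lattice m n" for v :: 'a
  proof (rule euclidean_eqI)
    fix b :: 'a assume b: "b \<in> Basis"
    obtain z where "v \<bullet> b = of_int z" by (rule latticeE[OF v b])
    with b show "(\<Sum>b\<in>Basis. of_int (restrict (\<lambda>b. \<lfloor>v \<bullet> b\<rfloor>) Basis b) *\<^sub>R b) \<bullet> b = v \<bullet> b"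
      by (simp add: inner_sum_left_Basis)
  qed
qed

lemma finite_lattice [simp]: "finite (lattice m n)"
  using bij_betw_finite[OF lattice_bij[of m n]] by (auto intro!: finite_PiE)

lemma card_lattice: "card (lattice m n :: 'a::euclidean_space set) = nat (n - m) ^ DIM('a)"
  using bij_betw_same_card[OF lattice_bij[of m n, where 'a='a]] by (simp add: card_PiE)

lemma lattice_Times: "lattice m n = lattice m n \<times> lattice m n"
  by (auto simp: lattice_def Basis_prod_def ball_Un)

lemma disjoint_hcubes:
  assumes "0 < L" "u \<in> lattice m n" "v \<in> lattice m n" "u \<noteq> v"
  shows "hcube (L *\<^sub>R u) L \<inter> hcube (L *\<^sub>R v) L = {}"
proof (rule ccontr)
  assume "\<not> ?thesis"
  then obtain x where x: "x \<in> hcube (L *\<^sub>R u) L" "x \<in> hcube (L *\<^sub>R v) L" by auto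
  have "u \<bullet> b = v \<bullet> b" if b: "b \<in> Basis" for b
  proof -
    obtain y z where yz: "u \<bullet> b = of_int y" "v \<bullet> b = of_int z"
      using latticeE[OF assms(2) b] latticeE[OF assms(3) b] by metis
    have "L * y < L * z + L" "L * z < L * y + L"
      using x b yz by (force simp: hcube_def)+
    hence "L * y < L * (z + 1)" "L * z < L * (y + 1)" by (auto simp: algebra_simps)
    hence "real_of_int y < z + 1" "real_of_int z < y + 1" using \<open>0 < L\<close> by (auto simp: mult_less_cancel_left simp del: of_int_add)
    thus ?thesis using yz by simp
  qed
  with \<open>u \<noteq> v\<close> show False using euclidean_eqI by blast
qed

text \<open>The cube containing \<open>x\<close> is indexed by the coordinatewise floor of
  \<open>x / L\<close>.\<close>

lemma UN_hcubes:
  assumes "0 < L"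
  shows "(\<Union>v\<in>lattice m n. hcube (L *\<^sub>R v) L) = block (of_int m * L) (of_int n * L)"
proof (intro set_eqI iffI)
  fix x :: 'a assume "x \<in> (\<Union>v\<in>lattice m n. hcube (L *\<^sub>R v) L)"
  then obtain v where v: "v \<in> lattice m n" "x \<in> hcube (L *\<^sub>R v) L" by auto
  show "x \<in> block (of_int m * L) (of_int n * L)"
    unfolding block_def
  proof safe
    fix b :: 'a assume b: "b \<in> Basis"
    then obtain z where z: "v \<bullet> b = of_int z" "m \<le> z" "z + 1 \<le> n"
      using latticeE[OF v(1) b] by (metis add1_zle_eq)
    have x: "L * z \<le> x \<bullet> b" "x \<bullet> b < L * z + L" using v(2) b z by (force simp: hcube_def)+
    have "of_int m * L \<le> of_int z * L" using z assms by (intro mult_right_mono) auto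
    with x(1) show "of_int m * L \<le> x \<bullet> b" unfolding mult.commute[of L] by linarith
    have "of_int (z + 1) * L \<le> of_int n * L" using z assms by (intro mult_right_mono) (auto simp del: of_int_add)
    with x show "x \<bullet> b < of_int n * L" by (simp add: algebra_simps)
  qed
next
  fix x :: 'a assume x: "x \<in> block (of_int m * L) (of_int n * L)"
  define v :: 'a where "v = (\<Sum>b\<in>Basis. of_int \<lfloor>x \<bullet> b / L\<rfloor> *\<^sub>R b)"
  have vb: "v \<bullet> b = of_int \<lfloor>x \<bullet> b / L\<rfloor>" if "b \<in> Basis" for b
    using that by (simp add: v_def inner_sum_left_Basis)
  have "v \<in> lattice m n"
    unfolding lattice_def
  proof safe
    fix b :: 'a assume b: "b \<in> Basis"
    have "of_int m * L \<le> x \<bullet> b" "x \<bullet> b < of_int n * L" using x b by (auto simp: block_def)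
    hence "of_int m \<le> x \<bullet> b / L" "x \<bullet> b / L < of_int n" using assms by (auto simp: field_simps)
    thus "\<exists>z. v \<bullet> b = of_int z \<and> m \<le> z \<and> z < n"
      using vb[OF b] by (auto simp: le_floor_iff floor_less_iff)
  qed
  moreover have "x \<in> hcube (L *\<^sub>R v) L"
    unfolding hcube_def
  proof safe
    fix b :: 'a assume b: "b \<in> Basis"
    have "of_int \<lfloor>x \<bullet> b / L\<rfloor> * L \<le> x \<bullet> b"
      using of_int_floor_le[of "x \<bullet> b / L"] unfolding pos_le_divide_eq[OF assms] .
    moreover have "x \<bullet> b < (of_int \<lfloor>x \<bullet> b / L\<rfloor> + 1) * L"
      using floor_correct[of "x \<bullet> b / L"] unfolding pos_divide_less_eq[OF assms] by simp
    ultimately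
    show "(L *\<^sub>R v) \<bullet> b \<le> x \<bullet> b" "x \<bullet> b < (L *\<^sub>R v) \<bullet> b + L"
      by (simp_all add: vb[OF b] algebra_simps)
  qed
  ultimately show "x \<in> (\<Union>v\<in>lattice m n. hcube (L *\<^sub>R v) L)" by blast
qed

lemma dist_hcube_le:
  fixes x y :: "'a::euclidean_space" and L :: real
  assumes "x \<in> hcube a L" "y \<in> hcube a L"
  shows "dist x y \<le> DIM('a) * L"
proof -
  have "dist x y \<le> (\<Sum>b\<in>Basis. \<bar>(x - y) \<bullet> b\<bar>)" unfolding dist_norm by (rule norm_le_l1)
  also have "\<dots> \<le> (\<Sum>b\<in>(Basis::'a set). L)"
  proof (rule sum_mono)
    fix b :: 'a assume "b \<in> Basis"
    with assms have "a \<bullet> b \<le> x \<bullet> b" "x \<bullet> b < a \<bullet> b + L" "a \<bullet> b \<le> y \<bullet> b" "y \<bullet> b < a \<bullet> b + L"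
      by (auto simp: hcube_def)
    thus "\<bar>(x - y) \<bullet> b\<bar> \<le> L" by (simp add: inner_simps)
  qed
  finally show ?thesis by simp
qed

lemma bounded_subset_block:
  fixes B :: "'a::euclidean_space set"
  assumes "bounded B"
  obtains k0 where "\<And>k. k0 \<le> k \<Longrightarrow> B \<subseteq> block (- (2 ^ k)) (2 ^ k)"
proof -
  obtain r where r: "\<And>x. x \<in> B \<Longrightarrow> norm x \<le> r" using assms bounded_iff by metis
  obtain k0 :: nat where k0: "r < 2 ^ k0" using real_arch_pow[of 2 r] by auto
  show ?thesis
  proof (rule that[of k0])
    fix k assume "k0 \<le> k"
    hence "(2::real) ^ k0 \<le> 2 ^ k" by (intro power_increasing) auto
    with k0 have "r < 2 ^ k" by linarith
    thus "B \<subseteq> block (- (2 ^ k)) (2 ^ k)"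
      unfolding block_def
    proof safe
      fix x b :: 'a assume "x \<in> B" "b \<in> Basis"
      hence "\<bar>x \<bullet> b\<bar> < 2 ^ k" using r[of x] Basis_le_norm[of b x] \<open>r < 2 ^ k\<close> by linarith
      thus "- (2 ^ k) \<le> x \<bullet> b" "x \<bullet> b < 2 ^ k" by auto
    qed
  qed
qed

section \<open>Measurability of point counts for the vague topology\<close>

lemma topspace_vague_topology [simp]: "topspace (vague_topology C) = C"
proof -
  \<comment> \<open>The zero function is an admissible test function, so \<open>C\<close> is itself
    a subbasic set.\<close>
  have "C = {w \<in> C. conf_eval w (\<lambda>_. 0) \<in> UNIV}" by auto
  thus ?thesis unfolding vague_topology_def topology_generated_by_topspace
    by (force intro!: exI[of _ "\<lambda>_. 0::real"])
qed

lemma space_borel_of [simp]: "space (borel_of T) = topspace T"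
  unfolding borel_of_def by (rule space_measure_of) (auto dest: openin_subset)

lemma sets_borel_of: "sets (borel_of T) = sigma_sets (topspace T) {U. openin T U}"
  unfolding borel_of_def by (rule sets_measure_of) (auto dest: openin_subset)

lemma borel_of_openin: "openin T U \<Longrightarrow> U \<in> sets (borel_of T)"
  by (simp add: sets_borel_of)

lemma borel_measurable_continuous_map:
  assumes "continuous_map T euclideanreal f"
  shows "f \<in> borel_measurable (borel_of T)"
proof (rule borel_measurableI)
  fix S :: "real set" assume "open S"
  hence "openin T {x \<in> topspace T. f x \<in> S}"
    using assms by (simp add: continuous_map_def)
  moreover have "{x \<in> topspace T. f x \<in> S} = f -` S \<inter> space (borel_of T)" by auto
  ultimately show "f -` S \<inter> space (borel_of T) \<in> sets (borel_of T)"
    by (metis borel_of_openin)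
qed

lemma conf_eval_eq_sum:
  assumes "finite (w \<inter> B)" "{x. f x \<noteq> 0} \<subseteq> B"
  shows "conf_eval w f = (\<Sum>x\<in>w \<inter> B. f x)"
  unfolding conf_eval_def using assms by (intro sum.mono_neutral_left) auto

lemma continuous_map_conf_eval:
  assumes "continuous_on UNIV f" "bounded {x. f x \<noteq> 0}"
  shows "continuous_map (vague_topology C) euclideanreal (\<lambda>w. conf_eval w f)"
  unfolding continuous_map_def
proof (intro conjI allI impI)
  fix U :: "real set" assume "openin euclideanreal U"
  hence U: "open U" by simp
  have "{w \<in> C. conf_eval w f \<in> U} \<in> {{w \<in> C. conf_eval w f \<in> U} | f U.
        continuous_on UNIV f \<and> bounded {x. f x \<noteq> 0} \<and> open U}"
    using assms U by blast
  hence "openin (vague_topology C) {w \<in> C. conf_eval w f \<in> U}"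
    unfolding vague_topology_def by (rule topology_generated_by_Basis)
  thus "openin (vague_topology C) {x \<in> topspace (vague_topology C). conf_eval x f \<in> U}"
    by simp
qed simp

locale loc_finite =
  fixes C :: "'a::euclidean_space set set"
  assumes fin: "w \<in> C \<Longrightarrow> bounded B \<Longrightarrow> finite (w \<inter> B)"
begin

abbreviation "MC \<equiv> borel_of (vague_topology C)"

text \<open>The indicator of \<open>K\<close> is the decreasing limit of tent functions in the
  distance to \<open>K\<close>, whose evaluations are vaguely continuous. Nonemptiness matters
  because \<open>infdist\<close> to the empty set is 0.\<close>

lemma card_compact_measurable:
  assumes K: "compact K" "K \<noteq> {}"
  shows "(\<lambda>w. real (card (w \<inter> K))) \<in> borel_measurable MC"
proof (rule borel_measurable_LIMSEQ_real)
  define f where "f n x = max 0 (1 - real n * infdist x K)" for n x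
  define B where "B = {x. infdist x K \<le> 1}"
  have bB: "bounded B"
  proof -
    obtain r where r: "\<And>x. x \<in> K \<Longrightarrow> norm x \<le> r" using K compact_imp_bounded bounded_iff by metis
    have "norm x \<le> r + 1" if "x \<in> B" for x
    proof -
      obtain y where y: "y \<in> K" "infdist x K = dist x y"
        using infdist_attains_inf[of K x] K by (auto simp: compact_imp_closed)
      have "norm x \<le> norm y + dist x y" using norm_triangle_ineq2[of x y] by (simp add: dist_norm)
      thus ?thesis using r[OF y(1)] y(2) that by (auto simp: B_def)
    qed
    thus ?thesis by (auto simp: bounded_iff)
  qed
  have supp: "{x. f (Suc n) x \<noteq> 0} \<subseteq> B" for n
  proof safe
    fix x assume "f (Suc n) x \<noteq> 0"
    hence "real (Suc n) * infdist x K < 1" by (auto simp: f_def max_def split: if_splits)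
    moreover have "infdist x K \<le> real (Suc n) * infdist x K"
      using infdist_nonneg[of x K] by (simp add: algebra_simps)
    ultimately show "x \<in> B" by (simp add: B_def)
  qed
  \<comment> \<open>The index starts at \<open>Suc n\<close>: with slope 0 the tent is constantly 1
    and its support is unbounded.\<close>
  show "(\<lambda>w. conf_eval w (f (Suc n))) \<in> borel_measurable MC" for n
  proof (intro borel_measurable_continuous_map continuous_map_conf_eval)
    show "continuous_on UNIV (f (Suc n))" unfolding f_def
      by (intro continuous_intros continuous_on_infdist)
    show "bounded {x. f (Suc n) x \<noteq> 0}" using supp bB bounded_subset by blast
  qed
  fix w assume "w \<in> space MC"
  hence w: "w \<in> C" by simp
  have fw: "finite (w \<inter> B)" using fin[OF w bB] .
  have "(\<lambda>n. \<Sum>x\<in>w \<inter> B. f (Suc n) x) \<longlonglongrightarrow> (\<Sum>x\<in>w \<inter> B. indicator K x)"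
  proof (rule tendsto_sum)
    fix x
    show "(\<lambda>n. f (Suc n) x) \<longlonglongrightarrow> indicator K x"
    proof (cases "x \<in> K")
      case True
      thus ?thesis by (simp add: f_def)
    next
      case False
      hence pos: "0 < infdist x K"
        using K infdist_pos_not_in_closed[of K x] by (auto simp: compact_imp_closed)
      obtain n0 where n0: "1 / infdist x K < real n0" using reals_Archimedean2 by blast
      have "f (Suc n) x = 0" if "n \<ge> n0" for n
      proof -
        have "1 / infdist x K < real (Suc n)" using n0 that by linarith
        thus ?thesis using pos by (simp add: f_def field_simps)
      qed
      hence "\<forall>\<^sub>F n in sequentially. f (Suc n) x = indicator K x"
        using False eventually_sequentially by auto
      thus ?thesis by (simp add: tendsto_eventually)
    qed
  qed
  also have "(\<Sum>x\<in>w \<inter> B. indicator K x) = real (card (w \<inter> B \<inter> K))"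
    using fw by (simp add: indicator_def sum.If_cases)
  also have "w \<inter> B \<inter> K = w \<inter> K"
    by (auto simp: B_def)
  finally show "(\<lambda>n. conf_eval w (f (Suc n))) \<longlonglongrightarrow> real (card (w \<inter> K))"
    using conf_eval_eq_sum[OF fw supp] by simp
qed

text \<open>Dynkin induction over the closed sets. Intersecting with a compact \<open>K\<close>
  keeps every count finite, so complements become differences and disjoint unions become
  sums.\<close>

lemma card_Int_measurable:
  assumes B: "B \<in> sets borel" "bounded B"
  shows "(\<lambda>w. real (card (w \<inter> B))) \<in> borel_measurable MC"
proof -
  obtain a where a: "B \<subseteq> cbox (- a) a" using bounded_subset_cbox_symmetric[OF B(2)] by blast
  \<comment> \<open>The extra point 0 keeps \<open>K\<close> nonempty even when the box is
    empty.\<close>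
  define K where "K = insert 0 (cbox (- a) a)"
  have cK: "compact K" "closed K" "K \<noteq> {}" "B \<subseteq> K" using a by (auto simp: K_def compact_imp_closed)
  hence bK: "bounded K" by (simp add: compact_imp_bounded)
  have "Int_stable {S::'a set. closed S}" by (auto simp: Int_stable_def)
  have UN: "\<Union>{S::'a set. closed S} = UNIV" by auto
  have "B \<in> sigma_sets UNIV {S. closed S}" using B(1) by (simp add: borel_eq_closed)
  with \<open>Int_stable {S::'a set. closed S}\<close> subset_Pow_Union[of "{S::'a set. closed S}"]
  have "(\<lambda>w. real (card (w \<inter> (K \<inter> B)))) \<in> borel_measurable MC"
    unfolding UN
  proof (induction B rule: sigma_sets_induct_disjoint)
    case (basic A)
    hence "compact (K \<inter> A)" using cK by (auto intro: compact_Int_closed)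
    thus ?case using card_compact_measurable by (cases "K \<inter> A = {}") auto
  next
    case empty show ?case by simp
  next
    case (compl A)
    have "real (card (w \<inter> K)) - real (card (w \<inter> (K \<inter> A))) = real (card (w \<inter> (K \<inter> (UNIV - A))))"
      if "w \<in> space MC" for w
    proof -
      have f: "finite (w \<inter> K)" using fin bK that by simp
      have "w \<inter> (K \<inter> (UNIV - A)) = (w \<inter> K) - (w \<inter> (K \<inter> A))" by auto
      moreover have "card (w \<inter> (K \<inter> A)) \<le> card (w \<inter> K)" using f by (intro card_mono) auto
      moreover have "finite (w \<inter> (K \<inter> A))" by (rule finite_subset[OF _ f]) auto
      moreover have "w \<inter> (K \<inter> A) \<subseteq> w \<inter> K" by auto
      ultimately
      show ?thesis by (metis card_Diff_subset of_nat_diff)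
    qed
    thus ?case using compl card_compact_measurable[OF cK(1,3)]
      by (subst measurable_cong[of _ _ "\<lambda>w. real (card (w \<inter> K)) - real (card (w \<inter> (K \<inter> A)))"]) auto
  next
    case (union A)
    show ?case
    proof (rule borel_measurable_LIMSEQ_real)
      show "(\<lambda>w. \<Sum>i<n. real (card (w \<inter> (K \<inter> A i)))) \<in> borel_measurable MC" for n
        using union by auto
      fix w assume "w \<in> space MC"
      hence f: "finite (w \<inter> K)" using fin bK by simp
      \<comment> \<open>Only finitely many points of \<open>w\<close> lie in \<open>K\<close>, so
        beyond the largest index needed to catch them the partial unions no longer change.\<close>
      have "\<exists>n0. \<forall>n\<ge>n0. w \<inter> (K \<inter> (\<Union>i. A i)) = (\<Union>i<n. w \<inter> (K \<inter> A i))"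
      proof -
        have "\<forall>x\<in>w \<inter> K. \<exists>i. x \<in> (\<Union>i. A i) \<longrightarrow> x \<in> A i" by auto
        then obtain g where g: "\<And>x. x \<in> w \<inter> K \<Longrightarrow> x \<in> (\<Union>i. A i) \<Longrightarrow> x \<in> A (g x)" by metis
        have gM: "g x < n" if "x \<in> w \<inter> K" "n \<ge> Suc (Max (g ` (w \<inter> K)))" for x n
        proof -
          have "g x \<le> Max (g ` (w \<inter> K))" using f that(1) by (intro Max_ge finite_imageI imageI)
          thus ?thesis using that(2) by simp
        qed
        have "w \<inter> (K \<inter> (\<Union>i. A i)) = (\<Union>i<n. w \<inter> (K \<inter> A i))" if n: "n \<ge> Suc (Max (g ` (w \<inter> K)))" for n
        proof (intro set_eqI iffI)
          fix x assume "x \<in> w \<inter> (K \<inter> (\<Union>i. A i))"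
          thus "x \<in> (\<Union>i<n. w \<inter> (K \<inter> A i))"
            using g[of x] gM[of x n] n by (intro UN_I[of "g x"]) auto
        qed auto
        thus ?thesis by blast
      qed
      then obtain n0 where n0: "\<And>n. n \<ge> n0 \<Longrightarrow> w \<inter> (K \<inter> (\<Union>i. A i)) = (\<Union>i<n. w \<inter> (K \<inter> A i))" by blast
      have "(\<Sum>i<n. real (card (w \<inter> (K \<inter> A i)))) = real (card (w \<inter> (K \<inter> (\<Union>i. A i))))" if "n \<ge> n0" for n
      proof -
        have "card (\<Union>i<n. w \<inter> (K \<inter> A i)) = (\<Sum>i<n. card (w \<inter> (K \<inter> A i)))"
          using union(1) f by (intro card_UN_disjoint) (auto simp: disjoint_family_on_def intro: finite_subset)
        thus ?thesis using n0[OF that] by simp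
      qed
      thus "(\<lambda>n. \<Sum>i<n. real (card (w \<inter> (K \<inter> A i)))) \<longlonglongrightarrow> real (card (w \<inter> (K \<inter> \<Union> (range A))))"
        by (intro tendsto_eventually) (auto simp: eventually_sequentially)
    qed
  qed
  moreover have "K \<inter> B = B" using cK by auto
  ultimately show ?thesis by simp
qed

lemma sets_card_eq:
  assumes "B \<in> sets borel" "bounded B"
  shows "{w \<in> C. card (w \<inter> B) = m} \<in> sets MC"
proof -
  have "{w \<in> space MC. real (card (w \<inter> B)) = real m} \<in> sets MC"
    using card_Int_measurable[OF assms] by measurable
  thus ?thesis by simp
qed

end

section \<open>Cell counts generate the vague topology\<close>

definition cell :: "nat \<Rightarrow> 'a::euclidean_space \<Rightarrow> 'a set" where
  "cell k v = hcube ((1 / 2 ^ k) *\<^sub>R v) (1 / 2 ^ k)"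

text \<open>The bound 4^k is 2^k * 2^k: with cells of side 2^(-k) the grid fills the block from -2^k
  to 2^k, so a single parameter both refines the cells and exhausts space.\<close>

definition grid :: "nat \<Rightarrow> 'a::euclidean_space set" where
  "grid k = lattice (- (4 ^ k)) (4 ^ k)"

lemma borel_cell [measurable]: "cell k v \<in> sets borel"
  by (simp add: cell_def)

lemma bounded_cell [simp]: "bounded (cell k v)"
  by (simp add: cell_def)

lemma finite_grid [simp]: "finite (grid k)"
  by (simp add: grid_def)

lemma disjoint_cells: "u \<in> grid k \<Longrightarrow> v \<in> grid k \<Longrightarrow> u \<noteq> v \<Longrightarrow> cell k u \<inter> cell k v = {}"
  unfolding cell_def grid_def by (rule disjoint_hcubes) auto

lemma disjoint_Int_cells:
  "\<forall>u\<in>grid k. \<forall>v\<in>grid k. u \<noteq> v \<longrightarrow> (w \<inter> cell k u) \<inter> (w \<inter> cell k v) = {}"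
  using disjoint_cells by blast

lemma UN_cells: "(\<Union>v\<in>grid k. cell k v) = block (- (2 ^ k)) (2 ^ k)"
proof -
  have "(4::real) ^ k = 2 ^ k * 2 ^ k" by (simp flip: power_mult_distrib)
  thus ?thesis
    unfolding cell_def grid_def by (subst UN_hcubes) (simp_all add: field_simps)
qed

lemma cell_Times: "cell k (a, b) = cell k a \<times> cell k b"
  by (simp add: cell_def hcube_Times)

lemma grid_Times: "grid k = grid k \<times> grid k"
  unfolding grid_def by (rule lattice_Times)

lemma corner_in_cell: "(1 / 2 ^ k) *\<^sub>R v \<in> cell k v"
  by (auto simp: cell_def hcube_def)

context loc_finite
begin

definition same_cells :: "nat \<Rightarrow> 'a set \<Rightarrow> 'a set \<Rightarrow> bool" where
  "same_cells k w w' \<longleftrightarrow> (\<forall>v\<in>grid k. card (w' \<inter> cell k v) = card (w \<inter> cell k v))"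

text \<open>On every cell \<open>f\<close> is replaced by its value at the lower corner, which
  belongs to the half-open cell. The set \<open>D\<close> confines the error to cells near the
  support: the block grows with \<open>k\<close>, so its total count would not give a bound uniform
  in \<open>k\<close>.\<close>

lemma conf_eval_cell_approx:
  assumes w: "w \<in> C" and supp: "{x. f x \<noteq> 0} \<subseteq> block (- (2 ^ k)) (2 ^ k)"
    and osc: "\<And>v x y. x \<in> cell k v \<Longrightarrow> y \<in> cell k v \<Longrightarrow> \<bar>f x - f y\<bar> \<le> \<eta>"
    and D: "\<And>v. cell k v \<inter> {x. f x \<noteq> 0} \<noteq> {} \<Longrightarrow> cell k v \<subseteq> D"
  shows "\<bar>conf_eval w f - (\<Sum>v\<in>grid k. real (card (w \<inter> cell k v)) * f ((1 / 2 ^ k) *\<^sub>R v))\<bar>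
    \<le> (\<Sum>v | v \<in> grid k \<and> cell k v \<subseteq> D. real (card (w \<inter> cell k v))) * \<eta>"
proof -
  have finc: "finite (w \<inter> cell k v)" for v using fin[OF w] by simp
  have "conf_eval w f = (\<Sum>x\<in>w \<inter> block (- (2 ^ k)) (2 ^ k). f x)"
    using fin[OF w] supp by (intro conf_eval_eq_sum) auto
  also have "w \<inter> block (- (2 ^ k)) (2 ^ k) = (\<Union>v\<in>grid k. w \<inter> cell k v)"
    unfolding UN_cells[symmetric] by auto
  also have "(\<Sum>x\<in>\<dots>. f x) = (\<Sum>v\<in>grid k. \<Sum>x\<in>w \<inter> cell k v. f x)"
    using finc disjoint_Int_cells[of k w] by (intro sum.UNION_disjoint) auto
  finally have "\<bar>conf_eval w f - (\<Sum>v\<in>grid k. real (card (w \<inter> cell k v)) * f ((1 / 2 ^ k) *\<^sub>R v))\<bar>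
    = \<bar>\<Sum>v\<in>grid k. \<Sum>x\<in>w \<inter> cell k v. f x - f ((1 / 2 ^ k) *\<^sub>R v)\<bar>"
    by (simp add: sum_subtractf)
  also have "\<dots> \<le> (\<Sum>v\<in>grid k. \<bar>\<Sum>x\<in>w \<inter> cell k v. f x - f ((1 / 2 ^ k) *\<^sub>R v)\<bar>)"
    by (rule sum_abs)
  also have "\<dots> \<le> (\<Sum>v\<in>grid k. if cell k v \<subseteq> D then real (card (w \<inter> cell k v)) * \<eta> else 0)"
  proof (rule sum_mono)
    fix v :: 'a assume "v \<in> grid k"
    show "\<bar>\<Sum>x\<in>w \<inter> cell k v. f x - f ((1 / 2 ^ k) *\<^sub>R v)\<bar>
      \<le> (if cell k v \<subseteq> D then real (card (w \<inter> cell k v)) * \<eta> else 0)"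
    proof (cases "cell k v \<subseteq> D")
      case True
      have "\<bar>\<Sum>x\<in>w \<inter> cell k v. f x - f ((1 / 2 ^ k) *\<^sub>R v)\<bar> \<le> (\<Sum>x\<in>w \<inter> cell k v. \<bar>f x - f ((1 / 2 ^ k) *\<^sub>R v)\<bar>)"
        by (rule sum_abs)
      also have "\<dots> \<le> (\<Sum>x\<in>w \<inter> cell k v. \<eta>)"
        by (intro sum_mono osc[OF _ corner_in_cell]) auto
      finally show ?thesis using True by simp
    next
      case False
      hence "f x = 0" if "x \<in> cell k v" for x using D that by blast
      thus ?thesis using False corner_in_cell[of k v] by simp
    qed
  qed
  also have "\<dots> = (\<Sum>v | v \<in> grid k \<and> cell k v \<subseteq> D. real (card (w \<inter> cell k v))) * \<eta>"
    by (auto simp: sum.inter_filter sum_distrib_right intro!: sum.cong)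
  finally show ?thesis .
qed

text \<open>The ball is enlarged by 1 and \<delta> is capped at 1, so a point close to the support
  stays in the compact ball; for two points off the support both values are 0.\<close>

lemma uniformly_continuous_bounded_support:
  fixes f :: "'a \<Rightarrow> real"
  assumes f: "continuous_on UNIV f" "{x. f x \<noteq> 0} \<subseteq> cball 0 R" and "0 < \<eta>"
  obtains \<delta> where "0 < \<delta>" "\<And>x y. dist x y < \<delta> \<Longrightarrow> \<bar>f x - f y\<bar> \<le> \<eta>"
proof -
  have "uniformly_continuous_on (cball 0 (R + 1)) f"
    using f by (intro compact_uniformly_continuous continuous_on_subset[OF f(1)]) auto
  then obtain d where d: "0 < d" "\<And>x y. x \<in> cball 0 (R + 1) \<Longrightarrow> y \<in> cball 0 (R + 1) \<Longrightarrow> dist y x < d \<Longrightarrow> dist (f y) (f x) < \<eta>"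
    using \<open>0 < \<eta>\<close> unfolding uniformly_continuous_on_def by blast
  show ?thesis
  proof (rule that[of "min d 1"])
    fix x y :: 'a assume xy: "dist x y < min d 1"
    show "\<bar>f x - f y\<bar> \<le> \<eta>"
    proof (cases "f x = 0 \<and> f y = 0")
      case False
      hence "norm x \<le> R \<or> norm y \<le> R" using f(2) by (auto simp: subset_iff)
      moreover have "norm x \<le> norm y + dist x y" "norm y \<le> norm x + dist x y"
        using norm_triangle_ineq2[of x y] norm_triangle_ineq2[of y x] by (auto simp: dist_norm norm_minus_commute)
      ultimately have "norm x \<le> R + 1" "norm y \<le> R + 1" using xy by auto
      thus ?thesis using d(2)[of y x] xy by (simp add: dist_real_def)
    qed (use \<open>0 < \<eta>\<close> in auto)
  qed (use d in auto)
qed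

text \<open>The approximation and its error involve cell counts only, and these agree for
  \<open>w\<close> and \<open>w'\<close>. The number of points of \<open>w\<close> in
  \<open>D\<close> therefore controls both errors, although \<open>w'\<close> varies freely.\<close>

lemma conf_eval_same_cells:
  assumes w: "w \<in> C" and f: "continuous_on UNIV f" "bounded {x. f x \<noteq> 0}" and "0 < e"
  shows "\<exists>k0. \<forall>k\<ge>k0. \<forall>w'\<in>C. same_cells k w w' \<longrightarrow> \<bar>conf_eval w' f - conf_eval w f\<bar> < e"
proof -
  obtain R where R: "{x. f x \<noteq> 0} \<subseteq> cball 0 R" using bounded_subset_ballD[OF f(2), of 0] ball_subset_cball by (meson subset_trans)
  \<comment> \<open>Two points of one cell are at distance at most \<open>DIM('a)\<close>, so every
    cell meeting the support lies in this ball.\<close>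
  define D :: "'a set" where "D = cball 0 (R + real DIM('a))"
  define n where "n = card (w \<inter> D)"
  \<comment> \<open>Each of the two errors is at most n * \<eta>, and this choice gives 2 * n *
    \<eta> < e, also for n = 0.\<close>
  define \<eta> where "\<eta> = e / (2 * real n + 1)"
  have "0 < \<eta>" using \<open>0 < e\<close> by (simp add: \<eta>_def)
  obtain \<delta> where \<delta>: "0 < \<delta>" "\<And>x y. dist x y < \<delta> \<Longrightarrow> \<bar>f x - f y\<bar> \<le> \<eta>"
    using uniformly_continuous_bounded_support[OF f(1) R \<open>0 < \<eta>\<close>] by blast
  obtain k1 where k1: "\<And>k. k1 \<le> k \<Longrightarrow> {x. f x \<noteq> 0} \<subseteq> block (- (2 ^ k)) (2 ^ k)"
    using bounded_subset_block[OF f(2)] by blast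
  obtain k2 :: nat where k2: "real DIM('a) / \<delta> < 2 ^ k2" using real_arch_pow[of 2] by auto
  have "\<bar>conf_eval w' f - conf_eval w f\<bar> < e"
    if k: "k \<ge> max k1 k2" and w': "w' \<in> C" "same_cells k w w'" for k w'
  proof -
    have "(2::real) ^ k2 \<le> 2 ^ k" using k by (intro power_increasing) auto
    hence "real DIM('a) / \<delta> < 2 ^ k" using k2 by linarith
    hence dk: "real DIM('a) * (1 / 2 ^ k) < \<delta>" using \<delta>(1) by (simp add: field_simps)
    have osc: "\<bar>f x - f y\<bar> \<le> \<eta>" if "x \<in> cell k v" "y \<in> cell k v" for v x y
      using dist_hcube_le[OF that[unfolded cell_def]] dk by (intro \<delta>(2)) linarith
    have cD: "cell k v \<subseteq> D" if ne: "cell k v \<inter> {x. f x \<noteq> 0} \<noteq> {}" for v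
    proof
      fix y assume y: "y \<in> cell k v"
      obtain x where x: "x \<in> cell k v" "f x \<noteq> 0" using ne by blast
      have "dist x y \<le> real DIM('a) * (1 / 2 ^ k)" 
        using dist_hcube_le[OF x(1)[unfolded cell_def] y[unfolded cell_def]] .
      also have "\<dots> \<le> real DIM('a) * 1" by (intro mult_left_mono) (auto simp: field_simps)
      finally have "dist x y \<le> real DIM('a)" by simp
      moreover have "norm x \<le> R" using x R by auto
      moreover have "norm y \<le> norm x + dist x y"
        using norm_triangle_ineq2[of y x] by (auto simp: dist_norm norm_minus_commute)
      ultimately show "y \<in> D" by (simp add: D_def)
    qed
    have kk: "k1 \<le> k" using k by simp
    let ?S = "\<lambda>w. \<Sum>v\<in>grid k. real (card (w \<inter> cell k v)) * f ((1 / 2 ^ k) *\<^sub>R v)"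
    let ?N = "\<lambda>w. \<Sum>v | v \<in> grid k \<and> cell k v \<subseteq> D. real (card (w \<inter> cell k v))"
    have "\<bar>conf_eval u f - ?S u\<bar> \<le> ?N u * \<eta>" if "u \<in> C" for u
      using osc cD by (intro conf_eval_cell_approx[OF that k1[OF kk]]) simp_all
    from this[OF w] this[OF w'(1)]
    have "\<bar>conf_eval w f - ?S w\<bar> \<le> ?N w * \<eta>" "\<bar>conf_eval w' f - ?S w'\<bar> \<le> ?N w' * \<eta>" .
    moreover have "?S w' = ?S w" "?N w' * \<eta> = ?N w * \<eta>" using w'(2) unfolding same_cells_def by auto
    moreover have "?N w * \<eta> \<le> real n * \<eta>"
    proof (intro mult_right_mono)
      have "?N w = real (card (\<Union>v\<in>{v. v \<in> grid k \<and> cell k v \<subseteq> D}. w \<inter> cell k v))"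
        using disjoint_Int_cells[of k w] fin[OF w] by (subst card_UN_disjoint) auto
      also have "\<dots> \<le> real n" unfolding n_def
        using fin[OF w, of D] by (intro of_nat_mono card_mono) (auto simp: D_def)
      finally show "?N w \<le> real n" .
    qed (use \<open>0 < \<eta>\<close> in auto)
    moreover have "2 * (real n * \<eta>) < e"
      using \<open>0 < e\<close> by (simp add: \<eta>_def divide_simps algebra_simps)
    ultimately show ?thesis by linarith
  qed
  thus ?thesis by blast
qed

text \<open>Induction on the generation of open sets. Asking for all levels from \<open>k0\<close>
  on, rather than for a single one, lets finite intersections go through with a maximum.\<close>

lemma openin_same_cells:
  assumes "openin (vague_topology C) G" "w \<in> G"
  shows "\<exists>k0. \<forall>k\<ge>k0. \<forall>w'\<in>C. same_cells k w w' \<longrightarrow> w' \<in> G"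
proof -
  have "generate_topology_on {{w \<in> C. conf_eval w f \<in> U} | f U.
        continuous_on UNIV f \<and> bounded {x. f x \<noteq> 0} \<and> open U} G"
    using assms(1) unfolding vague_topology_def openin_topology_generated_by_iff .
  thus ?thesis using assms(2)
  proof (induction G rule: generate_topology_on.induct)
    case Empty thus ?case by simp
  next
    case (Int a b)
    hence ab: "w \<in> a" "w \<in> b" by auto
    obtain k1 where k1: "\<forall>k\<ge>k1. \<forall>w'\<in>C. same_cells k w w' \<longrightarrow> w' \<in> a" using Int.IH(1)[OF ab(1)] ..
    obtain k2 where k2: "\<forall>k\<ge>k2. \<forall>w'\<in>C. same_cells k w w' \<longrightarrow> w' \<in> b" using Int.IH(2)[OF ab(2)] ..
    show ?case using k1 k2 by (intro exI[of _ "max k1 k2"]) auto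
  next
    case (UN K)
    then obtain a where a: "a \<in> K" "w \<in> a" by auto
    obtain k0 where "\<forall>k\<ge>k0. \<forall>w'\<in>C. same_cells k w w' \<longrightarrow> w' \<in> a" using UN.IH[OF a] ..
    thus ?case using \<open>a \<in> K\<close> by (intro exI[of _ k0]) blast
  next
    case (Basis s)
    then obtain f U where f: "s = {w \<in> C. conf_eval w f \<in> U}" "continuous_on UNIV f"
      "bounded {x. f x \<noteq> 0}" "open U" by blast
    have w: "w \<in> C" "conf_eval w f \<in> U" using Basis.prems f(1) by simp_all
    obtain e where e: "0 < e" "\<forall>y. dist y (conf_eval w f) < e \<longrightarrow> y \<in> U"
      using f(4) w(2) unfolding open_dist by blast
    obtain k0 where "\<forall>k\<ge>k0. \<forall>w'\<in>C. same_cells k w w' \<longrightarrow> \<bar>conf_eval w' f - conf_eval w f\<bar> < e"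
      using conf_eval_same_cells[OF w(1) f(2,3) e(1)] ..
    thus ?case using e(2) unfolding f(1) dist_real_def by (intro exI[of _ k0]) blast
  qed
qed

definition cell_atom :: "nat \<Rightarrow> ('a \<Rightarrow> nat) \<Rightarrow> 'a set set" where
  "cell_atom k m = {w \<in> C. \<forall>v\<in>grid k. card (w \<inter> cell k v) = m v}"

lemma sets_cell_atom [measurable]: "cell_atom k m \<in> sets MC"
proof -
  have "{w \<in> space MC. \<forall>v\<in>grid k. card (w \<inter> cell k v) = m v} \<in> sets MC"
    by (intro sets.sets_Collect_finite_All) (simp_all add: sets_card_eq)
  thus ?thesis by (simp add: cell_atom_def)
qed

text \<open>The atoms need not be open; what counts is that they are measurable and that countably
  many suffice. For this \<open>m\<close> is restricted to extensional functions on the finite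
  grid.\<close>

lemma openin_eq_UN_cell_atom:
  assumes "openin (vague_topology C) G"
  shows "G = (\<Union>(k, m)\<in>{(k, m). m \<in> grid k \<rightarrow>\<^sub>E UNIV \<and> cell_atom k m \<subseteq> G}. cell_atom k m)"
proof (intro equalityI subsetI)
  fix w assume w: "w \<in> G"
  hence wC: "w \<in> C" using openin_subset[OF assms] by auto
  obtain k where k: "\<forall>w'\<in>C. same_cells k w w' \<longrightarrow> w' \<in> G" using openin_same_cells[OF assms w] by blast
  define m where "m = restrict (\<lambda>v. card (w \<inter> cell k v)) (grid k)"
  have "cell_atom k m \<subseteq> G" "w \<in> cell_atom k m"
    using k wC by (auto simp: cell_atom_def m_def same_cells_def)
  thus "w \<in> (\<Union>(k, m)\<in>{(k, m). m \<in> grid k \<rightarrow>\<^sub>E UNIV \<and> cell_atom k m \<subseteq> G}. cell_atom k m)"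
    by (intro UN_I[of "(k, m)"]) (auto simp: m_def)
qed auto

text \<open>Reduces measurability of maps into the configuration space to cell counts.\<close>

lemma sets_MC: "sets MC = sigma_sets C {cell_atom k m | k m. True}"
proof (intro equalityI)
  interpret S: sigma_algebra C "sigma_sets C {cell_atom k m | k m. True}"
    by (rule sigma_algebra_sigma_sets) (auto simp: cell_atom_def)
  show "sets MC \<subseteq> sigma_sets C {cell_atom k m | k m. True}"
    unfolding sets_borel_of topspace_vague_topology
  proof (intro S.sigma_sets_subset subsetI)
    fix G assume "G \<in> {U. openin (vague_topology C) U}"
    hence G: "G = (\<Union>(k, m)\<in>{(k, m). m \<in> grid k \<rightarrow>\<^sub>E UNIV \<and> cell_atom k m \<subseteq> G}. cell_atom k m)"
      (is "_ = \<Union>(_ ` ?I)") by (intro openin_eq_UN_cell_atom) simp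
    have "countable (SIGMA k:UNIV. (grid k :: 'a set) \<rightarrow>\<^sub>E (UNIV :: nat set))"
      by (intro countable_SIGMA countable_PiE) auto
    hence "countable ?I" by (rule countable_subset[rotated]) auto
    hence "(\<Union>i\<in>?I. case i of (k, m) \<Rightarrow> cell_atom k m) \<in> sigma_sets C {cell_atom k m | k m. True}"
    proof (rule S.countable_UN'')
      fix i assume "i \<in> ?I"
      show "(case i of (k, m) \<Rightarrow> cell_atom k m) \<in> sigma_sets C {cell_atom k m | k m. True}"
        by (cases i) (auto intro: sigma_sets.Basic)
    qed
    from subst[OF G[symmetric], of "\<lambda>A. A \<in> _", OF this]
    show "G \<in> sigma_sets C {cell_atom k m | k m. True}" .
  qed
  show "sigma_sets C {cell_atom k m | k m. True} \<subseteq> sets MC"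
    using sets.sigma_sets_subset[of "{cell_atom k m | k m. True}" MC] sets_cell_atom
    unfolding space_borel_of topspace_vague_topology by blast
qed

lemma measurable_into_MC:
  assumes C: "\<And>x. x \<in> space M \<Longrightarrow> f x \<in> C"
    and m: "\<And>k v. (\<lambda>x. real (card (f x \<inter> cell k v))) \<in> borel_measurable M"
  shows "f \<in> measurable M MC"
proof (rule measurable_sigma_sets[OF sets_MC])
  fix A assume "A \<in> {cell_atom k m | k m. True}"
  then obtain k m where A: "A = cell_atom k m" by auto
  have "{x \<in> space M. real (card (f x \<inter> cell k v)) = real (m v)} \<in> sets M" for v
    using m by measurable
  hence "{x \<in> space M. \<forall>v\<in>grid k. card (f x \<inter> cell k v) = m v} \<in> sets M"
    by (intro sets.sets_Collect_finite_All) auto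
  also have "{x \<in> space M. \<forall>v\<in>grid k. card (f x \<inter> cell k v) = m v} = f -` A \<inter> space M"
    using C by (auto simp: A cell_atom_def)
  finally show "f -` A \<inter> space M \<in> sets M" .
qed (use C in \<open>auto simp: cell_atom_def\<close>)

end

section \<open>Weak convergence from generating functions of cell counts\<close>

context loc_finite
begin

text \<open>Here \<open>\<phi> k m\<close> is the infimum of \<Phi> on an atom and
  \<open>\<Psi> k n\<close> keeps finitely many atoms. The limits in \<open>n\<close> and
  \<open>k\<close> are taken under \<open>L\<close> alone; under \<open>M i\<close> only
  \<open>\<Psi> k n \<le> \<Phi>\<close> and the convergence of finitely many atom probabilities
  enter, so no uniformity in \<open>i\<close> is involved.\<close>

lemma integral_liminf_cell_atoms:
  fixes \<Phi> :: "'a set \<Rightarrow> real"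
  assumes M: "\<forall>\<^sub>F i in F. prob_space (M i) \<and> sets (M i) = sets MC"
    and L: "prob_space L" "sets L = sets MC"
    and conv: "\<And>k m. ((\<lambda>i. measure (M i) (cell_atom k m)) \<longlongrightarrow> measure L (cell_atom k m)) F"
    and \<Phi>: "continuous_map (vague_topology C) euclideanreal \<Phi>"
    and bd: "\<And>w. w \<in> C \<Longrightarrow> 0 \<le> \<Phi> w" "\<And>w. w \<in> C \<Longrightarrow> \<Phi> w \<le> B"
    and "0 < e"
  shows "\<forall>\<^sub>F i in F. integral\<^sup>L L \<Phi> - e < integral\<^sup>L (M i) \<Phi>"
proof -
  interpret L: prob_space L by fact
  have spL: "space L = C" using sets_eq_imp_space_eq[OF L(2)] by simp
  have mMC: "\<Phi> \<in> borel_measurable MC" by (rule borel_measurable_continuous_map[OF \<Phi>])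
  have mL: "\<Phi> \<in> borel_measurable L" using mMC measurable_cong_sets[OF L(2) refl] by blast
  have atL: "cell_atom k m \<in> sets L" for k m using L(2) by simp
  \<comment> \<open>An infimum over the empty set has no meaning here; the value 0 keeps \<phi>
    nonnegative.\<close>
  define \<phi> where "\<phi> k m = (if cell_atom k m = {} then 0 else INF w\<in>cell_atom k m. \<Phi> w)" for k m
  have bb: "bdd_below (\<Phi> ` cell_atom k m)" for k m
    using bd(1) by (intro bdd_belowI[of _ 0]) (auto simp: cell_atom_def)
  have \<phi>_le: "\<phi> k m \<le> \<Phi> w" if "w \<in> cell_atom k m" for k m w
    using that cINF_lower[OF bb that] by (auto simp: \<phi>_def)
  have \<phi>_nonneg: "0 \<le> \<phi> k m" for k m
    unfolding \<phi>_def using bd(1) by (auto intro!: cINF_greatest simp: cell_atom_def)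
  define J where "J k n = ((grid k :: 'a set) \<rightarrow>\<^sub>E {..n::nat})" for k n
  have finJ: "finite (J k n)" for k n unfolding J_def by (intro finite_PiE) auto
  define \<Psi> where "\<Psi> k n w = (\<Sum>m\<in>J k n. \<phi> k m * indicator (cell_atom k m) w)" for k n and w :: "'a set"
  define cnt where "cnt k w = restrict (\<lambda>v. card (w \<inter> cell k v)) (grid k)" for k and w :: "'a set"
  have atom_iff: "w \<in> cell_atom k m \<longleftrightarrow> m = cnt k w" if "w \<in> C" "m \<in> J k n" for w k m n
    using that by (auto simp: cell_atom_def cnt_def J_def PiE_def extensional_def restrict_def fun_eq_iff)
  have \<Psi>_eq: "\<Psi> k n w = (if cnt k w \<in> J k n then \<phi> k (cnt k w) else 0)" if "w \<in> C" for k n w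
  proof -
    have "\<Psi> k n w = (\<Sum>m\<in>J k n. if m = cnt k w then \<phi> k m else 0)"
      unfolding \<Psi>_def using atom_iff[OF that] by (intro sum.cong) (auto simp: indicator_def)
    thus ?thesis using finJ by (simp add: sum.delta)
  qed
  have cnt_atom: "w \<in> cell_atom k (cnt k w)" if "w \<in> C" for k w
    using that by (auto simp: cell_atom_def cnt_def)
  have \<Psi>_bd: "0 \<le> \<Psi> k n w" "\<Psi> k n w \<le> \<Phi> w" if "w \<in> C" for k n w
    using \<Psi>_eq[OF that] \<phi>_nonneg \<phi>_le[OF cnt_atom[OF that]] bd(1)[OF that] by auto
  have \<Psi>_lim: "(\<lambda>n. \<Psi> k n w) \<longlonglongrightarrow> \<phi> k (cnt k w)" if "w \<in> C" for k w
  proof (rule tendsto_eventually)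
    define n0 where "n0 = (\<Sum>v\<in>grid k. card (w \<inter> cell k v))"
    have "cnt k w \<in> J k n" if "n \<ge> n0" for n
    proof -
      have "card (w \<inter> cell k v) \<le> n" if "v \<in> grid k" for v
        using member_le_sum[OF that, of "\<lambda>v. card (w \<inter> cell k v)"] \<open>n \<ge> n0\<close> by (simp add: n0_def)
      thus ?thesis by (auto simp: cnt_def J_def)
    qed
    thus "\<forall>\<^sub>F n in sequentially. \<Psi> k n w = \<phi> k (cnt k w)"
      unfolding eventually_sequentially using \<Psi>_eq[OF \<open>w \<in> C\<close>] by auto
  qed
  have \<phi>_lim: "(\<lambda>k. \<phi> k (cnt k w)) \<longlonglongrightarrow> \<Phi> w" if w: "w \<in> C" for w
  proof (rule LIMSEQ_I)
    fix r :: real assume "0 < r"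
    \<comment> \<open>Near \<open>w\<close> the functional exceeds \<open>\<Phi> w - r / 2\<close>,
      hence so does, up to equality, its infimum over a fine enough atom; the upper bound is built
      into the infimum.\<close>
    have "openin (vague_topology C) {w' \<in> C. \<Phi> w' \<in> {\<Phi> w - r / 2<..}}"
      using openin_continuous_map_preimage[OF \<Phi>, of "{\<Phi> w - r / 2<..}"] by simp
    moreover have "w \<in> {w' \<in> C. \<Phi> w' \<in> {\<Phi> w - r / 2<..}}" using w \<open>0 < r\<close> by simp
    ultimately obtain k0 where k0: "\<forall>k\<ge>k0. \<forall>w'\<in>C. same_cells k w w' \<longrightarrow> w' \<in> {w' \<in> C. \<Phi> w' \<in> {\<Phi> w - r / 2<..}}"
      using openin_same_cells by blast
    have "norm (\<phi> k (cnt k w) - \<Phi> w) < r" if "k \<ge> k0" for k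
    proof -
      have ne: "cell_atom k (cnt k w) \<noteq> {}" using cnt_atom[OF w] by blast
      have "\<Phi> w - r / 2 \<le> \<Phi> w'" if "w' \<in> cell_atom k (cnt k w)" for w'
      proof -
        have "w' \<in> C" "same_cells k w w'" using that by (auto simp: cell_atom_def same_cells_def cnt_def)
        thus ?thesis using k0 \<open>k \<ge> k0\<close> by force
      qed
      hence "\<Phi> w - r / 2 \<le> \<phi> k (cnt k w)" using ne by (auto simp: \<phi>_def intro!: cINF_greatest)
      thus ?thesis using \<phi>_le[OF cnt_atom[OF w], of k] \<open>0 < r\<close> by (auto simp: abs_if)
    qed
    thus "\<exists>no. \<forall>n\<ge>no. norm (\<phi> n (cnt n w) - \<Phi> w) < r" by blast
  qed
  have mat: "(\<lambda>w. indicator (cell_atom k m) w :: real) \<in> borel_measurable L" for k m using atL by simp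
  have m\<Psi>: "\<Psi> k n \<in> borel_measurable L" for k n
    unfolding \<Psi>_def using mat by (intro borel_measurable_sum borel_measurable_times) auto
  have m\<phi>: "(\<lambda>w. \<phi> k (cnt k w)) \<in> borel_measurable L" for k
    by (rule borel_measurable_LIMSEQ_real[OF \<Psi>_lim m\<Psi>]) (simp add: spL)
  have l1: "(\<lambda>n. integral\<^sup>L L (\<Psi> k n)) \<longlonglongrightarrow> (\<integral>w. \<phi> k (cnt k w) \<partial>L)" for k
    using \<Psi>_lim \<Psi>_bd bd spL m\<Psi> m\<phi>
    by (intro integral_dominated_convergence[where w = "\<lambda>_. B"]) (auto intro!: AE_I2 order_trans[OF \<Psi>_bd(2)])
  have l2: "(\<lambda>k. \<integral>w. \<phi> k (cnt k w) \<partial>L) \<longlonglongrightarrow> integral\<^sup>L L \<Phi>"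
    using \<phi>_lim \<phi>_nonneg bd spL m\<phi> mL
    by (intro integral_dominated_convergence[where w = "\<lambda>_. B"])
       (auto intro!: AE_I2 order_trans[OF \<phi>_le[OF cnt_atom]])
  obtain k where k: "integral\<^sup>L L \<Phi> - e / 2 < (\<integral>w. \<phi> k (cnt k w) \<partial>L)"
    using order_tendstoD(1)[OF l2, of "integral\<^sup>L L \<Phi> - e / 2"] \<open>0 < e\<close>
    by (auto simp: eventually_sequentially)
  obtain n where n: "integral\<^sup>L L \<Phi> - e / 2 < integral\<^sup>L L (\<Psi> k n)"
    using order_tendstoD(1)[OF l1 k] by (auto simp: eventually_sequentially)
  have int_\<Psi>: "integral\<^sup>L N (\<Psi> k n) = (\<Sum>m\<in>J k n. \<phi> k m * measure N (cell_atom k m))"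
    if "prob_space N" "sets N = sets MC" for N
  proof -
    interpret prob_space N by fact
    have "cell_atom k m \<in> sets N" for m using that(2) by simp
    thus ?thesis unfolding \<Psi>_def
      by (subst Bochner_Integration.integral_sum) (auto simp: integrable_mult_right integrable_indicator_iff less_top[symmetric])
  qed
  have "((\<lambda>i. \<Sum>m\<in>J k n. \<phi> k m * measure (M i) (cell_atom k m)) \<longlongrightarrow> (\<Sum>m\<in>J k n. \<phi> k m * measure L (cell_atom k m))) F"
    by (intro tendsto_sum tendsto_mult tendsto_const conv)
  hence "\<forall>\<^sub>F i in F. integral\<^sup>L L \<Phi> - e / 2 < (\<Sum>m\<in>J k n. \<phi> k m * measure (M i) (cell_atom k m))"
    using n int_\<Psi>[OF L] by (intro order_tendstoD(1)) auto
  thus ?thesis using M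
  proof eventually_elim
    case (elim i)
    then interpret Mi: prob_space "M i" by simp
    have sM: "sets (M i) = sets MC" using elim by simp
    have spM: "space (M i) = C" using sets_eq_imp_space_eq[OF sM] by simp
    have m: "\<Phi> \<in> borel_measurable (M i)" "\<Psi> k n \<in> borel_measurable (M i)"
      using mMC m\<Psi>[of k n] measurable_cong_sets[OF sM refl, of borel] measurable_cong_sets[OF L(2) refl, of borel] by blast+
    have "integral\<^sup>L (M i) (\<Psi> k n) \<le> integral\<^sup>L (M i) \<Phi>"
    proof (rule integral_mono)
      show "integrable (M i) \<Phi>" "integrable (M i) (\<Psi> k n)"
        using m bd \<Psi>_bd spM by (auto intro!: Mi.integrable_const_bound[where B=B] AE_I2 order_trans[OF \<Psi>_bd(2)])
    qed (use \<Psi>_bd spM in auto)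
    thus ?case using elim int_\<Psi>[of "M i"] \<open>0 < e\<close> by auto
  qed
qed

text \<open>The lower bound is applied to \<open>B + \<Phi>\<close> and to
  \<open>B - \<Phi>\<close>, both nonnegative; together they enclose the integral of \<Phi>.\<close>

lemma weakly_converges_cell_atoms:
  assumes M: "\<forall>\<^sub>F i in F. prob_space (M i) \<and> sets (M i) = sets MC"
    and L: "prob_space L" "sets L = sets MC"
    and conv: "\<And>k m. ((\<lambda>i. measure (M i) (cell_atom k m)) \<longlongrightarrow> measure L (cell_atom k m)) F"
  shows "weakly_converges (vague_topology C) M L F"
  unfolding weakly_converges_def topspace_vague_topology
proof (intro allI impI)
  fix \<Phi> :: "'a set \<Rightarrow> real"
  assume \<Phi>: "continuous_map (vague_topology C) euclideanreal \<Phi> \<and> bounded (\<Phi> ` C)"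
  then obtain B where B: "\<And>w. w \<in> C \<Longrightarrow> \<bar>\<Phi> w\<bar> \<le> B" by (auto simp: bounded_iff)
  have mMC: "\<Phi> \<in> borel_measurable MC" using borel_measurable_continuous_map \<Phi> by blast
  have int: "integral\<^sup>L N (\<lambda>w. B + \<Phi> w) = B + integral\<^sup>L N \<Phi>" "integral\<^sup>L N (\<lambda>w. B - \<Phi> w) = B - integral\<^sup>L N \<Phi>"
    if N: "prob_space N" "sets N = sets MC" for N
  proof -
    interpret prob_space N by fact
    have "\<Phi> \<in> borel_measurable N" using mMC measurable_cong_sets[OF N(2) refl] by blast
    hence "integrable N \<Phi>"
      using B sets_eq_imp_space_eq[OF N(2)] by (auto intro!: integrable_const_bound[where B=B] AE_I2)
    thus "integral\<^sup>L N (\<lambda>w. B + \<Phi> w) = B + integral\<^sup>L N \<Phi>" "integral\<^sup>L N (\<lambda>w. B - \<Phi> w) = B - integral\<^sup>L N \<Phi>"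
      by (simp_all add: prob_space)
  qed
  have c: "continuous_map (vague_topology C) euclideanreal (\<lambda>w. B + \<Phi> w)"
    "continuous_map (vague_topology C) euclideanreal (\<lambda>w. B - \<Phi> w)"
    using \<Phi> by (intro continuous_intros; simp)+
  have b: "0 \<le> B + \<Phi> w" "B + \<Phi> w \<le> 2 * B" "0 \<le> B - \<Phi> w" "B - \<Phi> w \<le> 2 * B" if "w \<in> C" for w
    using B[OF that] by auto
  show "((\<lambda>i. integral\<^sup>L (M i) \<Phi>) \<longlongrightarrow> integral\<^sup>L L \<Phi>) F"
  proof (rule tendstoI)
    fix e :: real assume "0 < e"
    have "\<forall>\<^sub>F i in F. (\<integral>w. B + \<Phi> w \<partial>L) - e < (\<integral>w. B + \<Phi> w \<partial>M i)"
      by (rule integral_liminf_cell_atoms[where B="2 * B", OF M L conv c(1) _ _ \<open>0 < e\<close>]) (use b in auto)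
    moreover have "\<forall>\<^sub>F i in F. (\<integral>w. B - \<Phi> w \<partial>L) - e < (\<integral>w. B - \<Phi> w \<partial>M i)"
      by (rule integral_liminf_cell_atoms[where B="2 * B", OF M L conv c(2) _ _ \<open>0 < e\<close>]) (use b in auto)
    ultimately show "\<forall>\<^sub>F i in F. dist (integral\<^sup>L (M i) \<Phi>) (integral\<^sup>L L \<Phi>) < e"
      using M
    proof eventually_elim
      case (elim i)
      thus ?case using int[OF L] int[of "M i"] by (auto simp: dist_real_def)
    qed
  qed
qed

end

text \<open>For \<open>t\<close> small, \<open>1{N = j}\<close> is uniformly close to
  \<open>(t^N - \<Sum>k<j. t^k 1{N = k}) / t^j\<close>.\<close>

lemma count_indicator_closure:
  fixes N :: "'i \<Rightarrow> 'w \<Rightarrow> nat" and H :: "('w \<Rightarrow> real) \<Rightarrow> bool"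
  assumes "finite D"
    and add: "\<And>f g. H f \<Longrightarrow> H g \<Longrightarrow> H (\<lambda>w. f w + g w)"
    and scale: "\<And>f c. H f \<Longrightarrow> H (\<lambda>w. c * f w)"
    and lim: "\<And>f. (\<And>e. 0 < e \<Longrightarrow> \<exists>g. H g \<and> (\<forall>w. \<bar>f w - g w\<bar> \<le> e)) \<Longrightarrow> H f"
    and pow: "\<And>s. (\<And>i. i \<in> D \<Longrightarrow> 0 < s i \<and> s i \<le> 1) \<Longrightarrow> H (\<lambda>w. \<Prod>i\<in>D. s i ^ N i w)"
  shows "H (\<lambda>w. \<Prod>i\<in>D. of_bool (N i w = m i))"
proof -
  have sumH: "H (\<lambda>w. \<Sum>k\<in>K. f k w)" if "finite K" "\<And>k. k \<in> K \<Longrightarrow> H (f k)" for f :: "nat \<Rightarrow> 'w \<Rightarrow> real" and K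
    using that
  proof (induction K)
    case empty
    show ?case using scale[OF pow[of "\<lambda>_. 1"], of 0] by simp
  next
    case (insert x F)
    thus ?case using add by simp
  qed
  \<comment> \<open>Powers are turned into indicators one index at a time. The parameters
    \<open>s\<close> stay arbitrary in the induction, so that \<open>s a\<close> can be replaced by
    a small \<open>t\<close>.\<close>
  have "H (\<lambda>w. (\<Prod>i\<in>A. of_bool (N i w = m i)) * (\<Prod>i\<in>D - A. s i ^ N i w))"
    if "finite A" "A \<subseteq> D" "\<And>i. i \<in> D \<Longrightarrow> 0 < s i \<and> s i \<le> 1" for A s
    using that
  proof (induction A arbitrary: s)
    case empty
    thus ?case using pow by simp
  next
    case (insert a A)
    define R where "R w = (\<Prod>i\<in>A. of_bool (N i w = m i)) * (\<Prod>i\<in>D - insert a A. s i ^ N i w)" for w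
    have R: "0 \<le> R w \<and> R w \<le> 1" for w
    proof -
      have "0 \<le> (\<Prod>i\<in>A. of_bool (N i w = m i) :: real) \<and> (\<Prod>i\<in>A. of_bool (N i w = m i) :: real) \<le> 1"
        by (auto intro!: prod_nonneg prod_le_1)
      moreover have "0 \<le> (\<Prod>i\<in>D - insert a A. s i ^ N i w) \<and> (\<Prod>i\<in>D - insert a A. s i ^ N i w) \<le> 1"
        using insert.prems by (auto intro!: prod_nonneg prod_le_1 power_le_one zero_le_power simp: less_imp_le)
      ultimately show ?thesis unfolding R_def by (auto intro!: mult_le_one)
    qed
    have pw: "H (\<lambda>w. t ^ N a w * R w)" if t: "0 < t" "t \<le> 1" for t
    proof -
      have D: "D - A = insert a (D - insert a A)" using insert by auto
      have "H (\<lambda>w. (\<Prod>i\<in>A. of_bool (N i w = m i)) * (\<Prod>i\<in>D - A. (s(a := t)) i ^ N i w))"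
        using insert t by (intro insert.IH) auto
      also have "(\<lambda>w. (\<Prod>i\<in>A. of_bool (N i w = m i)) * (\<Prod>i\<in>D - A. (s(a := t)) i ^ N i w)) = (\<lambda>w. t ^ N a w * R w)"
        unfolding D R_def using \<open>finite D\<close> by (subst prod.insert) (auto simp: fun_eq_iff)
      finally show ?thesis .
    qed
    have "H (\<lambda>w. of_bool (N a w = j) * R w)" for j
    proof (induction j rule: less_induct)
      case (less j)
      show ?case
      proof (rule lim)
        fix e :: real assume "0 < e"
        \<comment> \<open>Counts below \<open>j\<close> are removed by the inner induction
          hypothesis, and a count N above \<open>j\<close> leaves at most t^(N - j) \<le> t \<le>
          e.\<close>
        define t where "t = min e 1"
        have t: "0 < t" "t \<le> 1" "t \<le> e" using \<open>0 < e\<close> by (auto simp: t_def)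
        define g where "g w = (1 / t ^ j) * (t ^ N a w * R w + (-1) * (\<Sum>k<j. t ^ k * (of_bool (N a w = k) * R w)))" for w
        have "H g" unfolding g_def
          by (intro scale add pw t sumH less) auto
        moreover have "\<bar>of_bool (N a w = j) * R w - g w\<bar> \<le> e" for w
        proof -
          have s: "(\<Sum>k<j. t ^ k * (of_bool (N a w = k) * R w)) = (if N a w < j then t ^ N a w * R w else 0)"
            by (subst sum.cong[OF refl, of _ _ "\<lambda>k. if k = N a w then t ^ k * R w else 0"]) (auto simp: sum.delta)
          consider "N a w < j" | "N a w = j" | "N a w > j" by linarith
          thus ?thesis
          proof cases
            case 3
            have "g w = t ^ (N a w - j) * R w"
              using 3 t by (simp add: g_def s power_diff)
            moreover have "t ^ (N a w - j) * R w \<le> t ^ 1 * 1"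
              using 3 t R[of w] by (intro mult_mono power_decreasing) auto
            ultimately show ?thesis using 3 t R[of w] by simp
          qed (use t in \<open>auto simp: g_def s\<close>)
        qed
        ultimately show "\<exists>g. H g \<and> (\<forall>w. \<bar>of_bool (N a w = j) * R w - g w\<bar> \<le> e)" by blast
      qed
    qed
    from this[of "m a"] show ?case
      using insert.hyps by (simp add: R_def mult.assoc)
  qed
  from this[of D "\<lambda>_. 1"] show ?thesis using \<open>finite D\<close> by simp
qed

context loc_finite
begin

definition gf :: "'i set \<Rightarrow> ('i \<Rightarrow> 'a set) \<Rightarrow> ('i \<Rightarrow> real) \<Rightarrow> 'a set \<Rightarrow> real" where
  "gf D B s w = (\<Prod>i\<in>D. s i ^ card (w \<inter> B i))"

lemma card_Int_measurable_count_space: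
  assumes "B \<in> sets borel" "bounded B"
  shows "(\<lambda>w. card (w \<inter> B)) \<in> measurable MC (count_space UNIV)"
  unfolding measurable_count_space_eq2_countable
proof -
  show "(\<lambda>w. card (w \<inter> B)) \<in> space MC \<rightarrow> UNIV \<and> (\<forall>n\<in>UNIV. (\<lambda>w. card (w \<inter> B)) -` {n} \<inter> space MC \<in> sets MC)"
  proof (intro conjI ballI)
    fix n
    have "(\<lambda>w. card (w \<inter> B)) -` {n} \<inter> space MC = {w \<in> C. card (w \<inter> B) = n}" by auto
    thus "(\<lambda>w. card (w \<inter> B)) -` {n} \<inter> space MC \<in> sets MC" using sets_card_eq[OF assms] by simp
  qed simp
qed

lemma gf_measurable:
  assumes "finite D" "\<And>i. i \<in> D \<Longrightarrow> B i \<in> sets borel \<and> bounded (B i)"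
  shows "gf D B s \<in> borel_measurable MC"
  unfolding gf_def
proof (rule borel_measurable_prod)
  fix i assume "i \<in> D"
  hence "(\<lambda>w. card (w \<inter> B i)) \<in> measurable MC (count_space UNIV)"
    using assms(2) by (intro card_Int_measurable_count_space) auto
  thus "(\<lambda>w. s i ^ card (w \<inter> B i)) \<in> borel_measurable MC"
    by (rule measurable_compose) simp
qed

lemma gf_bounds:
  assumes "\<And>i. i \<in> D \<Longrightarrow> 0 \<le> s i \<and> s i \<le> 1"
  shows "0 \<le> gf D B s w" "gf D B s w \<le> 1"
  unfolding gf_def using assms by (auto intro!: prod_nonneg prod_le_1 power_le_one zero_le_power)

text \<open>The closure result is applied to the class \<open>H\<close> of bounded measurable
  functionals whose integrals converge; a product of count indicators over the grid is the indicator
  of a cell atom.\<close>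

lemma weakly_converges_gf:
  assumes M: "\<forall>\<^sub>F i in F. prob_space (M i) \<and> sets (M i) = sets MC"
    and L: "prob_space L" "sets L = sets MC"
    and conv: "\<And>k s. (\<And>v. v \<in> grid k \<Longrightarrow> 0 < s v \<and> s v \<le> 1) \<Longrightarrow>
      ((\<lambda>i. integral\<^sup>L (M i) (gf (grid k) (cell k) s)) \<longlongrightarrow> integral\<^sup>L L (gf (grid k) (cell k) s)) F"
  shows "weakly_converges (vague_topology C) M L F"
proof (rule weakly_converges_cell_atoms[OF M L])
  fix k and m :: "'a \<Rightarrow> nat"
  define H where "H f \<longleftrightarrow> f \<in> borel_measurable MC \<and> (\<exists>b. \<forall>w. \<bar>f w\<bar> \<le> b) \<and>
      ((\<lambda>i. integral\<^sup>L (M i) f) \<longlongrightarrow> integral\<^sup>L L f) F" for f :: "'a set \<Rightarrow> real"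
  have int: "integrable N f" if N: "prob_space N \<and> sets N = sets MC" and f: "f \<in> borel_measurable MC" "\<exists>b. \<forall>w. \<bar>f w\<bar> \<le> b"
    for N and f :: "'a set \<Rightarrow> real"
  proof -
    interpret prob_space N using N by simp
    obtain b where b: "\<And>w. \<bar>f w\<bar> \<le> b" using f(2) by blast
    have "f \<in> borel_measurable N" using f(1) N measurable_cong_sets[of N MC borel borel] by blast
    thus ?thesis using b by (intro integrable_const_bound[where B=b]) auto
  qed
  have HI: "H f" if "f \<in> borel_measurable MC" "\<And>w. \<bar>f w\<bar> \<le> b"
      "((\<lambda>i. integral\<^sup>L (M i) f) \<longlongrightarrow> integral\<^sup>L L f) F" for f b
    using that unfolding H_def by blast
  have HD: "f \<in> borel_measurable MC" "\<exists>b. \<forall>w. \<bar>f w\<bar> \<le> b"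
      "((\<lambda>i. integral\<^sup>L (M i) f) \<longlongrightarrow> integral\<^sup>L L f) F" if "H f" for f
    using that unfolding H_def by simp_all
  have "H (\<lambda>w. \<Prod>v\<in>grid k. (of_bool (card (w \<inter> cell k v) = m v) :: real))"
  proof (rule count_indicator_closure)
    fix f g assume fg: "H f" "H g"
    obtain b where b: "\<And>w. \<bar>f w\<bar> \<le> b" using HD(2)[OF fg(1)] by blast
    obtain c where c: "\<And>w. \<bar>g w\<bar> \<le> c" using HD(2)[OF fg(2)] by blast
    have eq: "integral\<^sup>L N (\<lambda>w. f w + g w) = integral\<^sup>L N f + integral\<^sup>L N g"
      if "prob_space N \<and> sets N = sets MC" for N
      using int[OF that HD(1,2)[OF fg(1)]] int[OF that HD(1,2)[OF fg(2)]]
      by (rule Bochner_Integration.integral_add)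
    show "H (\<lambda>w. f w + g w)"
    proof (rule HI[of _ "b + c"])
      show "\<bar>f w + g w\<bar> \<le> b + c" for w using b[of w] c[of w] by linarith
      show "((\<lambda>i. integral\<^sup>L (M i) (\<lambda>w. f w + g w)) \<longlongrightarrow> integral\<^sup>L L (\<lambda>w. f w + g w)) F"
      proof (rule Lim_transform_eventually)
        show "((\<lambda>i. integral\<^sup>L (M i) f + integral\<^sup>L (M i) g) \<longlongrightarrow> integral\<^sup>L L (\<lambda>w. f w + g w)) F"
          unfolding eq[OF conjI[OF L]] by (rule tendsto_add[OF HD(3)[OF fg(1)] HD(3)[OF fg(2)]])
        show "\<forall>\<^sub>F i in F. integral\<^sup>L (M i) f + integral\<^sup>L (M i) g = integral\<^sup>L (M i) (\<lambda>w. f w + g w)"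
          using M by eventually_elim (simp add: eq)
      qed
    qed (intro borel_measurable_add HD(1) fg)
  next
    fix f c assume f: "H f"
    obtain b where b: "\<And>w. \<bar>f w\<bar> \<le> b" using HD(2)[OF f] by blast
    show "H (\<lambda>w. c * f w)"
    proof (rule HI[of _ "\<bar>c\<bar> * b"])
      show "\<bar>c * f w\<bar> \<le> \<bar>c\<bar> * b" for w using b by (simp add: abs_mult mult_left_mono)
      show "((\<lambda>i. integral\<^sup>L (M i) (\<lambda>w. c * f w)) \<longlongrightarrow> integral\<^sup>L L (\<lambda>w. c * f w)) F"
        using tendsto_mult[OF tendsto_const[of c] HD(3)[OF f]] by simp
      show "(\<lambda>w. c * f w) \<in> borel_measurable MC" using HD(1)[OF f] by simp
    qed
  next
    fix f assume f: "\<And>e. 0 < e \<Longrightarrow> \<exists>g. H g \<and> (\<forall>w. \<bar>f w - g w\<bar> \<le> e)"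
    have "\<forall>n. \<exists>g. H g \<and> (\<forall>w. \<bar>f w - g w\<bar> \<le> inverse (real (Suc n)))" using f by simp
    then obtain g where g: "\<And>n. H (g n)" "\<And>n w. \<bar>f w - g n w\<bar> \<le> inverse (real (Suc n))" by metis
    have fm: "f \<in> borel_measurable MC"
    proof (rule borel_measurable_LIMSEQ_real)
      show "g n \<in> borel_measurable MC" for n using HD(1)[OF g(1)] .
      fix w
      have "(\<lambda>n. f w - g n w) \<longlonglongrightarrow> 0"
        by (rule Lim_null_comparison[OF _ LIMSEQ_inverse_real_of_nat]) (simp add: g(2) del: of_nat_Suc)
      from tendsto_diff[OF tendsto_const[of "f w"] this] show "(\<lambda>n. g n w) \<longlonglongrightarrow> f w" by simp
    qed
    obtain b where b: "\<And>w. \<bar>g 0 w\<bar> \<le> b" using HD(2)[OF g(1)[of 0]] by blast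
    have fb: "\<bar>f w\<bar> \<le> b + 1" for w 
    proof -
      have "\<bar>f w - g 0 w\<bar> \<le> 1" using g(2)[of w 0] by simp
      thus ?thesis using b[of w] by linarith
    qed
    \<comment> \<open>This bound holds for every probability measure \<open>N\<close> at once, so
      uniform approximation can be interchanged with the limit along \<open>F\<close>.\<close>
    have close: "\<bar>integral\<^sup>L N f - integral\<^sup>L N h\<bar> \<le> e"
      if N: "prob_space N \<and> sets N = sets MC" and h: "H h" "\<And>w. \<bar>f w - h w\<bar> \<le> e" for N h e
    proof -
      interpret prob_space N using N by simp
      have fb': "\<exists>b. \<forall>w. \<bar>f w\<bar> \<le> b" using fb by blast
      have i: "integrable N f" "integrable N h"
        by (rule int[OF N fm fb'], rule int[OF N HD(1,2)[OF h(1)]])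
      have "\<bar>integral\<^sup>L N f - integral\<^sup>L N h\<bar> = \<bar>\<integral>w. f w - h w \<partial>N\<bar>" using i by simp
      also have "\<dots> \<le> (\<integral>w. \<bar>f w - h w\<bar> \<partial>N)" by (rule integral_abs_bound)
      also have "\<dots> \<le> (\<integral>w. e \<partial>N)" using i h by (intro integral_mono) auto
      finally show ?thesis by (simp add: prob_space)
    qed
    have "((\<lambda>i. integral\<^sup>L (M i) f) \<longlongrightarrow> integral\<^sup>L L f) F"
    proof (rule tendstoI)
      fix e :: real assume "0 < e"
      obtain h where h: "H h" "\<And>w. \<bar>f w - h w\<bar> \<le> e / 4" using f[of "e / 4"] \<open>0 < e\<close> by auto
      have "\<forall>\<^sub>F i in F. dist (integral\<^sup>L (M i) h) (integral\<^sup>L L h) < e / 4"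
        using HD(3)[OF h(1)] \<open>0 < e\<close> by (intro tendstoD) auto
      thus "\<forall>\<^sub>F i in F. dist (integral\<^sup>L (M i) f) (integral\<^sup>L L f) < e"
        using M
      proof eventually_elim
        case (elim i)
        have "\<bar>integral\<^sup>L (M i) f - integral\<^sup>L (M i) h\<bar> \<le> e / 4" "\<bar>integral\<^sup>L L f - integral\<^sup>L L h\<bar> \<le> e / 4"
          using close[OF elim(2) h] close[OF conjI[OF L] h] .
        thus ?case using elim(1) \<open>0 < e\<close> unfolding dist_real_def by linarith
      qed
    qed
    thus "H f" by (rule HI[OF fm fb])
  next
    fix s :: "'a \<Rightarrow> real" assume s: "\<And>v. v \<in> grid k \<Longrightarrow> 0 < s v \<and> s v \<le> 1"
    have "\<bar>gf (grid k) (cell k) s w\<bar> \<le> 1" for w using gf_bounds[of "grid k" s "cell k" w] s by (simp add: less_imp_le)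
    hence "H (gf (grid k) (cell k) s)"
      by (intro HI[OF gf_measurable _ conv[OF s]]) auto
    thus "H (\<lambda>w. \<Prod>v\<in>grid k. s v ^ card (w \<inter> cell k v))" unfolding gf_def .
  qed simp
  hence lim: "((\<lambda>i. integral\<^sup>L (M i) (\<lambda>w. \<Prod>v\<in>grid k. (of_bool (card (w \<inter> cell k v) = m v) :: real)))
      \<longlongrightarrow> integral\<^sup>L L (\<lambda>w. \<Prod>v\<in>grid k. (of_bool (card (w \<inter> cell k v) = m v) :: real))) F"
    by (rule HD(3))
  have eq: "integral\<^sup>L N (\<lambda>w. \<Prod>v\<in>grid k. (of_bool (card (w \<inter> cell k v) = m v) :: real)) = measure N (cell_atom k m)"
    if N: "prob_space N \<and> sets N = sets MC" for N
  proof -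
    interpret prob_space N using N by simp
    have sp: "space N = C" using N sets_eq_imp_space_eq[of N MC] by simp
    hence "integral\<^sup>L N (\<lambda>w. \<Prod>v\<in>grid k. (of_bool (card (w \<inter> cell k v) = m v) :: real)) = integral\<^sup>L N (indicator (cell_atom k m))"
      by (intro Bochner_Integration.integral_cong) (auto simp: cell_atom_def indicator_def)
    also have "\<dots> = measure N (cell_atom k m \<inter> space N)" by simp
    also have "cell_atom k m \<inter> space N = cell_atom k m" by (auto simp: cell_atom_def sp)
    finally show ?thesis .
  qed
  show "((\<lambda>i. measure (M i) (cell_atom k m)) \<longlongrightarrow> measure L (cell_atom k m)) F"
  proof (rule Lim_transform_eventually)
    show "((\<lambda>i. integral\<^sup>L (M i) (\<lambda>w. \<Prod>v\<in>grid k. (of_bool (card (w \<inter> cell k v) = m v) :: real)))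
      \<longlongrightarrow> measure L (cell_atom k m)) F"
      using lim unfolding eq[OF conjI[OF L]] .
    show "\<forall>\<^sub>F i in F. integral\<^sup>L (M i) (\<lambda>w. \<Prod>v\<in>grid k. (of_bool (card (w \<inter> cell k v) = m v) :: real))
        = measure (M i) (cell_atom k m)"
      using M by eventually_elim (rule eq)
  qed
qed

end

section \<open>Randomization\<close>

interpretation configs: loc_finite "configs :: (real^'n) set set"
  by unfold_locales (simp add: configs_def)

text \<open>The projection of a bounded set is bounded and meets finitely many positions; each
  position carries one mark, so finitely many marked points remain.\<close>

interpretation marked: loc_finite "marked_configs :: ((real^'n) \<times> real) set set"
proof
  fix w :: "((real^'n) \<times> real) set" and B :: "((real^'n) \<times> real) set"
  assume w: "w \<in> marked_configs" and B: "bounded B"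
  have "bounded (fst ` B)" by (rule bounded_fst[OF B])
  hence "finite (fst ` w \<inter> fst ` B)" using w by (simp add: marked_configs_def configs_def)
  hence "finite (fst ` (w \<inter> B))" by (rule rev_finite_subset) auto
  moreover have "inj_on fst (w \<inter> B)" using w by (auto simp: marked_configs_def intro: inj_on_subset)
  ultimately show "finite (w \<inter> B)" by (rule finite_imageD)
qed

lemma configs_finite: "X \<in> configs \<Longrightarrow> bounded B \<Longrightarrow> finite (X \<inter> B)"
  by (simp add: configs_def)

definition mark_conf :: "(real^'n) set \<Rightarrow> (real^'n \<Rightarrow> real) \<Rightarrow> ((real^'n) \<times> real) set" where
  "mark_conf X E = (\<lambda>x. (x, E x)) ` X"

text \<open>The kernel inside the \<open>bind\<close> of \<open>randomization\<close>, isolated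
  because the \<open>bind\<close> can be evaluated only once this map is known to be measurable in
  \<open>X\<close>.\<close>

definition mark_kernel :: "real measure \<Rightarrow> (real^'n) set \<Rightarrow> ((real^'n) \<times> real) set measure" where
  "mark_kernel \<nu> X = distr (\<Pi>\<^sub>M x\<in>X. \<nu>) marked_config_space (mark_conf X)"

lemma randomization_eq: "randomization P \<nu> = bind P (mark_kernel \<nu>)"
  by (simp add: randomization_def mark_kernel_def[abs_def] mark_conf_def[abs_def])

lemma mark_conf_in: "X \<in> configs \<Longrightarrow> mark_conf X E \<in> marked_configs"
  by (auto simp: marked_configs_def mark_conf_def image_image inj_on_def)

lemma card_mark_conf: "card (mark_conf X E \<inter> (B \<times> I)) = card {x \<in> X \<inter> B. E x \<in> I}"
proof -
  have "mark_conf X E \<inter> (B \<times> I) = (\<lambda>x. (x, E x)) ` {x \<in> X \<inter> B. E x \<in> I}"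
    by (auto simp: mark_conf_def)
  thus ?thesis by (simp add: card_image inj_on_def)
qed

text \<open>A bounded cell meets \<open>X\<close> in finitely many points, so the count is a finite
  sum of functions of single coordinates of \<open>E\<close>, even when \<open>X\<close> is
  infinite.\<close>

lemma mark_conf_measurable:
  fixes X :: "(real^'n) set"
  assumes X: "X \<in> configs" and \<nu>: "sets \<nu> = sets borel"
  shows "mark_conf X \<in> measurable (\<Pi>\<^sub>M x\<in>X. \<nu>) marked_config_space"
proof (rule marked.measurable_into_MC)
  show "mark_conf X E \<in> marked_configs" for E using mark_conf_in[OF X] .
  fix k and v :: "(real^'n) \<times> real"
  obtain a e where v: "v = (a, e)" by (cases v)
  have fin: "finite (X \<inter> cell k a)" using configs_finite[OF X] by simp
  have eq: "real (card (mark_conf X E \<inter> cell k v)) = (\<Sum>x\<in>X \<inter> cell k a. indicator (cell k e) (E x))" for E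
    unfolding v cell_Times card_mark_conf using fin by (simp add: indicator_def sum.If_cases Int_def conj_ac)
  have "(\<lambda>E. \<Sum>x\<in>X \<inter> cell k a. indicator (cell k e) (E x) :: real) \<in> borel_measurable (\<Pi>\<^sub>M x\<in>X. \<nu>)"
  proof (rule borel_measurable_sum)
    fix x assume "x \<in> X \<inter> cell k a"
    hence "(\<lambda>E. E x) \<in> measurable (\<Pi>\<^sub>M x\<in>X. \<nu>) \<nu>" by (intro measurable_component_singleton) auto
    hence "(\<lambda>E. E x) \<in> borel_measurable (\<Pi>\<^sub>M x\<in>X. \<nu>)" using \<nu> measurable_cong_sets[OF refl \<nu>] by blast
    thus "(\<lambda>E. indicator (cell k e) (E x) :: real) \<in> borel_measurable (\<Pi>\<^sub>M x\<in>X. \<nu>)"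
      by (rule measurable_compose) simp
  qed
  thus "(\<lambda>E. real (card (mark_conf X E \<inter> cell k v))) \<in> borel_measurable (\<Pi>\<^sub>M x\<in>X. \<nu>)"
    unfolding eq .
qed

lemma sets_mark_kernel [simp]: "sets (mark_kernel \<nu> X) = sets marked_config_space"
  by (simp add: mark_kernel_def)

lemma prob_space_mark_kernel:
  assumes "X \<in> configs" "sets \<nu> = sets borel" "prob_space \<nu>"
  shows "prob_space (mark_kernel \<nu> X)"
  unfolding mark_kernel_def
  by (intro prob_space.prob_space_distr prob_space_PiM assms mark_conf_measurable)

text \<open>The factor that one point at \<open>x\<close> with mark \<open>E\<close> contributes to
  the generating function of the family \<open>B i \<times> I i\<close>.\<close>

definition mark_weight :: "'i set \<Rightarrow> ('i \<Rightarrow> (real^'n) set) \<Rightarrow> ('i \<Rightarrow> real set) \<Rightarrow> ('i \<Rightarrow> real) \<Rightarrow> real^'n \<Rightarrow> real \<Rightarrow> real"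
  where "mark_weight D B I s x E = (\<Prod>i\<in>D. if x \<in> B i \<and> E \<in> I i then s i else 1)"

lemma mark_weight_bounds:
  assumes "\<And>i. i \<in> D \<Longrightarrow> 0 \<le> s i \<and> s i \<le> 1"
  shows "0 \<le> mark_weight D B I s x E" "mark_weight D B I s x E \<le> 1"
  unfolding mark_weight_def using assms by (auto intro!: prod_nonneg prod_le_1)

lemma mark_weight_measurable [measurable]:
  assumes "finite D" "\<And>i. i \<in> D \<Longrightarrow> I i \<in> sets borel"
  shows "mark_weight D B I s x \<in> borel_measurable borel"
  unfolding mark_weight_def[abs_def]
proof (rule borel_measurable_prod)
  fix i assume "i \<in> D"
  hence "I i \<in> sets borel" using assms by blast
  hence "(\<lambda>E. if E \<in> I i then s i else 1) \<in> borel_measurable borel" by simp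
  thus "(\<lambda>E. if x \<in> B i \<and> E \<in> I i then s i else 1) \<in> borel_measurable borel" by (cases "x \<in> B i") simp_all
qed

lemma gf_mark_conf:
  assumes X: "X \<in> configs" and D: "finite D" and B: "\<And>i. i \<in> D \<Longrightarrow> bounded (B i)"
  shows "marked.gf D (\<lambda>i. B i \<times> I i) s (mark_conf X E)
    = (\<Prod>x\<in>X \<inter> (\<Union>i\<in>D. B i). mark_weight D B I s x (E x))"
proof -
  have fin: "finite (X \<inter> (\<Union>i\<in>D. B i))" using configs_finite[OF X] D B by (simp add: bounded_UN)
  have "marked.gf D (\<lambda>i. B i \<times> I i) s (mark_conf X E)
     = (\<Prod>i\<in>D. \<Prod>x\<in>X \<inter> (\<Union>i\<in>D. B i). if x \<in> B i \<and> E x \<in> I i then s i else 1)"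
    unfolding marked.gf_def
  proof (rule prod.cong[OF refl])
    fix i assume i: "i \<in> D"
    have "(\<Prod>x\<in>X \<inter> (\<Union>i\<in>D. B i). if x \<in> B i \<and> E x \<in> I i then s i else 1)
       = (\<Prod>x\<in>{x \<in> X \<inter> (\<Union>i\<in>D. B i). x \<in> B i \<and> E x \<in> I i}. s i)"
      using fin by (rule prod.inter_filter[symmetric])
    also have "{x \<in> X \<inter> (\<Union>i\<in>D. B i). x \<in> B i \<and> E x \<in> I i} = {x \<in> X \<inter> B i. E x \<in> I i}" using i by auto
    finally show "s i ^ card (mark_conf X E \<inter> B i \<times> I i) = (\<Prod>x\<in>X \<inter> (\<Union>i\<in>D. B i). if x \<in> B i \<and> E x \<in> I i then s i else 1)"
      by (simp add: card_mark_conf)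
  qed
  also have "\<dots> = (\<Prod>x\<in>X \<inter> (\<Union>i\<in>D. B i). mark_weight D B I s x (E x))"
    unfolding mark_weight_def by (rule prod.swap)
  finally show ?thesis .
qed

text \<open>Only the finitely many marks at points of \<open>J\<close> matter. The product measure
  is projected to these coordinates, where independence factors the integral.\<close>

lemma integral_mark_kernel_gf:
  fixes B :: "'i \<Rightarrow> (real^'n) set"
  assumes X: "X \<in> configs" and D: "finite D"
    and B: "\<And>i. i \<in> D \<Longrightarrow> B i \<in> sets borel \<and> bounded (B i)"
    and I: "\<And>i. i \<in> D \<Longrightarrow> I i \<in> sets borel \<and> bounded (I i)"
    and s: "\<And>i. i \<in> D \<Longrightarrow> 0 \<le> s i \<and> s i \<le> 1"
    and \<nu>: "sets \<nu> = sets borel" "prob_space \<nu>"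
  shows "integral\<^sup>L (mark_kernel \<nu> X) (marked.gf D (\<lambda>i. B i \<times> I i) s)
    = (\<Prod>x\<in>X \<inter> (\<Union>i\<in>D. B i). \<integral>E. mark_weight D B I s x E \<partial>\<nu>)"
proof -
  interpret prob_space \<nu> by fact
  interpret PP: product_prob_space "\<lambda>_::real^'n. \<nu>" X ..
  define J where "J = X \<inter> (\<Union>i\<in>D. B i)"
  have J: "finite J" "J \<subseteq> X" using configs_finite[OF X] D B by (auto simp: J_def bounded_UN)
  have gm: "marked.gf D (\<lambda>i. B i \<times> I i) s \<in> borel_measurable marked_config_space"
    using B I D by (intro marked.gf_measurable) (auto intro: bounded_Times borel_Times)
  have wm: "mark_weight D B I s x \<in> borel_measurable \<nu>" for x
    using I D mark_weight_measurable[of D I B s x] measurable_cong_sets[OF \<nu>(1) refl, of borel] by blast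
  have "integral\<^sup>L (mark_kernel \<nu> X) (marked.gf D (\<lambda>i. B i \<times> I i) s)
    = (\<integral>E. marked.gf D (\<lambda>i. B i \<times> I i) s (mark_conf X E) \<partial>(\<Pi>\<^sub>M x\<in>X. \<nu>))"
    unfolding mark_kernel_def by (rule integral_distr[OF mark_conf_measurable[OF X \<nu>(1)] gm])
  also have "\<dots> = (\<integral>E. (\<Prod>x\<in>J. mark_weight D B I s x (restrict E J x)) \<partial>(\<Pi>\<^sub>M x\<in>X. \<nu>))"
    unfolding J_def using D B by (subst gf_mark_conf[OF X]) auto
  also have "\<dots> = (\<integral>E. (\<Prod>x\<in>J. mark_weight D B I s x (E x)) \<partial>distr (\<Pi>\<^sub>M x\<in>X. \<nu>) (\<Pi>\<^sub>M x\<in>J. \<nu>) (\<lambda>E. restrict E J))"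
  proof (rule integral_distr[symmetric])
    show "(\<lambda>E. restrict E J) \<in> measurable (\<Pi>\<^sub>M x\<in>X. \<nu>) (\<Pi>\<^sub>M x\<in>J. \<nu>)"
      using J by (intro measurable_restrict_subset)
    show "(\<lambda>E. \<Prod>x\<in>J. mark_weight D B I s x (E x)) \<in> borel_measurable (\<Pi>\<^sub>M x\<in>J. \<nu>)"
    proof (rule borel_measurable_prod)
      fix x assume x: "x \<in> J"
      show "(\<lambda>E. mark_weight D B I s x (E x)) \<in> borel_measurable (\<Pi>\<^sub>M x\<in>J. \<nu>)"
        using measurable_component_singleton[OF x] wm by (rule measurable_compose)
    qed
  qed
  also have "\<dots> = (\<integral>E. (\<Prod>x\<in>J. mark_weight D B I s x (E x)) \<partial>(\<Pi>\<^sub>M x\<in>J. \<nu>))"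
    using PP.distr_PiM_restrict_finite[OF J] by simp
  also have "\<dots> = (\<Prod>x\<in>J. \<integral>E. mark_weight D B I s x E \<partial>\<nu>)"
  proof (rule PP.product_integral_prod[OF J(1)])
    fix x
    show "integrable \<nu> (mark_weight D B I s x)"
      using mark_weight_bounds[of D s B I x] s wm by (intro integrable_const_bound[where B=1]) auto
  qed
  finally show ?thesis unfolding J_def .
qed

text \<open>Points are grouped by the set \<open>S\<close> of those indices whose \<open>B i\<close>
  contain them. The expected weight depends on \<open>S\<close> alone, so the product over points
  becomes a product of powers of counts in Venn regions, a form in which measurability in
  \<open>X\<close> can be read off. The \<open>B i\<close> may overlap here.\<close>

lemma prod_mark_weight_eq:
  fixes B :: "'i \<Rightarrow> (real^'n) set" and D :: "'i set" and \<nu> :: "real measure"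
  defines "BS \<equiv> \<lambda>S. {x. \<forall>i. i \<in> S \<longleftrightarrow> i \<in> D \<and> x \<in> B i}"
  assumes X: "X \<in> configs" and D: "finite D" and B: "\<And>i. i \<in> D \<Longrightarrow> bounded (B i)"
  shows "(\<Prod>x\<in>X \<inter> (\<Union>i\<in>D. B i). \<integral>E. mark_weight D B I s x E \<partial>\<nu>)
    = (\<Prod>S\<in>Pow D - {{}}. (\<integral>E. (\<Prod>i\<in>S. if E \<in> I i then s i else 1) \<partial>\<nu>) ^ card (X \<inter> BS S))"
proof -
  let ?J = "X \<inter> (\<Union>i\<in>D. B i)"
  have fin: "finite ?J" using configs_finite[OF X] D B by (simp add: bounded_UN)
  define T where "T x = {i \<in> D. x \<in> B i}" for x
  have TB: "{x \<in> ?J. T x = S} = X \<inter> BS S" if "S \<in> Pow D - {{}}" for S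
    using that unfolding T_def BS_def by auto
  have w: "mark_weight D B I s x E = (\<Prod>i\<in>T x. if E \<in> I i then s i else 1)" for x E
    unfolding mark_weight_def T_def using D by (subst prod.inter_filter) (auto intro!: prod.cong)
  have "(\<Prod>x\<in>?J. \<integral>E. mark_weight D B I s x E \<partial>\<nu>)
    = (\<Prod>x\<in>?J. \<integral>E. (\<Prod>i\<in>T x. if E \<in> I i then s i else 1) \<partial>\<nu>)"
    by (simp only: w)
  also have "\<dots> = (\<Prod>S\<in>Pow D - {{}}. \<Prod>x\<in>{x \<in> ?J. T x = S}. \<integral>E. (\<Prod>i\<in>T x. if E \<in> I i then s i else 1) \<partial>\<nu>)"
    using fin D by (intro prod.group[symmetric]) (auto simp: T_def)
  also have "\<dots> = (\<Prod>S\<in>Pow D - {{}}. (\<integral>E. (\<Prod>i\<in>S. if E \<in> I i then s i else 1) \<partial>\<nu>) ^ card (X \<inter> BS S))"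
  proof (rule prod.cong[OF refl])
    fix S assume S: "S \<in> Pow D - {{}}"
    have "(\<Prod>x\<in>{x \<in> ?J. T x = S}. \<integral>E. (\<Prod>i\<in>T x. if E \<in> I i then s i else 1) \<partial>\<nu>)
      = (\<Prod>x\<in>{x \<in> ?J. T x = S}. \<integral>E. (\<Prod>i\<in>S. if E \<in> I i then s i else 1) \<partial>\<nu>)"
      by (rule prod.cong) auto
    thus "(\<Prod>x\<in>{x \<in> ?J. T x = S}. \<integral>E. (\<Prod>i\<in>T x. if E \<in> I i then s i else 1) \<partial>\<nu>)
      = (\<integral>E. (\<Prod>i\<in>S. if E \<in> I i then s i else 1) \<partial>\<nu>) ^ card (X \<inter> BS S)"
      unfolding TB[OF S] by simp
  qed
  finally show ?thesis .
qed

section \<open>Measurability of the marking kernel in the point configuration\<close>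

lemma borel_Venn_region:
  assumes D: "finite D" and S: "S \<subseteq> D" and B: "\<And>i. i \<in> D \<Longrightarrow> B i \<in> sets borel"
  shows "{x. \<forall>i. i \<in> S \<longleftrightarrow> i \<in> D \<and> x \<in> B i} \<in> sets borel"
proof -
  have "{x \<in> space borel. \<forall>i\<in>D. x \<in> (if i \<in> S then B i else - B i)} \<in> sets borel"
    using D B by (intro sets.sets_Collect_finite_All) (auto simp: Compl_eq_Diff_UNIV)
  also have "{x \<in> space borel. \<forall>i\<in>D. x \<in> (if i \<in> S then B i else - B i)} = {x. \<forall>i. i \<in> S \<longleftrightarrow> i \<in> D \<and> x \<in> B i}"
    using S by (auto split: if_splits)
  finally show ?thesis .
qed

lemma measurable_integral_mark_kernel_gf:
  fixes B :: "'i \<Rightarrow> (real^'n) set"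
  assumes D: "finite D"
    and B: "\<And>i. i \<in> D \<Longrightarrow> B i \<in> sets borel \<and> bounded (B i)"
    and I: "\<And>i. i \<in> D \<Longrightarrow> I i \<in> sets borel \<and> bounded (I i)"
    and s: "\<And>i. i \<in> D \<Longrightarrow> 0 \<le> s i \<and> s i \<le> 1"
    and \<nu>: "sets \<nu> = sets borel" "prob_space \<nu>"
  shows "(\<lambda>X. integral\<^sup>L (mark_kernel \<nu> X) (marked.gf D (\<lambda>i. B i \<times> I i) s)) \<in> borel_measurable config_space"
proof -
  let ?BS = "\<lambda>S. {x. \<forall>i. i \<in> S \<longleftrightarrow> i \<in> D \<and> x \<in> B i}"
  have "(\<lambda>X. \<Prod>S\<in>Pow D - {{}}. (\<integral>E. (\<Prod>i\<in>S. if E \<in> I i then s i else 1) \<partial>\<nu>) ^ card (X \<inter> ?BS S)) \<in> borel_measurable config_space"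
  proof (rule borel_measurable_prod)
    fix S assume S: "S \<in> Pow D - {{}}"
    then obtain i where i: "i \<in> S" "i \<in> D" by blast
    have "?BS S \<subseteq> B i" using i(1) by blast
    hence "bounded (?BS S)" using B[OF i(2)] bounded_subset by blast
    moreover have "?BS S \<in> sets borel" using S B by (intro borel_Venn_region[OF D]) auto
    ultimately have "(\<lambda>X. card (X \<inter> ?BS S)) \<in> measurable config_space (count_space UNIV)"
      by (intro configs.card_Int_measurable_count_space)
    thus "(\<lambda>X. (\<integral>E. (\<Prod>i\<in>S. if E \<in> I i then s i else 1) \<partial>\<nu>) ^ card (X \<inter> ?BS S)) \<in> borel_measurable config_space"
      by (rule measurable_compose) simp
  qed
  moreover have "integral\<^sup>L (mark_kernel \<nu> X) (marked.gf D (\<lambda>i. B i \<times> I i) s)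
      = (\<Prod>S\<in>Pow D - {{}}. (\<integral>E. (\<Prod>i\<in>S. if E \<in> I i then s i else 1) \<partial>\<nu>) ^ card (X \<inter> ?BS S))"
    if "X \<in> space config_space" for X
    using that B I s \<nu> D by (subst integral_mark_kernel_gf) (auto intro!: prod_mark_weight_eq)
  ultimately show ?thesis by (subst measurable_cong) auto
qed

text \<open>An event is encoded by a finite set of constraints, so that intersecting two events
  amounts to uniting their constraint sets. Cell atoms do not serve here: the intersection of two
  atoms of different levels is in general not an atom.\<close>

definition rect_event :: "((real^'n) set \<times> real set \<times> nat) set \<Rightarrow> ((real^'n) \<times> real) set set" where
  "rect_event T = {w \<in> marked_configs. \<forall>(B, I, m)\<in>T. card (w \<inter> B \<times> I) = m}"

definition rects :: "((real^'n) set \<times> real set \<times> nat) set set" where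
  "rects = {T. finite T \<and> (\<forall>(B, I, m)\<in>T. B \<in> sets borel \<and> bounded B \<and> I \<in> sets borel \<and> bounded I)}"

lemma sets_marked_config_space:
  "sets marked_config_space = sigma_sets marked_configs (rect_event ` rects)"
proof (intro equalityI)
  show "sets marked_config_space \<subseteq> sigma_sets marked_configs (rect_event ` rects)"
    unfolding marked.sets_MC
  proof (rule sigma_sets_mono')
    show "{marked.cell_atom k m | k m. True} \<subseteq> rect_event ` rects"
    proof
      fix A :: "((real^'n) \<times> real) set set" assume "A \<in> {marked.cell_atom k m | k m. True}"
      then obtain k m where A: "A = marked.cell_atom k m" by blast
      define T where "T = (\<lambda>(a, e). (cell k a, cell k e, m (a, e))) ` grid k"
      have "T \<in> rects" unfolding rects_def T_def by auto
      moreover have "A = rect_event T"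
        unfolding A rect_event_def marked.cell_atom_def T_def by (auto simp: cell_Times)
      ultimately show "A \<in> rect_event ` rects" by blast
    qed
  qed
  have "rect_event T \<in> sets marked_config_space" if T: "T \<in> rects" for T :: "((real^'n) set \<times> real set \<times> nat) set"
  proof -
    have "{w \<in> space marked_config_space. \<forall>t\<in>T. card (w \<inter> fst t \<times> fst (snd t)) = snd (snd t)} \<in> sets marked_config_space"
    proof (rule sets.sets_Collect_finite_All)
      show "finite T" using T by (simp add: rects_def)
      fix t assume "t \<in> T"
      hence "fst t \<in> sets borel \<and> bounded (fst t) \<and> fst (snd t) \<in> sets borel \<and> bounded (fst (snd t))"
        using T by (auto simp: rects_def split_beta)
      thus "{w \<in> space marked_config_space. card (w \<inter> fst t \<times> fst (snd t)) = snd (snd t)} \<in> sets marked_config_space"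
        using marked.sets_card_eq[of "fst t \<times> fst (snd t)"] by (simp add: borel_Times bounded_Times)
    qed
    thus ?thesis by (simp add: rect_event_def split_beta)
  qed
  thus "sigma_sets marked_configs (rect_event ` rects) \<subseteq> sets marked_config_space"
    using sets.sigma_sets_subset[of "rect_event ` rects" marked_config_space]
    unfolding space_borel_of topspace_vague_topology by blast
qed

text \<open>The closure argument again, now for the class \<open>H\<close> of bounded measurable
  functionals whose integral against the kernel depends measurably on \<open>X\<close>. Uniform
  limits are handled by dominated convergence at each fixed \<open>X\<close>.\<close>

lemma measurable_measure_rect_event:
  fixes T :: "((real^'n) set \<times> real set \<times> nat) set"
  assumes T: "T \<in> rects" and \<nu>: "sets \<nu> = sets borel" "prob_space \<nu>"
  shows "(\<lambda>X. measure (mark_kernel \<nu> X) (rect_event T)) \<in> borel_measurable config_space"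
proof -
  define N where "N t w = card (w \<inter> fst t \<times> fst (snd t))" for t :: "(real^'n) set \<times> real set \<times> nat" and w
  define H where "H f \<longleftrightarrow> f \<in> borel_measurable marked_config_space \<and> (\<exists>b. \<forall>w. \<bar>f w\<bar> \<le> b) \<and>
      (\<lambda>X. integral\<^sup>L (mark_kernel \<nu> X) f) \<in> borel_measurable config_space" for f :: "((real^'n) \<times> real) set \<Rightarrow> real"
  have HI: "H f" if "f \<in> borel_measurable marked_config_space" "\<And>w. \<bar>f w\<bar> \<le> b"
      "(\<lambda>X. integral\<^sup>L (mark_kernel \<nu> X) f) \<in> borel_measurable config_space" for f b
    using that unfolding H_def by blast
  have HD: "f \<in> borel_measurable marked_config_space" "\<exists>b. \<forall>w. \<bar>f w\<bar> \<le> b"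
      "(\<lambda>X. integral\<^sup>L (mark_kernel \<nu> X) f) \<in> borel_measurable config_space" if "H f" for f
    using that unfolding H_def by simp_all
  have int: "integrable (mark_kernel \<nu> X) f" if X: "X \<in> configs" and f: "H f" for X f
  proof -
    interpret prob_space "mark_kernel \<nu> X" by (rule prob_space_mark_kernel[OF X \<nu>])
    obtain b where b: "\<And>w. \<bar>f w\<bar> \<le> b" using HD(2)[OF f] by blast
    have "f \<in> borel_measurable (mark_kernel \<nu> X)"
      using HD(1)[OF f] measurable_cong_sets[OF sets_mark_kernel refl] by blast
    thus ?thesis using b by (intro integrable_const_bound[where B=b]) auto
  qed
  have "H (\<lambda>w. \<Prod>t\<in>T. of_bool (N t w = snd (snd t)))"
  proof (rule count_indicator_closure)
    show "finite T" using T by (simp add: rects_def)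
  next
    fix f g assume fg: "H f" "H g"
    obtain b where b: "\<And>w. \<bar>f w\<bar> \<le> b" using HD(2)[OF fg(1)] by blast
    obtain c where c: "\<And>w. \<bar>g w\<bar> \<le> c" using HD(2)[OF fg(2)] by blast
    show "H (\<lambda>w. f w + g w)"
    proof (rule HI[of _ "b + c"])
      show "\<bar>f w + g w\<bar> \<le> b + c" for w using b[of w] c[of w] by linarith
      have "(\<lambda>X. integral\<^sup>L (mark_kernel \<nu> X) f + integral\<^sup>L (mark_kernel \<nu> X) g) \<in> borel_measurable config_space"
        by (rule borel_measurable_add[OF HD(3)[OF fg(1)] HD(3)[OF fg(2)]])
      moreover have "integral\<^sup>L (mark_kernel \<nu> X) (\<lambda>w. f w + g w) = integral\<^sup>L (mark_kernel \<nu> X) f + integral\<^sup>L (mark_kernel \<nu> X) g"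
        if "X \<in> space config_space" for X
        using that int fg by (intro Bochner_Integration.integral_add) auto
      ultimately show "(\<lambda>X. integral\<^sup>L (mark_kernel \<nu> X) (\<lambda>w. f w + g w)) \<in> borel_measurable config_space"
        by (subst measurable_cong) auto
    qed (intro borel_measurable_add HD(1) fg)
  next
    fix f c assume f: "H f"
    obtain b where b: "\<And>w. \<bar>f w\<bar> \<le> b" using HD(2)[OF f] by blast
    show "H (\<lambda>w. c * f w)"
    proof (rule HI[of _ "\<bar>c\<bar> * b"])
      show "\<bar>c * f w\<bar> \<le> \<bar>c\<bar> * b" for w using b by (simp add: abs_mult mult_left_mono)
      show "(\<lambda>X. integral\<^sup>L (mark_kernel \<nu> X) (\<lambda>w. c * f w)) \<in> borel_measurable config_space"
        using borel_measurable_times[OF borel_measurable_const[of c] HD(3)[OF f]] by simp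
      show "(\<lambda>w. c * f w) \<in> borel_measurable marked_config_space" using HD(1)[OF f] by simp
    qed
  next
    fix f assume f: "\<And>e. 0 < e \<Longrightarrow> \<exists>g. H g \<and> (\<forall>w. \<bar>f w - g w\<bar> \<le> e)"
    have "\<forall>n. \<exists>g. H g \<and> (\<forall>w. \<bar>f w - g w\<bar> \<le> inverse (real (Suc n)))" using f by simp
    then obtain g where g: "\<And>n. H (g n)" "\<And>n w. \<bar>f w - g n w\<bar> \<le> inverse (real (Suc n))" by metis
    have lim: "(\<lambda>n. g n w) \<longlonglongrightarrow> f w" for w
    proof -
      have "(\<lambda>n. f w - g n w) \<longlonglongrightarrow> 0"
        by (rule Lim_null_comparison[OF _ LIMSEQ_inverse_real_of_nat]) (simp add: g(2) del: of_nat_Suc)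
      from tendsto_diff[OF tendsto_const[of "f w"] this] show ?thesis by simp
    qed
    have fm: "f \<in> borel_measurable marked_config_space"
      using lim HD(1)[OF g(1)] by (rule borel_measurable_LIMSEQ_real)
    obtain b where b: "\<And>w. \<bar>g 0 w\<bar> \<le> b" using HD(2)[OF g(1)[of 0]] by blast
    have fb: "\<bar>f w\<bar> \<le> b + 1" for w
    proof -
      have "\<bar>f w - g 0 w\<bar> \<le> 1" using g(2)[of w 0] by simp
      thus ?thesis using b[of w] by linarith
    qed
    have gb: "\<bar>g n w\<bar> \<le> b + 2" for n w
    proof -
      have "inverse (real (Suc n)) \<le> 1" by (simp add: field_simps)
      thus ?thesis using fb[of w] g(2)[of w n] by linarith
    qed
    have "(\<lambda>X. integral\<^sup>L (mark_kernel \<nu> X) f) \<in> borel_measurable config_space"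
    proof (rule borel_measurable_LIMSEQ_real)
      show "(\<lambda>X. integral\<^sup>L (mark_kernel \<nu> X) (g n)) \<in> borel_measurable config_space" for n
        by (rule HD(3)[OF g(1)])
      fix X :: "(real^'n) set" assume "X \<in> space config_space"
      hence X: "X \<in> configs" by simp
      interpret prob_space "mark_kernel \<nu> X" by (rule prob_space_mark_kernel[OF X \<nu>])
      show "(\<lambda>n. integral\<^sup>L (mark_kernel \<nu> X) (g n)) \<longlonglongrightarrow> integral\<^sup>L (mark_kernel \<nu> X) f"
        using fm HD(1)[OF g(1)] lim gb
        by (intro integral_dominated_convergence[where w = "\<lambda>_. b + 2"])
           (simp_all add: measurable_cong_sets[OF sets_mark_kernel refl])
    qed
    thus "H f" by (rule HI[OF fm fb])
  next
    fix s :: "(real^'n) set \<times> real set \<times> nat \<Rightarrow> real" assume s: "\<And>t. t \<in> T \<Longrightarrow> 0 < s t \<and> s t \<le> 1"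
    have fT: "finite T" using T by (simp add: rects_def)
    have tB: "fst t \<in> sets borel \<and> bounded (fst t)" if "t \<in> T" for t using T that by (force simp: rects_def)
    have tI: "fst (snd t) \<in> sets borel \<and> bounded (fst (snd t))" if "t \<in> T" for t using T that by (force simp: rects_def)
    have s': "0 \<le> s t \<and> s t \<le> 1" if "t \<in> T" for t using s[OF that] by simp
    have "H (marked.gf T (\<lambda>t. fst t \<times> fst (snd t)) s)"
    proof (rule HI[of _ 1])
      show "marked.gf T (\<lambda>t. fst t \<times> fst (snd t)) s \<in> borel_measurable marked_config_space"
        using fT tB tI by (intro marked.gf_measurable) (simp_all add: borel_Times bounded_Times)
      show "\<bar>marked.gf T (\<lambda>t. fst t \<times> fst (snd t)) s w\<bar> \<le> 1" for w
        using marked.gf_bounds[of T s _ w, OF s'] by simp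
      show "(\<lambda>X. integral\<^sup>L (mark_kernel \<nu> X) (marked.gf T (\<lambda>t. fst t \<times> fst (snd t)) s)) \<in> borel_measurable config_space"
        by (rule measurable_integral_mark_kernel_gf[OF fT tB tI s' \<nu>])
    qed
    thus "H (\<lambda>w. \<Prod>t\<in>T. s t ^ N t w)" unfolding marked.gf_def N_def .
  qed
  hence "(\<lambda>X. integral\<^sup>L (mark_kernel \<nu> X) (\<lambda>w. \<Prod>t\<in>T. of_bool (N t w = snd (snd t)) :: real)) \<in> borel_measurable config_space"
    by (rule HD(3))
  moreover have "integral\<^sup>L (mark_kernel \<nu> X) (\<lambda>w. \<Prod>t\<in>T. of_bool (N t w = snd (snd t)) :: real)
      = measure (mark_kernel \<nu> X) (rect_event T)" for X
  proof -
    have sp: "space (mark_kernel \<nu> X) = marked_configs" using sets_eq_imp_space_eq[OF sets_mark_kernel] by simp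
    have fT: "finite T" using T by (simp add: rects_def)
    have "integral\<^sup>L (mark_kernel \<nu> X) (\<lambda>w. \<Prod>t\<in>T. of_bool (N t w = snd (snd t)) :: real)
      = integral\<^sup>L (mark_kernel \<nu> X) (indicator (rect_event T))"
      using fT by (intro Bochner_Integration.integral_cong refl)
        (auto simp: sp rect_event_def indicator_def N_def split_beta)
    also have "\<dots> = measure (mark_kernel \<nu> X) (rect_event T \<inter> space (mark_kernel \<nu> X))" by simp
    also have "rect_event T \<inter> space (mark_kernel \<nu> X) = rect_event T" by (auto simp: sp rect_event_def)
    finally show ?thesis .
  qed
  ultimately show ?thesis by simp
qed

text \<open>Rectangle events form an intersection-stable generator, so it suffices to evaluate the
  kernel on them and on the whole space.\<close>

lemma mark_kernel_measurable:
  assumes \<nu>: "sets \<nu> = sets borel" "prob_space \<nu>"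
  shows "mark_kernel \<nu> \<in> measurable config_space (subprob_algebra marked_config_space)"
proof (rule measurable_subprob_algebra_generated[OF sets_marked_config_space])
  show "Int_stable (rect_event ` rects)"
  proof (rule Int_stableI_image)
    fix T T' :: "((real^'n) set \<times> real set \<times> nat) set" assume "T \<in> rects" "T' \<in> rects"
    thus "\<exists>U\<in>rects. rect_event T \<inter> rect_event T' = rect_event U"
      by (intro bexI[of _ "T \<union> T'"]) (auto simp: rects_def rect_event_def ball_Un)
  qed
  show "rect_event ` rects \<subseteq> Pow marked_configs" by (auto simp: rect_event_def)
  fix X :: "(real^'n) set" assume "X \<in> space config_space"
  hence X: "X \<in> configs" by simp
  show "subprob_space (mark_kernel \<nu> X)"
    using prob_space_mark_kernel[OF X \<nu>] by (rule prob_space_imp_subprob_space)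
  show "sets (mark_kernel \<nu> X) = sets marked_config_space" by simp
next
  fix A assume "A \<in> rect_event ` rects"
  then obtain T where T: "T \<in> rects" "A = rect_event T" by blast
  have "(\<lambda>X. ennreal (measure (mark_kernel \<nu> X) A)) \<in> borel_measurable config_space"
    using measurable_measure_rect_event[OF T(1) \<nu>] unfolding T(2) by simp
  moreover have "emeasure (mark_kernel \<nu> X) A = ennreal (measure (mark_kernel \<nu> X) A)" if "X \<in> space config_space" for X
  proof -
    interpret prob_space "mark_kernel \<nu> X" using that by (intro prob_space_mark_kernel \<nu>) simp
    show ?thesis by (rule emeasure_eq_measure)
  qed
  ultimately show "(\<lambda>X. emeasure (mark_kernel \<nu> X) A) \<in> borel_measurable config_space"
    by (subst measurable_cong) auto
next
  have "emeasure (mark_kernel \<nu> X) marked_configs = 1" if "X \<in> space config_space" for X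
  proof -
    interpret prob_space "mark_kernel \<nu> X" using that by (intro prob_space_mark_kernel \<nu>) simp
    have "space (mark_kernel \<nu> X) = marked_configs" using sets_eq_imp_space_eq[OF sets_mark_kernel] by simp
    thus ?thesis using emeasure_space_1 by simp
  qed
  thus "(\<lambda>X. emeasure (mark_kernel \<nu> X) marked_configs) \<in> borel_measurable config_space"
    by (subst measurable_cong[where g = "\<lambda>_. 1"]) auto
qed

section \<open>Generating functions under the randomized law\<close>

lemma measurable_mark_kernel_spp:
  assumes P: "spp_law P" and \<nu>: "sets \<nu> = sets borel" "prob_space \<nu>"
  shows "mark_kernel \<nu> \<in> measurable P (subprob_algebra marked_config_space)"
proof -
  have "sets P = sets config_space" using P by (simp add: spp_law_def)
  thus ?thesis using mark_kernel_measurable[OF \<nu>] measurable_cong_sets by blast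
qed

lemma space_spp: "spp_law P \<Longrightarrow> space P = configs"
  using sets_eq_imp_space_eq[of P config_space] by (simp add: spp_law_def)

lemma
  assumes P: "spp_law P" and \<nu>: "sets \<nu> = sets borel" "prob_space \<nu>"
  shows sets_randomization: "sets (randomization P \<nu>) = sets marked_config_space"
    and prob_space_randomization: "prob_space (randomization P \<nu>)"
proof -
  interpret prob_space P using P by (simp add: spp_law_def)
  show "sets (randomization P \<nu>) = sets marked_config_space"
    unfolding randomization_eq by (rule sets_bind) (simp_all add: not_empty)
  show "prob_space (randomization P \<nu>)"
    unfolding randomization_eq
  proof (rule prob_space_bind[OF _ measurable_mark_kernel_spp[OF P \<nu>]])
    show "AE X in P. prob_space (mark_kernel \<nu> X)"
      using prob_space_mark_kernel[OF _ \<nu>] by (intro AE_I2) (simp add: space_spp[OF P])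
  qed
qed

text \<open>The iterated integral over \<open>bind\<close> is available for nonnegative integrals;
  since the functional takes values in the unit interval, it passes to them and back without
  loss.\<close>

lemma integral_randomization_gf:
  fixes B :: "'i \<Rightarrow> (real^'n) set"
  assumes P: "spp_law P" and D: "finite D"
    and B: "\<And>i. i \<in> D \<Longrightarrow> B i \<in> sets borel \<and> bounded (B i)"
    and I: "\<And>i. i \<in> D \<Longrightarrow> I i \<in> sets borel \<and> bounded (I i)"
    and s: "\<And>i. i \<in> D \<Longrightarrow> 0 \<le> s i \<and> s i \<le> 1"
    and \<nu>: "sets \<nu> = sets borel" "prob_space \<nu>"
  shows "integral\<^sup>L (randomization P \<nu>) (marked.gf D (\<lambda>i. B i \<times> I i) s)
    = (\<integral>X. (\<Prod>x\<in>X \<inter> (\<Union>i\<in>D. B i). \<integral>E. mark_weight D B I s x E \<partial>\<nu>) \<partial>P)"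
proof -
  let ?g = "marked.gf D (\<lambda>i. B i \<times> I i) s"
  have gm: "?g \<in> borel_measurable marked_config_space"
    using D B I by (intro marked.gf_measurable) (simp_all add: borel_Times bounded_Times)
  have gmr: "?g \<in> borel_measurable (randomization P \<nu>)" "?g \<in> borel_measurable (mark_kernel \<nu> X)" for X
    using gm by (simp_all add: measurable_cong_sets[OF sets_randomization[OF P \<nu>] refl]
      measurable_cong_sets[OF sets_mark_kernel refl])
  have g01: "0 \<le> ?g w" "?g w \<le> 1" for w using marked.gf_bounds[of D s] s by auto
  have Pm: "(\<lambda>X. integral\<^sup>L (mark_kernel \<nu> X) ?g) \<in> borel_measurable P"
    using measurable_integral_mark_kernel_gf[OF D B I s \<nu>] P
    by (simp add: spp_law_def cong: measurable_cong_sets)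
  have k: "(\<integral>\<^sup>+w. ennreal (?g w) \<partial>mark_kernel \<nu> X) = ennreal (integral\<^sup>L (mark_kernel \<nu> X) ?g)"
    if X: "X \<in> space P" for X
  proof -
    interpret prob_space "mark_kernel \<nu> X"
      using X by (intro prob_space_mark_kernel \<nu>) (simp add: space_spp[OF P])
    show ?thesis
      using gmr g01 by (intro nn_integral_eq_integral integrable_const_bound[where B=1]) auto
  qed
  have nn: "0 \<le> integral\<^sup>L (mark_kernel \<nu> X) ?g" for X using g01 by (intro Bochner_Integration.integral_nonneg)
  have "integral\<^sup>L (randomization P \<nu>) ?g = enn2real (\<integral>\<^sup>+w. ennreal (?g w) \<partial>randomization P \<nu>)"
    using gmr g01 by (intro integral_eq_nn_integral) auto
  also have "(\<integral>\<^sup>+w. ennreal (?g w) \<partial>randomization P \<nu>) = (\<integral>\<^sup>+X. \<integral>\<^sup>+w. ennreal (?g w) \<partial>mark_kernel \<nu> X \<partial>P)"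
    unfolding randomization_eq using gm
    by (intro nn_integral_bind[OF _ measurable_mark_kernel_spp[OF P \<nu>]]) auto
  also have "\<dots> = (\<integral>\<^sup>+X. ennreal (integral\<^sup>L (mark_kernel \<nu> X) ?g) \<partial>P)"
    by (rule nn_integral_cong[OF k])
  also have "enn2real \<dots> = (\<integral>X. integral\<^sup>L (mark_kernel \<nu> X) ?g \<partial>P)"
    using Pm nn by (intro integral_eq_nn_integral[symmetric]) auto
  also have "\<dots> = (\<integral>X. (\<Prod>x\<in>X \<inter> (\<Union>i\<in>D. B i). \<integral>E. mark_weight D B I s x E \<partial>\<nu>) \<partial>P)"
  proof (rule Bochner_Integration.integral_cong[OF refl])
    fix X assume "X \<in> space P"
    hence X: "X \<in> configs" by (simp add: space_spp[OF P])
    show "integral\<^sup>L (mark_kernel \<nu> X) ?g = (\<Prod>x\<in>X \<inter> (\<Union>i\<in>D. B i). \<integral>E. mark_weight D B I s x E \<partial>\<nu>)"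
      by (rule integral_mark_kernel_gf[OF X D B I s \<nu>])
  qed
  finally show ?thesis .
qed

section \<open>Averages of a stationary point process\<close>

lemma card_translate: "card (translate a X \<inter> B) = card (X \<inter> {x. x - a \<in> B})"
proof -
  have "translate a X \<inter> B = (\<lambda>x. x - a) ` (X \<inter> {x. x - a \<in> B})"
    by (auto simp: translate_def)
  thus ?thesis by (simp add: card_image)
qed

lemma bounded_diff_vimage: "bounded B \<Longrightarrow> bounded {x. x - a \<in> (B :: 'a::real_normed_vector set)}"
proof -
  assume "bounded B"
  moreover have "{x. x - a \<in> B} = (\<lambda>x. a + x) ` B" by (auto simp: image_iff) (metis add_diff_cancel_left' diff_add_cancel add.commute)
  ultimately show ?thesis by (simp add: bounded_translation)
qed

lemma hcube_diff_vimage: "{x. x - a \<in> hcube b L} = hcube (a + b) L"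
  by (auto simp: hcube_def inner_simps algebra_simps)

lemma translate_in_configs: "X \<in> configs \<Longrightarrow> translate a X \<in> configs"
proof -
  assume X: "X \<in> configs"
  have "finite (translate a X \<inter> B)" if "bounded B" for B
  proof -
    have "translate a X \<inter> B = (\<lambda>x. x - a) ` (X \<inter> {x. x - a \<in> B})" by (auto simp: translate_def)
    thus ?thesis using configs_finite[OF X bounded_diff_vimage[OF that]] by simp
  qed
  thus ?thesis by (simp add: configs_def)
qed

lemma translate_translate: "translate a (translate b X) = translate (a + b) X"
  by (auto simp: translate_def image_image algebra_simps)

lemma translate_zero [simp]: "translate 0 X = X"
  by (simp add: translate_def)

lemma translate_measurable: "translate a \<in> measurable config_space config_space"
proof (rule configs.measurable_into_MC)
  show "translate a X \<in> configs" if "X \<in> space config_space" for X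
    using that translate_in_configs by simp
  show "(\<lambda>X. real (card (translate a X \<inter> cell k v))) \<in> borel_measurable config_space" for k v
    unfolding card_translate cell_def hcube_diff_vimage
    by (rule configs.card_Int_measurable) auto
qed

locale stationary_spp = prob_space P for P :: "(real^'n) set measure" +
  fixes \<rho> :: real
  assumes sets_P: "sets P = sets config_space"
    and stationary: "stationary P"
    and rho_nonneg: "0 \<le> \<rho>"
    and intensity: "intensity P = ennreal \<rho>"
begin

definition F :: "real^'n \<Rightarrow> real \<Rightarrow> (real^'n) set \<Rightarrow> real" where
  "F a L X = real (card (X \<inter> hcube a L))"

lemma space_P: "space P = configs"
  using sets_eq_imp_space_eq[OF sets_P] by simp

lemma measurable_P_iff: "f \<in> borel_measurable P \<longleftrightarrow> f \<in> borel_measurable config_space"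
  by (rule iffD1[OF refl]) (simp add: measurable_cong_sets[OF sets_P refl])

lemma translate_P: "translate a \<in> measurable P P"
  using translate_measurable[of a] measurable_cong_sets[OF sets_P sets_P] by blast

lemma distr_translate: "distr P P (translate a) = P"
proof -
  have "distr P P (translate a) = distr P config_space (translate a)"
    by (rule distr_cong) (simp_all add: sets_P)
  thus ?thesis using stationary by (simp add: stationary_def)
qed

lemma borel_translate: "f \<in> borel_measurable P \<Longrightarrow> (\<lambda>X. f (translate a X)) \<in> borel_measurable P"
  using measurable_compose[OF translate_P] by blast

lemma integral_translate:
  fixes f :: "(real^'n) set \<Rightarrow> real"
  assumes "f \<in> borel_measurable P"
  shows "(\<integral>X. f (translate a X) \<partial>P) = (\<integral>X. f X \<partial>P)"
  using integral_distr[OF translate_P assms, of a] by (simp add: distr_translate)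

lemma integrable_translate:
  fixes f :: "(real^'n) set \<Rightarrow> real"
  assumes "integrable P f"
  shows "integrable P (\<lambda>X. f (translate a X))"
  using integrable_distr_eq[OF translate_P, of f a] assms by (simp add: distr_translate)

lemma count_measurable:
  "B \<in> sets borel \<Longrightarrow> bounded B \<Longrightarrow> (\<lambda>X. real (card (X \<inter> B))) \<in> borel_measurable P"
  unfolding measurable_P_iff by (rule configs.card_Int_measurable)

lemma card_measurable_hcube: "(\<lambda>X. card (X \<inter> hcube a L)) \<in> measurable P (count_space UNIV)"
  using configs.card_Int_measurable_count_space[OF borel_hcube bounded_hcube]
    measurable_cong_sets[OF sets_P refl] by blast

lemma F_measurable [measurable]: "F a L \<in> borel_measurable P"
  unfolding F_def[abs_def] by (rule count_measurable) auto

lemma F_translate: "F a L (translate b X) = F (b + a) L X"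
  by (simp add: F_def card_translate hcube_diff_vimage)

lemma F_nonneg [simp]: "0 \<le> F a L X"
  by (simp add: F_def)

lemma F_mono: "X \<in> configs \<Longrightarrow> hcube a L \<subseteq> hcube b L' \<Longrightarrow> F a L X \<le> F b L' X"
  unfolding F_def by (intro of_nat_mono card_mono configs_finite) auto

lemma integrable_cbox: "integrable P (\<lambda>X. real (card (X \<inter> cbox 0 1)))"
  and integral_cbox: "(\<integral>X. real (card (X \<inter> cbox 0 1)) \<partial>P) = \<rho>"
proof -
  have m: "(\<lambda>X. real (card (X \<inter> cbox 0 1))) \<in> borel_measurable P" by (rule count_measurable) auto
  have nn: "(\<integral>\<^sup>+X. ennreal (real (card (X \<inter> cbox 0 1))) \<partial>P) = ennreal \<rho>"
    using intensity by (simp add: intensity_def ennreal_of_nat_eq_real_of_nat)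
  show "integrable P (\<lambda>X. real (card (X \<inter> cbox 0 1)))"
    by (rule integrableI_nn_integral_finite[OF m _ nn]) simp
  show "(\<integral>X. real (card (X \<inter> cbox 0 1)) \<partial>P) = \<rho>"
    unfolding integral_eq_nn_integral[OF m AE_I2[OF of_nat_0_le_iff]] nn
    by (rule enn2real_ennreal[OF rho_nonneg])
qed

lemma One_vec: "(One :: real^'n) = 1"
  by (simp add: euclidean_eq_iff[where 'a="real^'n"] inner_sum_left_Basis) (auto simp: Basis_vec_def inner_axis)

lemma hcube_unit_subset: "hcube (0::real^'n) 1 \<subseteq> cbox 0 1"
  using hcube_subset_cbox[of "0::real^'n" 1] by (simp add: One_vec)

lemma integrable_F_unit: "integrable P (F a 1)"
proof -
  have "integrable P (F 0 1)"
  proof (rule Bochner_Integration.integrable_bound[OF integrable_cbox])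
    show "AE X in P. norm (F 0 1 X) \<le> norm (real (card (X \<inter> cbox 0 1)))"
    proof (rule AE_I2)
      fix X assume "X \<in> space P"
      hence "finite (X \<inter> cbox 0 1)" by (simp add: space_P configs_finite)
      thus "norm (F 0 1 X) \<le> norm (real (card (X \<inter> cbox 0 1)))"
        unfolding F_def using hcube_unit_subset by (auto intro!: card_mono)
    qed
  qed simp
  from integrable_translate[OF this, of a] show ?thesis by (simp add: F_translate)
qed

lemma F_block_sum:
  assumes X: "X \<in> configs" and s: "0 < s"
  shows "real (card (X \<inter> block (of_int m * s) (of_int n * s))) = (\<Sum>v\<in>lattice m n. F (s *\<^sub>R v) s X)"
proof -
  have "X \<inter> block (of_int m * s) (of_int n * s) = (\<Union>v\<in>lattice m n. X \<inter> hcube (s *\<^sub>R v) s)"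
    unfolding UN_hcubes[OF s, symmetric] by blast
  also have "card \<dots> = (\<Sum>v\<in>lattice m n. card (X \<inter> hcube (s *\<^sub>R v) s))"
  proof (rule card_UN_disjoint)
    show "\<forall>u\<in>lattice m n. \<forall>v\<in>lattice m n. u \<noteq> v \<longrightarrow> (X \<inter> hcube (s *\<^sub>R u) s) \<inter> (X \<inter> hcube (s *\<^sub>R v) s) = {}"
      using disjoint_hcubes[OF s] by blast
  qed (use configs_finite[OF X] in auto)
  finally show ?thesis by (simp add: F_def)
qed

text \<open>A bounded set is covered by finitely many unit cubes, each with an integrable count by
  stationarity.\<close>

lemma integrable_count:
  assumes B: "B \<in> sets borel" "bounded B"
  shows "integrable P (\<lambda>X. real (card (X \<inter> B)))"
proof -
  obtain k :: nat where "\<And>j. k \<le> j \<Longrightarrow> B \<subseteq> block (- (2 ^ j)) (2 ^ j)"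
    using bounded_subset_block[OF B(2)] by blast
  hence k: "B \<subseteq> block (- (2 ^ k)) (2 ^ k)" by simp
  have "integrable P (\<lambda>X. \<Sum>v\<in>lattice (- (2 ^ k)) (2 ^ k). F (1 *\<^sub>R v) 1 X)"
    by (intro Bochner_Integration.integrable_sum integrable_F_unit)
  thus ?thesis
  proof (rule Bochner_Integration.integrable_bound[OF _ count_measurable[OF B]])
    show "AE X in P. norm (real (card (X \<inter> B))) \<le> norm (\<Sum>v\<in>lattice (- (2 ^ k)) (2 ^ k). F (1 *\<^sub>R v) 1 X)"
    proof (rule AE_I2)
      fix X assume "X \<in> space P"
      hence X: "X \<in> configs" by (simp add: space_P)
      have "real (card (X \<inter> B)) \<le> real (card (X \<inter> block (of_int (- (2 ^ k)) * 1) (of_int (2 ^ k) * 1)))"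
        using k by (intro of_nat_mono card_mono configs_finite[OF X]) auto
      also have "\<dots> = (\<Sum>v\<in>lattice (- (2 ^ k)) (2 ^ k). F (1 *\<^sub>R v) 1 X)"
        by (rule F_block_sum[OF X]) simp
      finally show "norm (real (card (X \<inter> B))) \<le> norm (\<Sum>v\<in>lattice (- (2 ^ k)) (2 ^ k). F (1 *\<^sub>R v) 1 X)"
        by simp
    qed
  qed
qed

lemma integrable_F: "integrable P (F a L)"
  unfolding F_def[abs_def] by (rule integrable_count) auto

lemma integral_F_shift: "(\<integral>X. F a L X \<partial>P) = (\<integral>X. F 0 L X \<partial>P)"
  using integral_translate[OF F_measurable, of 0 L a] by (simp add: F_translate)

lemma F_scale_sum:
  assumes X: "X \<in> configs" and s: "0 < s"
  shows "F 0 (real n * s) X = (\<Sum>v\<in>lattice 0 (int n). F (s *\<^sub>R v) s X)"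
proof -
  have "block (of_int 0 * s) (of_int (int n) * s) = hcube (0 :: real^'n) (real n * s)"
    unfolding block_eq_hcube by simp
  thus ?thesis using F_block_sum[OF X s, of 0 "int n"] by (simp only: F_def)
qed

text \<open>The large cube splits into n^d translates of the cube of side \<open>s\<close>, all with
  the same mean by stationarity. Keeping \<open>s\<close> arbitrary also yields the means of cubes
  of fractional side.\<close>

lemma integral_F_scale:
  assumes s: "0 < s"
  shows "(\<integral>X. F 0 (real n * s) X \<partial>P) = real n ^ CARD('n) * (\<integral>X. F 0 s X \<partial>P)"
proof -
  have "(\<integral>X. F 0 (real n * s) X \<partial>P) = (\<integral>X. (\<Sum>v\<in>lattice 0 (int n). F (s *\<^sub>R v) s X) \<partial>P)"
    by (rule Bochner_Integration.integral_cong[OF refl], rule F_scale_sum[OF _ s]) (simp add: space_P)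
  also have "\<dots> = (\<Sum>v\<in>(lattice 0 (int n) :: (real^'n) set). \<integral>X. F (s *\<^sub>R v) s X \<partial>P)"
    by (rule Bochner_Integration.integral_sum[OF integrable_F])
  also have "\<dots> = (\<Sum>v\<in>(lattice 0 (int n) :: (real^'n) set). \<integral>X. F 0 s X \<partial>P)"
    by (intro sum.cong refl integral_F_shift)
  also have "\<dots> = real n ^ CARD('n) * (\<integral>X. F 0 s X \<partial>P)"
    unfolding sum_constant card_lattice by simp
  finally show ?thesis .
qed

text \<open>The intensity is defined through the closed cube. It fits into a half-open cube of side
  slightly above 1, whose mean is known from scaling; letting the side shrink to 1 shows that the
  faces carry no mass in the mean.\<close>

lemma integral_F_unit: "(\<integral>X. F 0 1 X \<partial>P) = \<rho>"
proof (rule antisym)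
  have "(\<integral>X. F 0 1 X \<partial>P) \<le> (\<integral>X. real (card (X \<inter> cbox 0 1)) \<partial>P)"
  proof (rule integral_mono[OF integrable_F integrable_cbox])
    fix X assume "X \<in> space P"
    hence "finite (X \<inter> cbox 0 1)" by (simp add: space_P configs_finite)
    thus "F 0 1 X \<le> real (card (X \<inter> cbox 0 1))"
      unfolding F_def using hcube_unit_subset by (auto intro!: card_mono)
  qed
  thus "(\<integral>X. F 0 1 X \<partial>P) \<le> \<rho>" by (simp add: integral_cbox)
  let ?r = "\<integral>X. F 0 1 X \<partial>P"
  have le: "\<rho> \<le> (1 + inverse (real (Suc n))) ^ CARD('n) * ?r" for n
  proof -
    let ?s = "inverse (real (Suc n))"
    have "\<rho> \<le> (\<integral>X. F 0 (real (Suc (Suc n)) * ?s) X \<partial>P)"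
      unfolding integral_cbox[symmetric]
    proof (rule integral_mono[OF integrable_cbox integrable_F])
      fix X assume "X \<in> space P"
      hence X: "X \<in> configs" by (simp add: space_P)
      have "1 < real (Suc (Suc n)) * ?s" by (simp add: field_simps)
      hence "cbox (0::real^'n) 1 \<subseteq> hcube 0 (real (Suc (Suc n)) * ?s)"
        unfolding One_vec[symmetric] hcube_def cbox_def by auto
      thus "real (card (X \<inter> cbox 0 1)) \<le> F 0 (real (Suc (Suc n)) * ?s) X"
        unfolding F_def by (intro of_nat_mono card_mono configs_finite[OF X]) auto
    qed
    also have "\<dots> = real (Suc (Suc n)) ^ CARD('n) * (\<integral>X. F 0 ?s X \<partial>P)" by (rule integral_F_scale) simp
    \<comment> \<open>The scaling law read backwards: \<open>Suc n\<close> small cubes per direction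
      fill the unit cube.\<close>
    also have "(\<integral>X. F 0 ?s X \<partial>P) = ?s ^ CARD('n) * ?r"
      using integral_F_scale[of ?s "Suc n"] by (simp add: field_simps)
    also have "real (Suc (Suc n)) ^ CARD('n) * (?s ^ CARD('n) * ?r) = (real (Suc (Suc n)) * ?s) ^ CARD('n) * ?r"
      by (simp only: power_mult_distrib mult.assoc)
    also have "real (Suc (Suc n)) * ?s = 1 + ?s" by (simp add: field_simps)
    finally show ?thesis .
  qed
  have "(\<lambda>n. (1 + inverse (real (Suc n))) ^ CARD('n) * ?r) \<longlonglongrightarrow> (1 + 0) ^ CARD('n) * ?r"
    by (intro tendsto_intros LIMSEQ_inverse_real_of_nat)
  from LIMSEQ_le_const[OF this] le show "\<rho> \<le> ?r" by auto
qed

lemma integral_F_nat: "(\<integral>X. F a (real n) X \<partial>P) = \<rho> * real n ^ CARD('n)"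
  using integral_F_scale[of 1 n] integral_F_shift[of a "real n"] by (simp add: integral_F_unit)

section \<open>Averages over integer translates\<close>

definition avg :: "nat \<Rightarrow> ((real^'n) set \<Rightarrow> real) \<Rightarrow> (real^'n) set \<Rightarrow> real" where
  "avg n f X = (\<Sum>v\<in>lattice 0 (int n). f (translate v X)) / real n ^ CARD('n)"

lemma avg_measurable:
  assumes "f \<in> borel_measurable P"
  shows "avg n f \<in> borel_measurable P"
proof -
  have "(\<lambda>X. \<Sum>v\<in>lattice 0 (int n). f (translate v X)) \<in> borel_measurable P"
    by (rule borel_measurable_sum[OF borel_translate[OF assms]])
  thus ?thesis unfolding avg_def[abs_def] by simp
qed

lemma avg_integrable:
  assumes "integrable P f"
  shows "integrable P (avg n f)"
proof -
  have "integrable P (\<lambda>X. \<Sum>v\<in>lattice 0 (int n). f (translate v X))"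
    by (rule Bochner_Integration.integrable_sum[OF integrable_translate[OF assms]])
  thus ?thesis unfolding avg_def[abs_def] by (rule integrable_divide)
qed

lemma integral_avg:
  assumes "integrable P f" "0 < n"
  shows "(\<integral>X. avg n f X \<partial>P) = (\<integral>X. f X \<partial>P)"
proof -
  have "(\<integral>X. avg n f X \<partial>P) = (\<Sum>v\<in>(lattice 0 (int n) :: (real^'n) set). \<integral>X. f (translate v X) \<partial>P) / real n ^ CARD('n)"
    unfolding avg_def using integrable_translate[OF assms(1)]
    by (simp add: Bochner_Integration.integral_sum)
  also have "\<dots> = (\<integral>X. f X \<partial>P)"
    using assms integral_translate[of f] by (simp add: card_lattice)
  finally show ?thesis .
qed

lemma avg_diff: "avg n (\<lambda>X. f X - g X) X = avg n f X - avg n g X"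
  by (simp add: avg_def sum_subtractf diff_divide_distrib)

lemma avg_add: "avg n (\<lambda>X. f X + g X) X = avg n f X + avg n g X"
  by (simp add: avg_def sum.distrib add_divide_distrib)

lemma avg_divide: "avg n (\<lambda>X. f X / c) X = avg n f X / c"
  by (simp add: avg_def sum_divide_distrib[symmetric] mult.commute)

lemma abs_avg_le: "\<bar>avg n f X\<bar> \<le> avg n (\<lambda>X. \<bar>f X\<bar>) X"
  unfolding avg_def by (simp add: divide_right_mono sum_abs)

lemma avg_bounded:
  assumes "\<And>X. \<bar>f X\<bar> \<le> M"
  shows "\<bar>avg n f X\<bar> \<le> M"
proof (cases "n = 0")
  case True
  \<comment> \<open>For \<open>n = 0\<close> division by zero makes the average 0, and
    \<open>M\<close> bounds an absolute value.\<close>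
  thus ?thesis using order_trans[OF abs_ge_zero assms] by (simp add: avg_def power_0_left)
next
  case False
  have "\<bar>avg n f X\<bar> \<le> (\<Sum>v\<in>(lattice 0 (int n) :: (real^'n) set). M) / real n ^ CARD('n)"
    unfolding avg_def abs_divide abs_of_nonneg[OF zero_le_power[OF of_nat_0_le_iff]]
    by (intro divide_right_mono order_trans[OF sum_abs] sum_mono assms) simp
  thus ?thesis using False by (simp add: card_lattice)
qed

text \<open>Jensen's inequality for the square, in the form of Cauchy-Schwarz for finite
  sums.\<close>

lemma avg_square_le: "(avg n f X)\<^sup>2 \<le> avg n (\<lambda>X. (f X)\<^sup>2) X"
proof (cases "n = 0")
  case False
  have "(\<Sum>v\<in>lattice 0 (int n). f (translate v X))\<^sup>2
    \<le> real (card (lattice 0 (int n) :: (real^'n) set)) * (\<Sum>v\<in>lattice 0 (int n). (f (translate v X))\<^sup>2)"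
    using sum_squared_le_sum_of_squares[of _ "lattice 0 (int n) :: (real^'n) set"] by (simp add: mult.commute)
  thus ?thesis using False
    by (simp add: avg_def card_lattice power_divide divide_le_eq power2_eq_square field_simps)
qed (simp add: avg_def power_0_left)

lemma avg_L1_contraction:
  assumes "integrable P f" "0 < n"
  shows "(\<integral>X. \<bar>avg n f X\<bar> \<partial>P) \<le> (\<integral>X. \<bar>f X\<bar> \<partial>P)"
proof -
  have "(\<integral>X. \<bar>avg n f X\<bar> \<partial>P) \<le> (\<integral>X. avg n (\<lambda>X. \<bar>f X\<bar>) X \<partial>P)"
    using assms by (intro integral_mono abs_avg_le integrable_abs avg_integrable)
  also have "\<dots> = (\<integral>X. \<bar>f X\<bar> \<partial>P)" using assms by (intro integral_avg integrable_abs)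
  finally show ?thesis .
qed

text \<open>Integer translates of the unit cube tile the large one, so counts per volume are exactly
  the averages of the single observable \<open>F 0 1\<close>.\<close>

lemma avg_F_unit: "X \<in> configs \<Longrightarrow> avg n (F 0 1) X = F 0 (real n) X / real n ^ CARD('n)"
  using F_scale_sum[of X 1 n] by (simp add: avg_def F_translate)

text \<open>The shifted and the unshifted index box both contain the lattice points with coordinates
  from \<open>k\<close> to below \<open>n\<close>, and each has n^d - (n - k)^d further points. The
  common part cancels.\<close>

lemma sum_lattice_shift_le:
  fixes g :: "real^'n \<Rightarrow> real"
  assumes u: "u \<in> lattice 0 (int k)" and "k \<le> n" and g: "\<And>v. \<bar>g v\<bar> \<le> M"
  shows "\<bar>(\<Sum>v\<in>lattice 0 (int n). g (u + v)) - (\<Sum>v\<in>lattice 0 (int n). g v)\<bar>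
    \<le> 2 * M * (real n ^ CARD('n) - real (n - k) ^ CARD('n))"
proof -
  let ?B = "lattice 0 (int n) :: (real^'n) set" and ?W = "lattice (int k) (int n) :: (real^'n) set"
  let ?A = "(\<lambda>v. u + v) ` ?B"
  have cA: "card ?A = n ^ CARD('n)" by (simp add: card_image card_lattice)
  have cB: "card ?B = n ^ CARD('n)" by (simp add: card_lattice)
  have cW: "card ?W = (n - k) ^ CARD('n)" using \<open>k \<le> n\<close> by (simp add: card_lattice nat_diff_distrib)
  have WB: "?W \<subseteq> ?B" unfolding lattice_def by fastforce
  have WA: "?W \<subseteq> ?A"
  proof
    fix w assume w: "w \<in> ?W"
    have "w - u \<in> ?B"
      unfolding lattice_def
    proof safe
      fix b :: "real^'n" assume b: "b \<in> Basis"
      obtain y where y: "w \<bullet> b = of_int y" "int k \<le> y" "y < int n" by (rule latticeE[OF w b])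
      obtain z where z: "u \<bullet> b = of_int z" "0 \<le> z" "z < int k" by (rule latticeE[OF u b])
      show "\<exists>z. (w - u) \<bullet> b = of_int z \<and> 0 \<le> z \<and> z < int n"
        using y z by (intro exI[of _ "y - z"]) (simp add: inner_simps)
    qed
    thus "w \<in> ?A" by (intro image_eqI[of _ _ "w - u"]) auto
  qed
  have bd: "\<bar>\<Sum>v\<in>S - ?W. g v\<bar> \<le> M * (real n ^ CARD('n) - real (n - k) ^ CARD('n))" if S: "finite S" "?W \<subseteq> S" "card S = n ^ CARD('n)" for S
  proof -
    have "\<bar>\<Sum>v\<in>S - ?W. g v\<bar> \<le> (\<Sum>v\<in>S - ?W. M)" using g by (intro order_trans[OF sum_abs] sum_mono)
    also have "\<dots> = M * real (card (S - ?W))" by simp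
    also have "card (S - ?W) = n ^ CARD('n) - (n - k) ^ CARD('n)" using S cW by (simp add: card_Diff_subset)
    also have "real (n ^ CARD('n) - (n - k) ^ CARD('n)) = real n ^ CARD('n) - real (n - k) ^ CARD('n)"
      by (subst of_nat_diff) (auto intro: power_mono)
    finally show ?thesis .
  qed
  have "(\<Sum>v\<in>?B. g (u + v)) = (\<Sum>v\<in>?A. g v)" by (simp add: sum.reindex)
  also have "\<dots> = (\<Sum>v\<in>?A - ?W. g v) + (\<Sum>v\<in>?W. g v)" using WA by (intro sum.subset_diff) auto
  finally have 1: "(\<Sum>v\<in>?B. g (u + v)) = (\<Sum>v\<in>?A - ?W. g v) + (\<Sum>v\<in>?W. g v)" .
  have 2: "(\<Sum>v\<in>?B. g v) = (\<Sum>v\<in>?B - ?W. g v) + (\<Sum>v\<in>?W. g v)" using WB by (intro sum.subset_diff) auto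
  show ?thesis using 1 2 bd[OF _ WA cA] bd[OF _ WB cB] by simp
qed

text \<open>For \<open>k \<le> n\<close>, the proportion of lattice points of a box of side
  \<open>n\<close> that lie outside a subbox of side \<open>n - k\<close>.\<close>

definition boundary :: "nat \<Rightarrow> nat \<Rightarrow> real" where
  "boundary k n = 1 - (real (n - k) / real n) ^ CARD('n)"

lemma boundary_tendsto: "(\<lambda>n. boundary k n) \<longlonglongrightarrow> 0"
proof -
  have "(\<lambda>n. 1 - (1 - real k / real n) ^ CARD('n)) \<longlonglongrightarrow> 1 - (1 - 0) ^ CARD('n)"
    by (intro tendsto_intros lim_const_over_n)
  moreover have "\<forall>\<^sub>F n in sequentially. 1 - (1 - real k / real n) ^ CARD('n) = boundary k n"
    using eventually_ge_at_top[of "Suc k"]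
  proof eventually_elim
    case (elim n)
    hence "real (n - k) / real n = 1 - real k / real n" by (simp add: of_nat_diff field_simps)
    thus ?case by (simp add: boundary_def)
  qed
  ultimately show ?thesis by (auto elim: Lim_transform_eventually)
qed

text \<open>Swapping the sums writes the double average as a mean over \<open>u\<close> of shifted
  averages of length \<open>n\<close>, each of which differs from the unshifted one by boundary
  terms only. Long averages thus hardly notice a previous averaging over a fixed box.\<close>

lemma avg_avg_close:
  assumes f: "\<And>X. \<bar>f X\<bar> \<le> M" and kn: "0 < k" "k \<le> n"
  shows "\<bar>avg n (avg k f) X - avg n f X\<bar> \<le> 2 * M * boundary k n"
proof -
  let ?K = "lattice 0 (int k) :: (real^'n) set" and ?N = "lattice 0 (int n) :: (real^'n) set"
  have "avg n (avg k f) X = (\<Sum>v\<in>?N. \<Sum>u\<in>?K. f (translate (u + v) X)) / real k ^ CARD('n) / real n ^ CARD('n)"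
    by (simp add: avg_def translate_translate sum_divide_distrib)
  also have "(\<Sum>v\<in>?N. \<Sum>u\<in>?K. f (translate (u + v) X)) = (\<Sum>u\<in>?K. \<Sum>v\<in>?N. f (translate (u + v) X))"
    by (rule sum.swap)
  finally have 1: "avg n (avg k f) X = (\<Sum>u\<in>?K. \<Sum>v\<in>?N. f (translate (u + v) X)) / real k ^ CARD('n) / real n ^ CARD('n)" .
  have "avg n f X = (\<Sum>u\<in>?K. \<Sum>v\<in>?N. f (translate v X)) / real k ^ CARD('n) / real n ^ CARD('n)"
    using kn by (simp add: avg_def card_lattice)
  with 1 have "avg n (avg k f) X - avg n f X
      = (\<Sum>u\<in>?K. (\<Sum>v\<in>?N. f (translate (u + v) X)) - (\<Sum>v\<in>?N. f (translate v X))) / real k ^ CARD('n) / real n ^ CARD('n)"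
    by (simp add: sum_subtractf diff_divide_distrib)
  also have "\<bar>\<dots>\<bar> \<le> (\<Sum>u\<in>?K. 2 * M * (real n ^ CARD('n) - real (n - k) ^ CARD('n))) / real k ^ CARD('n) / real n ^ CARD('n)"
    unfolding abs_divide abs_of_nonneg[OF zero_le_power[OF of_nat_0_le_iff]]
    by (intro divide_right_mono order_trans[OF sum_abs] sum_mono sum_lattice_shift_le f kn) simp_all
  also have "\<dots> = 2 * M * boundary k n"
    using kn by (simp add: card_lattice boundary_def power_divide field_simps)
  finally show ?thesis .
qed

end

section \<open>The mean ergodic theorem\<close>

context stationary_spp
begin

lemma integrable_bounded:
  fixes f :: "(real^'n) set \<Rightarrow> real"
  assumes "f \<in> borel_measurable P" "\<And>X. \<bar>f X\<bar> \<le> M"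
  shows "integrable P f"
  using assms by (intro integrable_const_bound[where B=M]) auto

lemma integrable_square_bounded:
  fixes f :: "(real^'n) set \<Rightarrow> real"
  assumes f: "f \<in> borel_measurable P" "\<And>X. \<bar>f X\<bar> \<le> M"
  shows "integrable P (\<lambda>X. (f X)\<^sup>2)"
proof (rule integrable_bounded)
  show "\<bar>(f X)\<^sup>2\<bar> \<le> M\<^sup>2" for X using power_mono[OF f(2)[of X], of 2] by simp
qed (use f in simp)

text \<open>Averaging contracts the L^2 norm, so the long average of \<open>f\<close> is hardly
  larger than \<open>g\<close> when the long averages of the two are close. The cases of interest
  are \<open>g\<close> an average of \<open>f\<close> and \<open>g\<close> the midpoint of two
  averages.\<close>

lemma integral_square_avg_le:
  fixes f g :: "(real^'n) set \<Rightarrow> real"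
  assumes f: "f \<in> borel_measurable P" "\<And>X. \<bar>f X\<bar> \<le> M" and g: "g \<in> borel_measurable P" "\<And>X. \<bar>g X\<bar> \<le> M"
    and "0 < n" and c: "\<And>X. \<bar>avg n g X - avg n f X\<bar> \<le> c"
  shows "(\<integral>X. (avg n f X)\<^sup>2 \<partial>P) \<le> (\<integral>X. (g X)\<^sup>2 \<partial>P) + 2 * M * c"
proof -
  have M: "0 \<le> M" using f(2)[of undefined] by linarith
  have i: "integrable P (\<lambda>X. (avg n f X)\<^sup>2)" "integrable P (\<lambda>X. (g X)\<^sup>2)"
    by (rule integrable_square_bounded[OF avg_measurable[OF f(1)] avg_bounded[OF f(2)]], rule integrable_square_bounded[OF g])
  have "(\<integral>X. (avg n f X)\<^sup>2 \<partial>P) \<le> (\<integral>X. avg n (\<lambda>X. (g X)\<^sup>2) X + 2 * M * c \<partial>P)"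
  proof (rule integral_mono[OF i(1)])
    show "integrable P (\<lambda>X. avg n (\<lambda>X. (g X)\<^sup>2) X + 2 * M * c)"
      using avg_integrable[OF i(2)] by simp
    fix X
    have "(avg n f X)\<^sup>2 - (avg n g X)\<^sup>2 = (avg n f X - avg n g X) * (avg n f X + avg n g X)"
      by (simp add: power2_eq_square algebra_simps)
    also have "\<dots> \<le> \<bar>avg n f X - avg n g X\<bar> * \<bar>avg n f X + avg n g X\<bar>"
      by (metis abs_ge_self abs_mult)
    also have "\<dots> \<le> c * (2 * M)"
    proof (intro mult_mono)
      show "\<bar>avg n f X - avg n g X\<bar> \<le> c" using c[of X] by linarith
      show "\<bar>avg n f X + avg n g X\<bar> \<le> 2 * M"
        using avg_bounded[where f=f and n=n and X=X, OF f(2)] avg_bounded[where f=g and n=n and X=X, OF g(2)] by linarith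
      show "0 \<le> c" using c[of X] by linarith
    qed simp
    finally show "(avg n f X)\<^sup>2 \<le> avg n (\<lambda>X. (g X)\<^sup>2) X + 2 * M * c"
      using avg_square_le[where n=n and f=g and X=X] by (simp add: mult.commute)
  qed
  also have "\<dots> = (\<integral>X. (g X)\<^sup>2 \<partial>P) + 2 * M * c"
    using avg_integrable[OF i(2)] integral_avg[OF i(2) \<open>0 < n\<close>] by (simp add: prob_space)
  finally show ?thesis .
qed

text \<open>The squared norms of the averages converge to their infimum; by the parallelogram law the
  averages are then Cauchy.\<close>

lemma avg_L2_Cauchy:
  fixes f :: "(real^'n) set \<Rightarrow> real"
  assumes f: "f \<in> borel_measurable P" "\<And>X. \<bar>f X\<bar> \<le> M" and "0 < e"
  shows "\<exists>N>0. \<forall>k\<ge>N. \<forall>j\<ge>N. (\<integral>X. (avg k f X - avg j f X)\<^sup>2 \<partial>P) < e"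
proof -
  define a where "a n = (\<integral>X. (avg n f X)\<^sup>2 \<partial>P)" for n
  define m where "m = (INF n\<in>{1..}. a n)"
  have bb: "bdd_below (a ` {1..})"
    by (rule bdd_belowI[of _ 0]) (auto simp: a_def)
  have m_le: "m \<le> a n" if "0 < n" for n
    unfolding m_def using that by (intro cINF_lower bb) auto
  have fm: "avg k f \<in> borel_measurable P" "\<bar>avg k f X\<bar> \<le> M" for k X
    using avg_measurable[OF f(1)] avg_bounded[OF f(2)] by auto
  \<comment> \<open>The infimum also bounds the midpoint: averaging the midpoint over a long box
    gives nearly \<open>avg n f\<close>, whose squared norm is at least \<open>m\<close>, and the
    error vanishes as \<open>n\<close> grows.\<close>
  have mid: "m \<le> (\<integral>X. ((avg k f X + avg j f X) / 2)\<^sup>2 \<partial>P)" if kj: "0 < k" "0 < j" for k j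
  proof -
    let ?g = "\<lambda>X. (avg k f X + avg j f X) / 2"
    have gm: "?g \<in> borel_measurable P" using fm by simp
    have gb: "\<bar>?g X\<bar> \<le> M" for X using fm(2)[of k X] fm(2)[of j X] by auto
    have le: "m \<le> (\<integral>X. (?g X)\<^sup>2 \<partial>P) + 2 * M * (M * (boundary k n + boundary j n))" if n: "max k j \<le> n" for n
    proof -
      have c: "\<bar>avg n ?g X - avg n f X\<bar> \<le> M * (boundary k n + boundary j n)" for X
      proof -
        have "avg n ?g X - avg n f X
          = ((avg n (avg k f) X - avg n f X) + (avg n (avg j f) X - avg n f X)) / 2"
          by (simp add: avg_divide avg_add field_simps)
        moreover have "\<bar>avg n (avg k f) X - avg n f X\<bar> \<le> 2 * M * boundary k n"
          using kj n by (intro avg_avg_close[OF f(2)]) auto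
        moreover have "\<bar>avg n (avg j f) X - avg n f X\<bar> \<le> 2 * M * boundary j n"
          using kj n by (intro avg_avg_close[OF f(2)]) auto
        ultimately show ?thesis by (simp add: algebra_simps)
      qed
      have "m \<le> a n" using kj n by (intro m_le) auto
      also have "\<dots> \<le> (\<integral>X. (?g X)\<^sup>2 \<partial>P) + 2 * M * (M * (boundary k n + boundary j n))"
        unfolding a_def using kj n by (intro integral_square_avg_le[OF f gm gb _ c]) auto
      finally show ?thesis .
    qed
    have "(\<lambda>n. (\<integral>X. (?g X)\<^sup>2 \<partial>P) + 2 * M * (M * (boundary k n + boundary j n)))
      \<longlonglongrightarrow> (\<integral>X. (?g X)\<^sup>2 \<partial>P) + 2 * M * (M * (0 + 0))"
      by (intro tendsto_intros boundary_tendsto)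
    hence "m \<le> (\<integral>X. (?g X)\<^sup>2 \<partial>P) + 2 * M * (M * (0 + 0))"
      by (rule LIMSEQ_le_const) (use le in blast)
    thus ?thesis by simp
  qed
  \<comment> \<open>The margin e / 4 is what the parallelogram identity asks for: 2 * a k + 2 * a j
    - 4 * m < 4 * (e / 4).\<close>
  have "\<exists>N>0. \<forall>n\<ge>N. a n < m + e / 4"
  proof -
    have "Inf (a ` {1..}) < m + e / 8" using \<open>0 < e\<close> by (simp add: m_def)
    \<comment> \<open>One average nearly attains the infimum, and every sufficiently long average
      exceeds its squared norm by a boundary term at most.\<close>
    then obtain k where k: "0 < k" "a k < m + e / 8"
      using bb by (subst (asm) cInf_less_iff) (auto simp: Suc_le_eq)
    have "(\<lambda>n. 2 * M * (2 * M * boundary k n)) \<longlonglongrightarrow> 2 * M * (2 * M * 0)"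
      by (intro tendsto_intros boundary_tendsto)
    from order_tendstoD(2)[OF this, of "e / 8"] \<open>0 < e\<close>
    obtain N where N: "\<And>n. n \<ge> N \<Longrightarrow> 2 * M * (2 * M * boundary k n) < e / 8"
      by (auto simp: eventually_sequentially)
    have "a n < m + e / 4" if n: "n \<ge> max k N" for n
    proof -
      have "a n \<le> a k + 2 * M * (2 * M * boundary k n)"
        unfolding a_def using k n
        by (intro integral_square_avg_le[OF f fm] avg_avg_close[OF f(2)]) auto
      thus ?thesis using k(2) N[of n] n by simp
    qed
    thus ?thesis using k(1) by (intro exI[of _ "max k N"]) auto
  qed
  then obtain N where N: "0 < N" "\<And>n. n \<ge> N \<Longrightarrow> a n < m + e / 4" by blast
  have "(\<integral>X. (avg k f X - avg j f X)\<^sup>2 \<partial>P) < e" if kj: "k \<ge> N" "j \<ge> N" for k j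
  proof -
    have gb: "\<bar>(avg k f X + avg j f X) / 2\<bar> \<le> M" for X using fm(2)[of k X] fm(2)[of j X] by auto
    have "(\<integral>X. (avg k f X - avg j f X)\<^sup>2 \<partial>P)
      = (\<integral>X. 2 * (avg k f X)\<^sup>2 + 2 * (avg j f X)\<^sup>2 - 4 * ((avg k f X + avg j f X) / 2)\<^sup>2 \<partial>P)"
      by (rule Bochner_Integration.integral_cong[OF refl]) (simp add: power2_eq_square field_simps)
    also have "\<dots> = 2 * a k + 2 * a j - 4 * (\<integral>X. ((avg k f X + avg j f X) / 2)\<^sup>2 \<partial>P)"
      unfolding a_def using integrable_square_bounded[OF fm, of k] integrable_square_bounded[OF fm, of j] integrable_square_bounded[OF _ gb] fm by simp
    also have "\<dots> < e"
      using mid[of k j] N(2)[OF kj(1)] N(2)[OF kj(2)] N(1) kj by simp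
    finally show ?thesis .
  qed
  thus ?thesis using N(1) by blast
qed

text \<open>L^2 smallness passes to L^1 through the pointwise bound |h| \<le> e / 2 + h^2 / (2 * e),
  a rearrangement of (|h| - e)^2 \<ge> 0, and total mass 1.\<close>

lemma avg_L1_Cauchy_bounded:
  fixes f :: "(real^'n) set \<Rightarrow> real"
  assumes f: "f \<in> borel_measurable P" "\<And>X. \<bar>f X\<bar> \<le> M" and "0 < e"
  shows "\<exists>N>0. \<forall>k\<ge>N. \<forall>j\<ge>N. (\<integral>X. \<bar>avg k f X - avg j f X\<bar> \<partial>P) < e"
proof -
  have "0 < e\<^sup>2" using \<open>0 < e\<close> by simp
  from avg_L2_Cauchy[OF f this] obtain N where
    N: "0 < N" "\<And>k j. k \<ge> N \<Longrightarrow> j \<ge> N \<Longrightarrow> (\<integral>X. (avg k f X - avg j f X)\<^sup>2 \<partial>P) < e\<^sup>2" by blast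
  have "(\<integral>X. \<bar>avg k f X - avg j f X\<bar> \<partial>P) < e" if kj: "k \<ge> N" "j \<ge> N" for k j
  proof -
    let ?h = "\<lambda>X. avg k f X - avg j f X"
    have hm: "?h \<in> borel_measurable P" using avg_measurable[OF f(1)] by simp
    have hb: "\<bar>?h X\<bar> \<le> 2 * M" for X
      using avg_bounded[where f=f and n=k and X=X, OF f(2)] avg_bounded[where f=f and n=j and X=X, OF f(2)] by linarith
    have h2: "integrable P (\<lambda>X. (?h X)\<^sup>2)" by (rule integrable_square_bounded[OF hm hb])
    have "(\<integral>X. \<bar>?h X\<bar> \<partial>P) \<le> (\<integral>X. e / 2 + (?h X)\<^sup>2 / (2 * e) \<partial>P)"
    proof (rule integral_mono)
      show "integrable P (\<lambda>X. \<bar>?h X\<bar>)" using integrable_bounded[OF hm hb] by simp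
      show "integrable P (\<lambda>X. e / 2 + (?h X)\<^sup>2 / (2 * e))" using h2 by simp
      fix X
      have "0 \<le> (\<bar>?h X\<bar> - e)\<^sup>2" by simp
      hence "2 * e * \<bar>?h X\<bar> \<le> e\<^sup>2 + (?h X)\<^sup>2" by (simp add: power2_diff algebra_simps)
      thus "\<bar>?h X\<bar> \<le> e / 2 + (?h X)\<^sup>2 / (2 * e)" using \<open>0 < e\<close> by (simp add: field_simps power2_eq_square)
    qed
    also have "\<dots> = e / 2 + (\<integral>X. (?h X)\<^sup>2 \<partial>P) / (2 * e)" using h2 by (simp add: prob_space)
    also have "\<dots> < e / 2 + e\<^sup>2 / (2 * e)"
      using N(2)[OF kj] \<open>0 < e\<close> by (intro add_strict_left_mono divide_strict_right_mono) auto
    also have "\<dots> = e" using \<open>0 < e\<close> by (simp add: field_simps power2_eq_square)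
    finally show ?thesis .
  qed
  thus ?thesis using N(1) by blast
qed

text \<open>Truncation at a high level changes \<open>f\<close> little in L^1, and averaging
  contracts the L^1 norm, so the truncation error is small for all averages at once.\<close>

lemma avg_L1_Cauchy:
  fixes f :: "(real^'n) set \<Rightarrow> real"
  assumes f: "integrable P f" "\<And>X. 0 \<le> f X" and "0 < e"
  shows "\<exists>N>0. \<forall>k\<ge>N. \<forall>j\<ge>N. (\<integral>X. \<bar>avg k f X - avg j f X\<bar> \<partial>P) < e"
proof -
  have fm: "f \<in> borel_measurable P" using f(1) by simp
  let ?t = "\<lambda>M X. min (f X) (real M)"
  have tb: "\<bar>?t M X\<bar> \<le> real M" for M X using f(2)[of X] by auto
  have tm: "?t M \<in> borel_measurable P" for M using fm by simp
  have "(\<lambda>M. \<integral>X. \<bar>f X - ?t M X\<bar> \<partial>P) \<longlonglongrightarrow> (\<integral>X. 0 \<partial>P)"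
  proof (rule integral_dominated_convergence[where w = f])
    show "AE X in P. (\<lambda>M. \<bar>f X - ?t M X\<bar>) \<longlonglongrightarrow> 0"
    proof (rule AE_I2)
      fix X
      obtain M0 :: nat where M0: "f X \<le> real M0" using real_arch_simple by blast
      have "\<forall>\<^sub>F M in sequentially. \<bar>f X - ?t M X\<bar> = 0"
        using eventually_ge_at_top[of M0] by eventually_elim (use M0 in auto)
      thus "(\<lambda>M. \<bar>f X - ?t M X\<bar>) \<longlonglongrightarrow> 0" by (rule tendsto_eventually)
    qed
    show "AE X in P. norm \<bar>f X - ?t M X\<bar> \<le> f X" for M using f(2) by (intro AE_I2) (auto simp: min_def)
  qed (use f fm in auto)
  from order_tendstoD(2)[OF this, of "e / 3"] \<open>0 < e\<close>
  obtain M where M: "(\<integral>X. \<bar>f X - ?t M X\<bar> \<partial>P) < e / 3" by (auto simp: eventually_sequentially)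
  have tM: "\<bar>?t M X\<bar> \<le> real M" for X by (rule tb)
  have "0 < e / 3" using \<open>0 < e\<close> by simp
  from avg_L1_Cauchy_bounded[OF tm[of M] tM this] obtain N where
    N: "0 < N" "\<And>k j. k \<ge> N \<Longrightarrow> j \<ge> N \<Longrightarrow> (\<integral>X. \<bar>avg k (?t M) X - avg j (?t M) X\<bar> \<partial>P) < e / 3" by blast
  have ti: "integrable P (?t M)" by (rule integrable_bounded[OF tm[of M] tM])
  have di: "integrable P (\<lambda>X. f X - ?t M X)" using f(1) ti by simp
  have "(\<integral>X. \<bar>avg k f X - avg j f X\<bar> \<partial>P) < e" if kj: "k \<ge> N" "j \<ge> N" for k j
  proof -
    let ?D = "\<lambda>X. f X - ?t M X"
    have "(\<integral>X. \<bar>avg k f X - avg j f X\<bar> \<partial>P)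
      \<le> (\<integral>X. \<bar>avg k ?D X\<bar> + \<bar>avg j ?D X\<bar> + \<bar>avg k (?t M) X - avg j (?t M) X\<bar> \<partial>P)"
    proof (rule integral_mono)
      show "integrable P (\<lambda>X. \<bar>avg k f X - avg j f X\<bar>)" using avg_integrable[OF f(1)] by simp
      show "integrable P (\<lambda>X. \<bar>avg k ?D X\<bar> + \<bar>avg j ?D X\<bar> + \<bar>avg k (?t M) X - avg j (?t M) X\<bar>)"
        using avg_integrable[OF di] avg_integrable[OF ti] by simp
      show "\<bar>avg k f X - avg j f X\<bar> \<le> \<bar>avg k ?D X\<bar> + \<bar>avg j ?D X\<bar> + \<bar>avg k (?t M) X - avg j (?t M) X\<bar>" for X
        unfolding avg_diff by linarith
    qed
    also have "\<dots> = (\<integral>X. \<bar>avg k ?D X\<bar> \<partial>P) + (\<integral>X. \<bar>avg j ?D X\<bar> \<partial>P) + (\<integral>X. \<bar>avg k (?t M) X - avg j (?t M) X\<bar> \<partial>P)"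
      using avg_integrable[OF di] avg_integrable[OF ti] by simp
    also have "\<dots> < e"
      using avg_L1_contraction[OF di, of k] avg_L1_contraction[OF di, of j] M N(1) N(2)[OF kj] kj by simp
    finally show ?thesis .
  qed
  thus ?thesis using N(1) by blast
qed

lemma F_L1_Cauchy:
  assumes "0 < e"
  shows "\<exists>N>0. \<forall>k\<ge>N. \<forall>j\<ge>N. (\<integral>X. \<bar>F 0 (real k) X / real k ^ CARD('n) - F 0 (real j) X / real j ^ CARD('n)\<bar> \<partial>P) < e"
proof -
  have "(\<integral>X. \<bar>avg k (F 0 1) X - avg j (F 0 1) X\<bar> \<partial>P)
    = (\<integral>X. \<bar>F 0 (real k) X / real k ^ CARD('n) - F 0 (real j) X / real j ^ CARD('n)\<bar> \<partial>P)" for k j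
    by (rule Bochner_Integration.integral_cong[OF refl]) (simp add: avg_F_unit space_P)
  with avg_L1_Cauchy[OF integrable_F[of 0 1] F_nonneg assms] show ?thesis by simp
qed

end

section \<open>Ergodicity and the constant limit of the averages\<close>

locale ergodic_spp = stationary_spp P \<rho> for P :: "(real^'n) set measure" and \<rho> +
  assumes ergodic: "ergodic P"
begin

lemma hcube_neg_One: "hcube (- (p *\<^sub>R One)) (L + 2 * p) = block (- p) (L + p)"
  by (auto simp: hcube_def block_def inner_simps)

text \<open>The cube \<open>[-p, r k + p)\<close>, \<open>p\<close> arbitrary, absorbs a fixed translation; this makes the
  following event invariant under every translation and not just almost surely.\<close>

definition low_density :: "(nat \<Rightarrow> nat) \<Rightarrow> real \<Rightarrow> (real^'n) set set" where
  "low_density r q = {X \<in> configs. \<forall>p::nat. \<forall>n. \<exists>k\<ge>n.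
     real (card (X \<inter> block (- real p) (real (r k) + real p))) / real (r k) ^ CARD('n) < q}"

lemma sets_low_density: "low_density r q \<in> sets P"
proof -
  let ?c = "\<lambda>p k X. real (card (X \<inter> block (- real p) (real (r k) + real p))) / real (r k) ^ CARD('n)"
  have "?c p k \<in> borel_measurable P" for p k
    by (rule borel_measurable_divide[OF count_measurable[OF borel_block bounded_block] borel_measurable_const])
  hence m: "{X \<in> space P. ?c p k X < q} \<in> sets P" for p k
    by (rule borel_measurable_less) simp
  have "{X \<in> space P. \<forall>p n. \<exists>k. n \<le> k \<and> ?c p k X < q} \<in> sets P"
    by (intro sets.sets_Collect_countable_All sets.sets_Collect_countable_Ex sets.sets_Collect_conj
      sets.sets_Collect_const m)
  thus ?thesis unfolding low_density_def space_P .
qed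

text \<open>Shifting by \<open>a\<close> moves a cube enlarged by \<open>p\<close> into the cube
  enlarged by any \<open>p'\<close> of size at least \<open>p + norm a\<close>, and the defining
  condition holds for all enlargements.\<close>

lemma translate_low_density:
  assumes X: "X \<in> low_density r q"
  shows "translate a X \<in> low_density r q"
proof -
  have Xc: "X \<in> configs" using X by (simp add: low_density_def)
  have "\<exists>k\<ge>n. real (card (translate a X \<inter> block (- real p) (real (r k) + real p))) / real (r k) ^ CARD('n) < q" for p n
  proof -
    obtain p' :: nat where p': "real p + norm a \<le> real p'" using real_arch_simple by blast
    obtain k where k: "k \<ge> n" "real (card (X \<inter> block (- real p') (real (r k) + real p'))) / real (r k) ^ CARD('n) < q"
      using X unfolding low_density_def by blast
    have "{x. x - a \<in> block (- real p) (real (r k) + real p)} \<subseteq> block (- real p') (real (r k) + real p')"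
    proof
      fix x assume x: "x \<in> {x. x - a \<in> block (- real p) (real (r k) + real p)}"
      show "x \<in> block (- real p') (real (r k) + real p')"
        unfolding block_def
      proof safe
        fix b :: "real^'n" assume b: "b \<in> Basis"
        have "- real p \<le> (x - a) \<bullet> b" "(x - a) \<bullet> b < real (r k) + real p" using x b by (auto simp: block_def)
        moreover have "\<bar>a \<bullet> b\<bar> \<le> norm a" using Basis_le_norm[OF b] .
        ultimately show "- real p' \<le> x \<bullet> b" "x \<bullet> b < real (r k) + real p'" using p' by (auto simp: inner_simps)
      qed
    qed
    hence "card (translate a X \<inter> block (- real p) (real (r k) + real p)) \<le> card (X \<inter> block (- real p') (real (r k) + real p'))"
      unfolding card_translate by (intro card_mono configs_finite[OF Xc]) auto
    hence "real (card (translate a X \<inter> block (- real p) (real (r k) + real p))) / real (r k) ^ CARD('n)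
      \<le> real (card (X \<inter> block (- real p') (real (r k) + real p'))) / real (r k) ^ CARD('n)"
      by (intro divide_right_mono) auto
    with k show ?thesis by (intro exI[of _ k]) linarith
  qed
  thus ?thesis using translate_in_configs[OF Xc] by (simp add: low_density_def)
qed

lemma prob_low_density: "prob (low_density r q) = 0 \<or> prob (low_density r q) = 1"
proof -
  have inv: "translate a -` low_density r q \<inter> space P = low_density r q" for a
  proof (intro equalityI subsetI)
    fix X assume "X \<in> translate a -` low_density r q \<inter> space P"
    hence "translate (- a) (translate a X) \<in> low_density r q" using translate_low_density by blast
    thus "X \<in> low_density r q" by (simp add: translate_translate)
  next
    fix X assume "X \<in> low_density r q"
    thus "X \<in> translate a -` low_density r q \<inter> space P"
      using translate_low_density by (auto simp: space_P low_density_def)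
  qed
  have "\<forall>A\<in>sets P. (\<forall>a. translate a -` A \<inter> space P = A) \<longrightarrow> prob A = 0 \<or> prob A = 1"
    using ergodic by (simp add: ergodic_def)
  from this[rule_format, OF sets_low_density inv] show ?thesis .
qed

text \<open>The enlarged block is again a half-open cube, of integer side \<open>n + 2 * p\<close>,
  so its mean count is exact.\<close>

lemma block_excess_integral:
  "(\<integral>X. real (card (X \<inter> block (- real p) (real n + real p))) - F 0 (real n) X \<partial>P)
    = \<rho> * (real (n + 2 * p) ^ CARD('n) - real n ^ CARD('n))"
proof -
  have b: "block (- real p) (real n + real p) = hcube (- (real p *\<^sub>R (One :: real^'n))) (real (n + 2 * p))"
    using hcube_neg_One[of "real p" "real n", where 'a="real^'n"] by simp
  have "(\<integral>X. real (card (X \<inter> block (- real p) (real n + real p))) - F 0 (real n) X \<partial>P)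
    = (\<integral>X. F (- (real p *\<^sub>R One)) (real (n + 2 * p)) X - F 0 (real n) X \<partial>P)"
    by (simp only: b F_def)
  also have "\<dots> = \<rho> * real (n + 2 * p) ^ CARD('n) - \<rho> * real n ^ CARD('n)"
    by (simp only: Bochner_Integration.integral_diff[OF integrable_F integrable_F] integral_F_nat)
  finally show ?thesis by (simp only: right_diff_distrib)
qed

text \<open>Enlarging the cube by a fixed \<open>p\<close> adds points whose mean number is of lower
  order than the volume. The normalised excess therefore tends to 0 in L^1 and almost surely along a
  subsequence, which suffices because \<open>low_density\<close> asks only for infinitely many
  \<open>k\<close>.\<close>

lemma block_excess_frequently_small:
  fixes r :: "nat \<Rightarrow> nat"
  assumes r: "strict_mono r"
  shows "AE X in P. \<forall>e>0. \<forall>n. \<exists>k\<ge>n.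
    (real (card (X \<inter> block (- real p) (real (r k) + real p))) - F 0 (real (r k)) X) / real (r k) ^ CARD('n) < e"
proof -
  define D where "D n X = (real (card (X \<inter> block (- real p) (real n + real p))) - F 0 (real n) X) / real n ^ CARD('n)" for n X
  have bi: "integrable P (\<lambda>X. real (card (X \<inter> block (- real p) (real n + real p))))" for n
    by (rule integrable_count[OF borel_block bounded_block])
  have Di: "integrable P (D n)" for n
    unfolding D_def using bi integrable_F by simp
  have D0: "0 \<le> D n X" if "X \<in> space P" for n X
  proof -
    have "hcube (0 :: real^'n) (real n) \<subseteq> block (- real p) (real n + real p)"
      unfolding hcube_def block_def
    proof safe
      fix x b :: "real^'n" assume "\<forall>b\<in>Basis. 0 \<bullet> b \<le> x \<bullet> b \<and> x \<bullet> b < 0 \<bullet> b + real n" "b \<in> Basis"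
      hence "0 \<le> x \<bullet> b" "x \<bullet> b < real n" by auto
      thus "- real p \<le> x \<bullet> b" "x \<bullet> b < real n + real p" by linarith+
    qed
    hence "F 0 (real n) X \<le> real (card (X \<inter> block (- real p) (real n + real p)))"
      unfolding F_def using that by (intro of_nat_mono card_mono configs_finite) (auto simp: space_P)
    thus ?thesis by (simp add: D_def)
  qed
  have ID: "(\<integral>X. norm (D (r k) X) \<partial>P) = \<rho> * ((1 + real (2 * p) / real (r k)) ^ CARD('n) - 1)" if "r k > 0" for k
  proof -
    have "(\<integral>X. norm (D (r k) X) \<partial>P) = (\<integral>X. D (r k) X \<partial>P)"
      using D0 by (intro Bochner_Integration.integral_cong) auto
    also have "\<dots> = \<rho> * (real (r k + 2 * p) ^ CARD('n) - real (r k) ^ CARD('n)) / real (r k) ^ CARD('n)"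
      unfolding D_def by (simp only: integral_divide_zero block_excess_integral)
    also have "\<dots> = \<rho> * ((real (r k + 2 * p) / real (r k)) ^ CARD('n) - 1)"
      using that by (simp add: power_divide field_simps)
    also have "real (r k + 2 * p) / real (r k) = 1 + real (2 * p) / real (r k)"
      using that by (simp add: add_divide_distrib)
    finally show ?thesis .
  qed
  have "(\<lambda>k. \<integral>X. norm (D (r k) X) \<partial>P) \<longlonglongrightarrow> 0"
  proof (rule Lim_transform_eventually)
    have "(\<lambda>n. real (2 * p) / real n) \<longlonglongrightarrow> 0" by (rule lim_const_over_n)
    hence "(\<lambda>k. real (2 * p) / real (r k)) \<longlonglongrightarrow> 0"
      using LIMSEQ_subseq_LIMSEQ[OF _ r] by (auto simp: o_def)
    hence "(\<lambda>k. \<rho> * ((1 + real (2 * p) / real (r k)) ^ CARD('n) - 1)) \<longlonglongrightarrow> \<rho> * ((1 + 0) ^ CARD('n) - 1)"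
      by (intro tendsto_intros)
    thus "(\<lambda>k. \<rho> * ((1 + real (2 * p) / real (r k)) ^ CARD('n) - 1)) \<longlonglongrightarrow> 0" by simp
    show "\<forall>\<^sub>F k in sequentially. \<rho> * ((1 + real (2 * p) / real (r k)) ^ CARD('n) - 1) = (\<integral>X. norm (D (r k) X) \<partial>P)"
      using eventually_gt_at_top[of 0]
    proof eventually_elim
      case (elim k)
      hence "0 < r k" using seq_suble[OF r, of k] by simp
      thus ?case by (rule ID[symmetric])
    qed
  qed
  from tendsto_L1_AE_subseq[OF Di this] obtain s
    where s: "strict_mono s" "AE X in P. (\<lambda>k. D (r (s k)) X) \<longlonglongrightarrow> 0" by blast
  from s(2) show ?thesis
  proof eventually_elim
    case (elim X)
    show ?case
    proof safe
      fix e :: real and n :: nat assume "0 < e"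
      from order_tendstoD(2)[OF elim this] obtain m where m: "\<And>k. k \<ge> m \<Longrightarrow> D (r (s k)) X < e"
        by (auto simp: eventually_sequentially)
      have "n \<le> s (max m n)" using seq_suble[OF s(1), of "max m n"] by simp
      thus "\<exists>k\<ge>n. (real (card (X \<inter> block (- real p) (real (r k) + real p))) - F 0 (real (r k)) X) / real (r k) ^ CARD('n) < e"
        using m[of "max m n"] unfolding D_def by (intro exI[of _ "s (max m n)"]) simp
    qed
  qed
qed

text \<open>The averages have an L^1 limit \<open>h\<close> of mean \<rho>. Up to null sets the
  invariant event of level \<open>q\<close> contains {h < q} and is contained in {h \<le> q}; since
  its probability is 0 or 1, \<open>h\<close> can lie neither below nor above its mean with positive
  probability.\<close>

lemma F_L1_limit:
  "(\<lambda>n. \<integral>X. \<bar>F 0 (real n) X / real n ^ CARD('n) - \<rho>\<bar> \<partial>P) \<longlonglongrightarrow> 0"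
proof -
  define A where "A n X = F 0 (real n) X / real n ^ CARD('n)" for n X
  have Ai: "integrable P (A n)" for n unfolding A_def using integrable_F by simp
  have Am: "A n \<in> borel_measurable P" for n using Ai by simp
  have cau: "\<exists>N>0. \<forall>k\<ge>N. \<forall>j\<ge>N. (\<integral>X. \<bar>A k X - A j X\<bar> \<partial>P) < e" if "0 < e" for e
    unfolding A_def by (rule F_L1_Cauchy[OF that])
  have "\<exists>N. \<forall>i\<ge>N. \<forall>j\<ge>N. (LINT X|P. norm (A i X - A j X)) < e" if "0 < e" for e
    using cau[OF that] by auto
  from cauchy_L1_AE_cauchy_subseq[OF Ai this]
  obtain r where r: "strict_mono r" and cA: "AE X in P. Cauchy (\<lambda>i. A (r i) X)" by blast
  define h where "h X = lim (\<lambda>i. A (r i) X)" for X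
  have hm: "h \<in> borel_measurable P" unfolding h_def[abs_def] by (rule borel_measurable_lim_metric[OF Am])
  have hl: "AE X in P. (\<lambda>i. A (r i) X) \<longlonglongrightarrow> h X"
    using cA by eventually_elim (simp add: h_def Cauchy_convergent_iff convergent_LIMSEQ_iff)
  \<comment> \<open>Fatou's lemma along the almost surely convergent subsequence bounds the distance
    to \<open>h\<close> for every index beyond \<open>N\<close>, not only for those of the
    subsequence.\<close>
  have L1: "integrable P (\<lambda>X. A n X - h X) \<and> (\<integral>X. \<bar>A n X - h X\<bar> \<partial>P) \<le> e"
    if N: "\<forall>k\<ge>N. \<forall>j\<ge>N. (\<integral>X. \<bar>A k X - A j X\<bar> \<partial>P) < e" and n: "N \<le> n" and "0 < e" for N n e
  proof -
    have "(\<integral>\<^sup>+X. ennreal \<bar>A n X - h X\<bar> \<partial>P) \<le> (\<integral>\<^sup>+X. liminf (\<lambda>i. ennreal \<bar>A n X - A (r i) X\<bar>) \<partial>P)"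
    proof (rule nn_integral_mono_AE)
      show "AE X in P. ennreal \<bar>A n X - h X\<bar> \<le> liminf (\<lambda>i. ennreal \<bar>A n X - A (r i) X\<bar>)"
        using hl
      proof eventually_elim
        case (elim X)
        have "(\<lambda>i. ennreal \<bar>A n X - A (r i) X\<bar>) \<longlonglongrightarrow> ennreal \<bar>A n X - h X\<bar>"
          by (intro tendsto_ennrealI tendsto_rabs tendsto_diff tendsto_const elim)
        from lim_imp_Liminf[OF _ this] show ?case by simp
      qed
    qed
    also have "\<dots> \<le> liminf (\<lambda>i. \<integral>\<^sup>+X. ennreal \<bar>A n X - A (r i) X\<bar> \<partial>P)"
      using Am by (intro nn_integral_liminf) simp
    also have "\<dots> \<le> liminf (\<lambda>i. ennreal e)"
    proof (rule Liminf_mono)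
      show "\<forall>\<^sub>F i in sequentially. (\<integral>\<^sup>+X. ennreal \<bar>A n X - A (r i) X\<bar> \<partial>P) \<le> ennreal e"
        using eventually_ge_at_top[of N]
      proof eventually_elim
        case (elim i)
        hence ri: "N \<le> r i" using seq_suble[OF r, of i] by simp
        have "(\<integral>\<^sup>+X. ennreal \<bar>A n X - A (r i) X\<bar> \<partial>P) = ennreal (\<integral>X. \<bar>A n X - A (r i) X\<bar> \<partial>P)"
          using Ai by (intro nn_integral_eq_integral) auto
        also have "\<dots> \<le> ennreal e" using N n ri by (intro ennreal_leI) (simp add: less_imp_le)
        finally show ?case .
      qed
    qed
    also have "\<dots> = ennreal e" by (simp add: Liminf_const)
    finally have nn: "(\<integral>\<^sup>+X. ennreal \<bar>A n X - h X\<bar> \<partial>P) \<le> ennreal e" .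
    have i: "integrable P (\<lambda>X. A n X - h X)"
    proof (rule integrableI_bounded)
      show "(\<lambda>X. A n X - h X) \<in> borel_measurable P" using Am hm by simp
      show "(\<integral>\<^sup>+X. ennreal (norm (A n X - h X)) \<partial>P) < \<infinity>"
        unfolding real_norm_def by (rule order_le_less_trans[OF nn]) simp
    qed
    have "ennreal (\<integral>X. \<bar>A n X - h X\<bar> \<partial>P) = (\<integral>\<^sup>+X. ennreal \<bar>A n X - h X\<bar> \<partial>P)"
      using i by (intro nn_integral_eq_integral[symmetric]) auto
    with nn have "ennreal (\<integral>X. \<bar>A n X - h X\<bar> \<partial>P) \<le> ennreal e" by simp
    with i \<open>0 < e\<close> show ?thesis by (simp add: ennreal_le_iff)
  qed
  have hi: "integrable P h"
  proof -
    from cau[of 1] obtain N where "\<forall>k\<ge>N. \<forall>j\<ge>N. (\<integral>X. \<bar>A k X - A j X\<bar> \<partial>P) < 1" by auto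
    from L1[OF this order_refl] have "integrable P (\<lambda>X. A N X - h X)" by simp
    from Bochner_Integration.integrable_diff[OF Ai[of N] this] show ?thesis by simp
  qed
  have lim_h: "(\<lambda>n. \<integral>X. \<bar>A n X - h X\<bar> \<partial>P) \<longlonglongrightarrow> 0"
  proof (rule LIMSEQ_I)
    fix e :: real assume "0 < e"
    hence e2: "0 < e / 2" by simp
    from cau[OF e2] obtain N where N: "\<forall>k\<ge>N. \<forall>j\<ge>N. (\<integral>X. \<bar>A k X - A j X\<bar> \<partial>P) < e / 2" by blast
    have "norm ((\<integral>X. \<bar>A n X - h X\<bar> \<partial>P) - 0) < e" if "n \<ge> N" for n
    proof -
      have "(\<integral>X. \<bar>A n X - h X\<bar> \<partial>P) \<le> e / 2" using L1[OF N that e2] by blast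
      moreover have "0 \<le> (\<integral>X. \<bar>A n X - h X\<bar> \<partial>P)" by simp
      ultimately show ?thesis using \<open>0 < e\<close> by simp
    qed
    thus "\<exists>no. \<forall>n\<ge>no. norm ((\<integral>X. \<bar>A n X - h X\<bar> \<partial>P) - 0) < e" by blast
  qed
  have int_h: "(\<integral>X. h X \<partial>P) = \<rho>"
  proof -
    have "(\<lambda>n. \<rho> - (\<integral>X. h X \<partial>P)) \<longlonglongrightarrow> 0"
    proof (rule Lim_null_comparison[OF _ lim_h])
      show "\<forall>\<^sub>F n in sequentially. norm (\<rho> - (\<integral>X. h X \<partial>P)) \<le> (\<integral>X. \<bar>A n X - h X\<bar> \<partial>P)"
        using eventually_gt_at_top[of 0]
      proof eventually_elim
        case (elim n)
        have "\<rho> = (\<integral>X. A n X \<partial>P)" unfolding A_def using integral_F_nat[of 0 n] elim by simp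
        hence "\<rho> - (\<integral>X. h X \<partial>P) = (\<integral>X. A n X - h X \<partial>P)" using Ai hi by simp
        thus ?case using integral_abs_bound[of P "\<lambda>X. A n X - h X"] by simp
      qed
    qed
    hence "\<rho> - (\<integral>X. h X \<partial>P) = 0" by (simp add: LIMSEQ_const_iff)
    thus ?thesis by simp
  qed
  have "AE X in P. \<forall>p. \<forall>e>0. \<forall>n. \<exists>k\<ge>n.
    (real (card (X \<inter> block (- real p) (real (r k) + real p))) - F 0 (real (r k)) X) / real (r k) ^ CARD('n) < e"
    using block_excess_frequently_small[OF r] by (simp add: AE_all_countable)
  \<comment> \<open>Infinitely many densities below \<open>q\<close> force the limit to be at most
    \<open>q\<close>, by the case of enlargement 0; conversely a limit below \<open>q\<close> leaves
    room for the excess of any enlargement.\<close>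
  hence low: "AE X in P. \<forall>q. (h X < q \<longrightarrow> X \<in> low_density r q) \<and> (X \<in> low_density r q \<longrightarrow> h X \<le> q)"
    using hl AE_space
  proof eventually_elim
    case (elim X)
    show ?case
    proof (intro allI conjI impI)
      fix q assume q: "h X < q"
      have "\<exists>k\<ge>n. real (card (X \<inter> block (- real p) (real (r k) + real p))) / real (r k) ^ CARD('n) < q" for p n
      proof -
        \<comment> \<open>One half of the gap is spent on the density, the other on the
          excess.\<close>
        let ?e = "(q - h X) / 2"
        have e: "0 < ?e" using q by simp
        have "h X < h X + ?e" using e by linarith
        from order_tendstoD(2)[OF elim(2) this] obtain n0 where n0: "\<And>k. k \<ge> n0 \<Longrightarrow> A (r k) X < h X + ?e"
          by (auto simp: eventually_sequentially)
        obtain k where k: "k \<ge> max n n0"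
          "(real (card (X \<inter> block (- real p) (real (r k) + real p))) - F 0 (real (r k)) X) / real (r k) ^ CARD('n) < ?e"
          using elim(1) e by blast
        have "A (r k) X < h X + ?e" using n0 k(1) by simp
        with k(2) have "(real (card (X \<inter> block (- real p) (real (r k) + real p))) - F 0 (real (r k)) X) / real (r k) ^ CARD('n)
          + F 0 (real (r k)) X / real (r k) ^ CARD('n) < ?e + (h X + ?e)" unfolding A_def by linarith
        also have "?e + (h X + ?e) = q" by (simp add: field_simps)
        finally have "real (card (X \<inter> block (- real p) (real (r k) + real p))) / real (r k) ^ CARD('n) < q"
          by (simp add: diff_divide_distrib)
        with k(1) show ?thesis by (intro exI[of _ k]) simp
      qed
      thus "X \<in> low_density r q" using elim(3) unfolding low_density_def space_P by blast
    next
      fix q assume X: "X \<in> low_density r q"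
      have freq: "\<exists>k\<ge>n. A (r k) X < q" for n
      proof -
        obtain k where "k \<ge> n" "real (card (X \<inter> block (- real 0) (real (r k) + real 0))) / real (r k) ^ CARD('n) < q"
          using X unfolding low_density_def by blast
        thus ?thesis unfolding A_def F_def by (intro exI[of _ k]) (simp add: block_eq_hcube)
      qed
      show "h X \<le> q"
      proof (rule ccontr)
        assume "\<not> h X \<le> q"
        hence "q < h X" by simp
        from order_tendstoD(1)[OF elim(2) this] obtain n0 where "\<And>k. k \<ge> n0 \<Longrightarrow> q < A (r k) X"
          by (auto simp: eventually_sequentially)
        with freq[of n0] show False by force
      qed
    qed
  qed
  \<comment> \<open>Probability 1 would give \<open>h \<le> q\<close> almost surely and hence a mean
    at most \<open>q\<close>, below \<rho>; so the event is null and
    \<open>q \<le> h\<close>.\<close>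
  have ge: "AE X in P. q \<le> h X" if "q < \<rho>" for q
  proof -
    have "prob (low_density r q) \<noteq> 1"
    proof
      assume "prob (low_density r q) = 1"
      hence "AE X in P. X \<in> low_density r q" using sets_low_density by (simp add: prob_eq_1)
      hence "AE X in P. h X \<le> q" using low by eventually_elim blast
      hence "(\<integral>X. h X \<partial>P) \<le> (\<integral>X. q \<partial>P)" using hi by (intro integral_mono_AE) auto
      thus False using that int_h by (simp add: prob_space)
    qed
    hence "prob (low_density r q) = 0" using prob_low_density by blast
    hence "AE X in P. X \<notin> low_density r q" using sets_low_density by (simp add: prob_eq_0)
    thus ?thesis using low by eventually_elim force
  qed
  have le: "AE X in P. h X \<le> q" if "\<rho> < q" for q
  proof -
    have "prob (low_density r q) \<noteq> 0"
    proof
      assume "prob (low_density r q) = 0"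
      hence "AE X in P. X \<notin> low_density r q" using sets_low_density by (simp add: prob_eq_0)
      hence "AE X in P. q \<le> h X" using low by eventually_elim force
      hence "(\<integral>X. q \<partial>P) \<le> (\<integral>X. h X \<partial>P)" using hi by (intro integral_mono_AE) auto
      thus False using that int_h by (simp add: prob_space)
    qed
    hence "prob (low_density r q) = 1" using prob_low_density by blast
    hence "AE X in P. X \<in> low_density r q" using sets_low_density by (simp add: prob_eq_1)
    thus ?thesis using low by eventually_elim blast
  qed
  have "AE X in P. \<forall>n. \<rho> - inverse (real (Suc n)) \<le> h X \<and> h X \<le> \<rho> + inverse (real (Suc n))"
    unfolding AE_all_countable
  proof
    fix n
    have "0 < inverse (real (Suc n))" by simp
    hence "AE X in P. \<rho> - inverse (real (Suc n)) \<le> h X" "AE X in P. h X \<le> \<rho> + inverse (real (Suc n))"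
      by (intro ge le; linarith)+
    thus "AE X in P. \<rho> - inverse (real (Suc n)) \<le> h X \<and> h X \<le> \<rho> + inverse (real (Suc n))"
      by eventually_elim simp
  qed
  hence h_rho: "AE X in P. h X = \<rho>"
  proof eventually_elim
    case (elim X)
    have "\<bar>h X - \<rho>\<bar> \<le> inverse (real (Suc n))" for n using elim[rule_format, of n] by linarith
    from LIMSEQ_le_const[OF LIMSEQ_inverse_real_of_nat, of "\<bar>h X - \<rho>\<bar>"] this have "\<bar>h X - \<rho>\<bar> \<le> 0" by blast
    thus ?case by simp
  qed
  have "(\<integral>X. \<bar>A n X - h X\<bar> \<partial>P) = (\<integral>X. \<bar>A n X - \<rho>\<bar> \<partial>P)" for n
  proof (rule integral_cong_AE)
    show "AE X in P. \<bar>A n X - h X\<bar> = \<bar>A n X - \<rho>\<bar>" using h_rho by eventually_elim simp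
  qed (use Am hm in simp_all)
  with lim_h show ?thesis by (simp add: A_def)
qed

text \<open>Stationarity removes the corner \<open>a\<close>. A real side lies between two
  consecutive integers, and both counts and volumes are monotone in the side.\<close>

lemma F_real_L1_limit:
  "((\<lambda>L. \<integral>X. \<bar>F a L X / L ^ CARD('n) - \<rho>\<bar> \<partial>P) \<longlongrightarrow> 0) at_top"
proof -
  have key: "\<bar>x / D - \<rho>\<bar> = \<bar>x - \<rho> * D\<bar> / D" if "0 < D" for x D
  proof -
    have "x / D - \<rho> = (x - \<rho> * D) / D" using that by (simp add: field_simps)
    thus ?thesis using that by simp
  qed
  let ?n = "\<lambda>L::real. nat \<lfloor>L\<rfloor>"
  let ?d = "CARD('n)"
  \<comment> \<open>The factor 2 arises because the gap between the sides \<open>n\<close> and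
    \<open>n + 1\<close> enters once through the mean count and once through the volume.\<close>
  define g where "g n = (\<integral>X. \<bar>F 0 (real n) X / real n ^ ?d - \<rho>\<bar> \<partial>P) + 2 * \<rho> * ((1 + 1 / real n) ^ ?d - 1)" for n
  have "(\<lambda>n. g n) \<longlonglongrightarrow> 0 + 2 * \<rho> * ((1 + 0) ^ ?d - 1)"
    unfolding g_def by (intro tendsto_intros F_L1_limit lim_const_over_n)
  hence g: "g \<longlonglongrightarrow> 0" by simp
  have fl: "filterlim ?n sequentially at_top"
    by (rule filterlim_compose[OF filterlim_nat_sequentially filterlim_floor_sequentially])
  have glim: "((\<lambda>L. g (?n L)) \<longlongrightarrow> 0) at_top" by (rule filterlim_compose[OF g fl])
  show ?thesis
  proof (rule Lim_null_comparison[OF _ glim])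
    show "\<forall>\<^sub>F L in at_top. norm (\<integral>X. \<bar>F a L X / L ^ ?d - \<rho>\<bar> \<partial>P) \<le> g (?n L)"
      using eventually_ge_at_top[of 1]
    proof eventually_elim
      case (elim L)
      define n where "n = ?n L"
      have n: "0 < n" "real n \<le> L" "L \<le> real (Suc n)" using elim by (auto simp: n_def le_nat_iff) linarith+
      have nd: "0 < real n ^ ?d" "real n ^ ?d \<le> L ^ ?d" "L ^ ?d \<le> real (Suc n) ^ ?d"
        using n by (auto intro!: power_mono)
      let ?E = "real (Suc n) ^ ?d - real n ^ ?d"
      let ?u = "\<lambda>X. F 0 (real n) X" and ?v = "\<lambda>X. F 0 (real (Suc n)) X"
      have "(\<integral>X. \<bar>F a L X / L ^ ?d - \<rho>\<bar> \<partial>P) = (\<integral>X. \<bar>F 0 L X / L ^ ?d - \<rho>\<bar> \<partial>P)"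
        using integral_translate[of "\<lambda>X. \<bar>F 0 L X / L ^ ?d - \<rho>\<bar>" a] by (simp add: F_translate)
      also have "\<dots> \<le> (\<integral>X. \<bar>?u X / real n ^ ?d - \<rho>\<bar> + (?v X - ?u X + \<rho> * ?E) / real n ^ ?d \<partial>P)"
      proof (rule integral_mono)
        show "integrable P (\<lambda>X. \<bar>F 0 L X / L ^ ?d - \<rho>\<bar>)" using integrable_F by simp
        show "integrable P (\<lambda>X. \<bar>?u X / real n ^ ?d - \<rho>\<bar> + (?v X - ?u X + \<rho> * ?E) / real n ^ ?d)"
          using integrable_F by simp
        fix X assume "X \<in> space P"
        hence X: "X \<in> configs" by (simp add: space_P)
        have uv: "?u X \<le> F 0 L X" "F 0 L X \<le> ?v X"
          by (rule F_mono[OF X hcube_mono[OF n(2)]], rule F_mono[OF X hcube_mono[OF n(3)]])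
        have "\<bar>F 0 L X / L ^ ?d - \<rho>\<bar> = \<bar>F 0 L X - \<rho> * L ^ ?d\<bar> / L ^ ?d"
          using nd by (intro key) linarith
        also have "\<dots> \<le> \<bar>F 0 L X - \<rho> * L ^ ?d\<bar> / real n ^ ?d"
          using nd(2) order_less_le_trans[OF nd(1,2)] nd(1) by (intro divide_left_mono mult_pos_pos) linarith+
        also have "\<dots> \<le> (\<bar>?u X - \<rho> * real n ^ ?d\<bar> + (?v X - ?u X + \<rho> * ?E)) / real n ^ ?d"
        proof (rule divide_right_mono)
          have "\<rho> * real n ^ ?d \<le> \<rho> * L ^ ?d" "\<rho> * L ^ ?d \<le> \<rho> * real (Suc n) ^ ?d"
            using nd rho_nonneg by (auto intro!: mult_left_mono)
          thus "\<bar>F 0 L X - \<rho> * L ^ ?d\<bar> \<le> \<bar>?u X - \<rho> * real n ^ ?d\<bar> + (?v X - ?u X + \<rho> * ?E)"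
            using uv unfolding right_diff_distrib by linarith
        qed (use nd in simp)
        also have "\<dots> = \<bar>?u X / real n ^ ?d - \<rho>\<bar> + (?v X - ?u X + \<rho> * ?E) / real n ^ ?d"
          unfolding key[OF nd(1)] by (rule add_divide_distrib)
        finally show "\<bar>F 0 L X / L ^ ?d - \<rho>\<bar> \<le> \<bar>?u X / real n ^ ?d - \<rho>\<bar> + (?v X - ?u X + \<rho> * ?E) / real n ^ ?d" .
      qed
      also have "\<dots> = (\<integral>X. \<bar>?u X / real n ^ ?d - \<rho>\<bar> \<partial>P) + ((\<integral>X. ?v X \<partial>P) - (\<integral>X. ?u X \<partial>P) + \<rho> * ?E) / real n ^ ?d"
        using integrable_F by (simp add: prob_space)
      also have "((\<integral>X. ?v X \<partial>P) - (\<integral>X. ?u X \<partial>P) + \<rho> * ?E) / real n ^ ?d = 2 * \<rho> * (?E / real n ^ ?d)"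
        unfolding integral_F_nat by (simp add: algebra_simps)
      also have "?E / real n ^ ?d = (real (Suc n) / real n) ^ ?d - 1"
        using nd(1) by (simp add: power_divide diff_divide_distrib)
      also have "real (Suc n) / real n = 1 + 1 / real n" using n(1) by (simp add: field_simps)
      finally show ?case by (simp add: g_def n_def)
    qed
  qed
qed

end

section \<open>Generating functions of the marked processes\<close>

text \<open>Disjointness leaves at most one factor different from 1, so the product is affine in the
  indicators and can be integrated termwise.\<close>

lemma prod_if_disjoint:
  fixes s :: "'j \<Rightarrow> real"
  assumes "finite J" "disjoint_family_on I J"
  shows "(\<Prod>j\<in>J. if E \<in> I j then s j else 1) = 1 - (\<Sum>j\<in>J. indicator (I j) E * (1 - s j))"
proof (cases "\<exists>j\<in>J. E \<in> I j")
  case True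
  then obtain j where j: "j \<in> J" "E \<in> I j" by blast
  have iff: "E \<in> I i \<longleftrightarrow> i = j" if "i \<in> J" for i
    using assms(2) j that unfolding disjoint_family_on_def by blast
  have "(\<Prod>i\<in>J. if E \<in> I i then s i else 1) = (\<Prod>i\<in>J. if i = j then s i else 1)"
    by (intro prod.cong) (auto simp: iff)
  moreover have "(\<Sum>i\<in>J. indicator (I i) E * (1 - s i)) = (\<Sum>i\<in>J. if i = j then 1 - s i else 0)"
    by (intro sum.cong) (auto simp: iff)
  ultimately show ?thesis using assms(1) j(1) by (simp add: prod.delta sum.delta)
next
  case False
  thus ?thesis by simp
qed

lemma sum_measure_disjoint_bounds:
  fixes \<nu> :: "real measure"
  assumes \<nu>: "sets \<nu> = sets borel" "prob_space \<nu>"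
    and J: "finite J" "disjoint_family_on I J" "\<And>j. j \<in> J \<Longrightarrow> I j \<in> sets borel"
    and t: "\<And>j. j \<in> J \<Longrightarrow> 0 \<le> t j \<and> t j \<le> (1::real)"
  shows "0 \<le> (\<Sum>j\<in>J. measure \<nu> (I j) * t j)" "(\<Sum>j\<in>J. measure \<nu> (I j) * t j) \<le> 1"
proof -
  interpret prob_space \<nu> by fact
  show "0 \<le> (\<Sum>j\<in>J. measure \<nu> (I j) * t j)" using t by (intro sum_nonneg mult_nonneg_nonneg) auto
  have "(\<Sum>j\<in>J. measure \<nu> (I j) * t j) \<le> (\<Sum>j\<in>J. measure \<nu> (I j))"
    using t by (intro sum_mono mult_left_le) auto
  also have "\<dots> = measure \<nu> (\<Union>j\<in>J. I j)"
    using J \<nu> by (intro finite_measure_finite_Union[symmetric]) auto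
  also have "\<dots> \<le> 1" by simp
  finally show "(\<Sum>j\<in>J. measure \<nu> (I j) * t j) \<le> 1" .
qed

lemma integral_mark_weight_product:
  fixes B :: "'z \<Rightarrow> (real^'n) set" and \<nu> :: "real measure"
  assumes ZJ: "finite Z" "finite J" "disjoint_family_on B Z" "disjoint_family_on I J"
    and I: "\<And>j. j \<in> J \<Longrightarrow> I j \<in> sets borel"
    and \<nu>: "sets \<nu> = sets borel" "prob_space \<nu>"
    and z: "z \<in> Z" "x \<in> B z"
  shows "(\<integral>E. mark_weight (Z \<times> J) (\<lambda>i. B (fst i)) (\<lambda>i. I (snd i)) s x E \<partial>\<nu>)
    = 1 - (\<Sum>j\<in>J. measure \<nu> (I j) * (1 - s (z, j)))"
proof -
  interpret prob_space \<nu> by fact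
  have iff: "x \<in> B y \<longleftrightarrow> y = z" if "y \<in> Z" for y
    using ZJ(3) z that unfolding disjoint_family_on_def by blast
  have w: "mark_weight (Z \<times> J) (\<lambda>i. B (fst i)) (\<lambda>i. I (snd i)) s x E
    = 1 - (\<Sum>j\<in>J. indicator (I j) E * (1 - s (z, j)))" for E
  proof -
    have "mark_weight (Z \<times> J) (\<lambda>i. B (fst i)) (\<lambda>i. I (snd i)) s x E
      = (\<Prod>y\<in>Z. \<Prod>j\<in>J. if x \<in> B y \<and> E \<in> I j then s (y, j) else 1)"
      unfolding mark_weight_def prod.cartesian_product by (intro prod.cong refl) auto
    also have "\<dots> = (\<Prod>y\<in>Z. if y = z then \<Prod>j\<in>J. if E \<in> I j then s (y, j) else 1 else 1)"
      by (intro prod.cong) (auto simp: iff)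
    also have "\<dots> = (\<Prod>j\<in>J. if E \<in> I j then s (z, j) else 1)"
      using ZJ(1) z(1) by (simp add: prod.delta)
    also have "\<dots> = 1 - (\<Sum>j\<in>J. indicator (I j) E * (1 - s (z, j)))"
      by (rule prod_if_disjoint[OF ZJ(2,4)])
    finally show ?thesis .
  qed
  have ii: "integrable \<nu> (\<lambda>E. indicator (I j) E * (1 - s (z, j)))" if "j \<in> J" for j
    using I[OF that] \<nu>(1) by (intro integrable_mult_left integrable_real_indicator) (auto simp: less_top[symmetric])
  have "(\<integral>E. mark_weight (Z \<times> J) (\<lambda>i. B (fst i)) (\<lambda>i. I (snd i)) s x E \<partial>\<nu>)
    = (\<integral>E. 1 \<partial>\<nu>) - (\<Sum>j\<in>J. \<integral>E. indicator (I j) E * (1 - s (z, j)) \<partial>\<nu>)"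
    unfolding w using ii by (subst Bochner_Integration.integral_diff) (auto simp: Bochner_Integration.integral_sum)
  also have "\<dots> = 1 - (\<Sum>j\<in>J. measure \<nu> (I j) * (1 - s (z, j)))"
  proof -
    have "(\<integral>E. indicator (I j) E * (1 - s (z, j)) \<partial>\<nu>) = measure \<nu> (I j) * (1 - s (z, j))" if "j \<in> J" for j
      using sets_eq_imp_space_eq[OF \<nu>(1)] by simp
    moreover have "(\<integral>E. 1 \<partial>\<nu>) = (1::real)" by (simp add: prob_space)
    ultimately show ?thesis by (simp only: cong: sum.cong)
  qed
  finally show ?thesis .
qed

text \<open>With disjoint \<open>B z\<close> every point sees a single index \<open>z\<close>, and
  its mark contributes the same expected factor as that of any other point of \<open>B z\<close>.
  The marks are thereby integrated out and only powers of unmarked counts remain.\<close>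

lemma integral_randomization_gf_product:
  fixes B :: "'z \<Rightarrow> (real^'n) set"
  assumes P: "spp_law P" and ZJ: "finite Z" "finite J" "disjoint_family_on B Z" "disjoint_family_on I J"
    and B: "\<And>z. z \<in> Z \<Longrightarrow> B z \<in> sets borel \<and> bounded (B z)"
    and I: "\<And>j. j \<in> J \<Longrightarrow> I j \<in> sets borel \<and> bounded (I j)"
    and s: "\<And>i. i \<in> Z \<times> J \<Longrightarrow> 0 \<le> s i \<and> s i \<le> 1"
    and \<nu>: "sets \<nu> = sets borel" "prob_space \<nu>"
    and J: "J \<noteq> {}"
  shows "integral\<^sup>L (randomization P \<nu>) (marked.gf (Z \<times> J) (\<lambda>i. B (fst i) \<times> I (snd i)) s)
    = (\<integral>X. (\<Prod>z\<in>Z. (1 - (\<Sum>j\<in>J. measure \<nu> (I j) * (1 - s (z, j)))) ^ card (X \<inter> B z)) \<partial>P)"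
proof -
  let ?\<kappa> = "\<lambda>z. 1 - (\<Sum>j\<in>J. measure \<nu> (I j) * (1 - s (z, j)))"
  have "integral\<^sup>L (randomization P \<nu>) (marked.gf (Z \<times> J) (\<lambda>i. B (fst i) \<times> I (snd i)) s)
    = (\<integral>X. (\<Prod>x\<in>X \<inter> (\<Union>i\<in>Z \<times> J. B (fst i)). \<integral>E. mark_weight (Z \<times> J) (\<lambda>i. B (fst i)) (\<lambda>i. I (snd i)) s x E \<partial>\<nu>) \<partial>P)"
    using ZJ B I by (intro integral_randomization_gf[OF P _ _ _ s \<nu>]) auto
  also have "\<dots> = (\<integral>X. (\<Prod>z\<in>Z. ?\<kappa> z ^ card (X \<inter> B z)) \<partial>P)"
  proof (rule Bochner_Integration.integral_cong[OF refl])
    fix X assume "X \<in> space P"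
    hence X: "X \<in> configs" by (simp add: space_spp[OF P])
    have U: "X \<inter> (\<Union>i\<in>Z \<times> J. B (fst i)) = (\<Union>z\<in>Z. X \<inter> B z)" using J by auto
    have "(\<Prod>x\<in>X \<inter> (\<Union>i\<in>Z \<times> J. B (fst i)). \<integral>E. mark_weight (Z \<times> J) (\<lambda>i. B (fst i)) (\<lambda>i. I (snd i)) s x E \<partial>\<nu>)
      = (\<Prod>z\<in>Z. \<Prod>x\<in>X \<inter> B z. \<integral>E. mark_weight (Z \<times> J) (\<lambda>i. B (fst i)) (\<lambda>i. I (snd i)) s x E \<partial>\<nu>)"
      unfolding U
    proof (rule prod.UNION_disjoint[OF ZJ(1)])
      show "\<forall>z\<in>Z. finite (X \<inter> B z)" using configs_finite[OF X] B by blast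
      show "\<forall>i\<in>Z. \<forall>j\<in>Z. i \<noteq> j \<longrightarrow> (X \<inter> B i) \<inter> (X \<inter> B j) = {}"
        using ZJ(3) unfolding disjoint_family_on_def by blast
    qed
    also have "\<dots> = (\<Prod>z\<in>Z. \<Prod>x\<in>X \<inter> B z. ?\<kappa> z)"
      using I by (intro prod.cong refl integral_mark_weight_product ZJ \<nu>) auto
    finally show "(\<Prod>x\<in>X \<inter> (\<Union>i\<in>Z \<times> J. B (fst i)). \<integral>E. mark_weight (Z \<times> J) (\<lambda>i. B (fst i)) (\<lambda>i. I (snd i)) s x E \<partial>\<nu>)
      = (\<Prod>z\<in>Z. ?\<kappa> z ^ card (X \<inter> B z))" by simp
  qed
  finally show ?thesis .
qed

text \<open>The function is expanded over the values of \<open>N\<close>, cut off below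
  \<open>n\<close>, and the exponential series is summed. The rate 0 and the parameter 0 are covered
  through 0^0 = 1.\<close>

lemma (in prob_space) expectation_power_poisson:
  fixes N :: "'a \<Rightarrow> nat" and r t :: real
  assumes N: "N \<in> measurable M (count_space UNIV)"
    and p: "\<And>k. prob {x \<in> space M. N x = k} = r ^ k / fact k * exp (- r)"
    and t: "0 \<le> t" "t \<le> 1"
  shows "(\<integral>x. t ^ N x \<partial>M) = exp (- (r * (1 - t)))"
proof -
  let ?f = "\<lambda>n x. \<Sum>k<n. t ^ k * indicator {x \<in> space M. N x = k} x"
  have mk: "{x \<in> space M. N x = k} \<in> events" for k
    using measurable_sets[OF N, of "{k}"] by (simp add: vimage_def Int_def conj_commute)
  have fm: "?f n \<in> borel_measurable M" for n
    using mk by (intro borel_measurable_sum borel_measurable_times) auto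
  have f_eq: "?f n x = (if N x < n then t ^ N x else 0)" if "x \<in> space M" for n x
  proof -
    have "?f n x = (\<Sum>k<n. if k = N x then t ^ k else 0)"
      using that by (intro sum.cong) (auto simp: indicator_def)
    thus ?thesis by (simp add: sum.delta)
  qed
  have "(\<lambda>n. \<integral>x. ?f n x \<partial>M) \<longlonglongrightarrow> (\<integral>x. t ^ N x \<partial>M)"
  proof (rule integral_dominated_convergence[where w = "\<lambda>_. 1"])
    show "(\<lambda>x. t ^ N x) \<in> borel_measurable M" by (rule measurable_compose[OF N]) simp
    show "AE x in M. (\<lambda>n. ?f n x) \<longlonglongrightarrow> t ^ N x"
    proof (rule AE_I2)
      fix x assume x: "x \<in> space M"
      have "\<forall>\<^sub>F n in sequentially. ?f n x = t ^ N x"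
        using eventually_gt_at_top[of "N x"] by eventually_elim (simp only: f_eq[OF x] if_True)
      thus "(\<lambda>n. ?f n x) \<longlonglongrightarrow> t ^ N x" by (rule tendsto_eventually)
    qed
    show "AE x in M. norm (?f n x) \<le> 1" for n
    proof (rule AE_I2)
      fix x assume "x \<in> space M"
      from f_eq[OF this, of n] show "norm (?f n x) \<le> 1" using t by (simp add: power_le_one)
    qed
  qed (use fm in auto)
  moreover have "(\<integral>x. ?f n x \<partial>M) = (\<Sum>k<n. (t * r) ^ k /\<^sub>R fact k) * exp (- r)" for n
  proof -
    have "(\<integral>x. ?f n x \<partial>M) = (\<Sum>k<n. \<integral>x. t ^ k * indicator {x \<in> space M. N x = k} x \<partial>M)"
      using mk by (intro Bochner_Integration.integral_sum integrable_mult_right integrable_real_indicator)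
        (auto simp: less_top[symmetric])
    also have "\<dots> = (\<Sum>k<n. t ^ k * prob {x \<in> space M. N x = k})"
    proof (intro sum.cong refl)
      fix k
      have "{x \<in> space M. N x = k} \<inter> space M = {x \<in> space M. N x = k}" by blast
      thus "(\<integral>x. t ^ k * indicator {x \<in> space M. N x = k} x \<partial>M) = t ^ k * prob {x \<in> space M. N x = k}"
        by simp
    qed
    also have "\<dots> = (\<Sum>k<n. (t * r) ^ k /\<^sub>R fact k) * exp (- r)"
      unfolding p sum_distrib_right by (intro sum.cong refl) (simp add: power_mult_distrib field_simps)
    finally show ?thesis .
  qed
  moreover have "(\<lambda>n. (\<Sum>k<n. (t * r) ^ k /\<^sub>R fact k) * exp (- r)) \<longlonglongrightarrow> exp (t * r) * exp (- r)"
    using exp_converges[of "t * r"] unfolding sums_def by (intro tendsto_mult tendsto_const)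
  ultimately have "(\<integral>x. t ^ N x \<partial>M) = exp (t * r) * exp (- r)" by (simp add: LIMSEQ_unique)
  thus ?thesis by (simp add: exp_add[symmetric] algebra_simps)
qed

lemma poisson_gf:
  fixes Q :: "(real^'n) set measure" and B :: "'z \<Rightarrow> (real^'n) set"
  assumes Q: "poisson_process_law r Q" and Z: "finite Z" "disjoint_family_on B Z"
    and B: "\<And>z. z \<in> Z \<Longrightarrow> B z \<in> sets borel \<and> bounded (B z)"
    and t: "\<And>z. z \<in> Z \<Longrightarrow> 0 \<le> t z \<and> t z \<le> 1"
  shows "(\<integral>X. (\<Prod>z\<in>Z. t z ^ card (X \<inter> B z)) \<partial>Q) = (\<Prod>z\<in>Z. exp (- (r * measure lborel (B z) * (1 - t z))))"
proof -
  have spp: "spp_law Q" using Q by (simp add: poisson_process_law_def)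
  interpret prob_space Q using spp by (simp add: spp_law_def)
  have sQ: "sets Q = sets config_space" using spp by (simp add: spp_law_def)
  \<comment> \<open>The definition of the Poisson process states independence for families indexed
    by an initial segment of the naturals, so \<open>Z\<close> is enumerated.\<close>
  obtain h where h: "bij_betw h {0..<card Z} Z" using ex_bij_betw_nat_finite[OF Z(1)] by blast
  hence h: "bij_betw h {..<card Z} Z" by (simp add: atLeast0LessThan)
  have hZ: "h i \<in> Z" if "i < card Z" for i using h that by (auto simp: bij_betw_def)
  have Bh: "(\<forall>i<card Z. B (h i) \<in> sets borel \<and> bounded (B (h i))) \<and> disjoint_family_on (\<lambda>i. B (h i)) {..<card Z}"
  proof (intro conjI allI impI)
    show "disjoint_family_on (\<lambda>i. B (h i)) {..<card Z}"
      unfolding disjoint_family_on_def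
    proof (intro ballI impI)
      fix i j assume "i \<in> {..<card Z}" "j \<in> {..<card Z}" "i \<noteq> j"
      hence "h i \<in> Z" "h j \<in> Z" "h i \<noteq> h j" using h by (auto simp: bij_betw_def inj_on_def)
      thus "B (h i) \<inter> B (h j) = {}" using Z(2) by (auto simp: disjoint_family_on_def)
    qed
  qed (use B hZ in auto)
  have all: "\<forall>(m::nat) B. (\<forall>i<m. B i \<in> sets borel \<and> bounded (B i)) \<and> disjoint_family_on B {..<m} \<longrightarrow>
        indep_vars (\<lambda>_. count_space UNIV) (\<lambda>i X. card (X \<inter> B i)) {..<m}"
    using Q by (simp add: poisson_process_law_def)
  have ind: "indep_vars (\<lambda>_. count_space UNIV) (\<lambda>i X. card (X \<inter> B (h i))) {..<card Z}"
    using all[rule_format, OF Bh] .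
  have ind2: "indep_vars (\<lambda>_. borel) (\<lambda>i X. t (h i) ^ card (X \<inter> B (h i))) {..<card Z}"
    by (rule indep_vars_compose2[OF ind, where Y = "\<lambda>i n. t (h i) ^ n"]) simp
  have cm: "(\<lambda>X. card (X \<inter> B z)) \<in> measurable Q (count_space UNIV)" if "z \<in> Z" for z
    using configs.card_Int_measurable_count_space[of "B z"] B[OF that] measurable_cong_sets[OF sQ refl] by blast
  have int: "integrable Q (\<lambda>X. t z ^ card (X \<inter> B z))" if "z \<in> Z" for z
  proof (rule integrable_const_bound[where B=1])
    show "(\<lambda>X. t z ^ card (X \<inter> B z)) \<in> borel_measurable Q"
      by (rule measurable_compose[OF cm[OF that]]) simp
    show "AE X in Q. norm (t z ^ card (X \<inter> B z)) \<le> 1"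
      using t[OF that] by (intro AE_I2) (simp add: power_le_one)
  qed
  have "(\<integral>X. (\<Prod>z\<in>Z. t z ^ card (X \<inter> B z)) \<partial>Q) = (\<integral>X. (\<Prod>i<card Z. t (h i) ^ card (X \<inter> B (h i))) \<partial>Q)"
    by (intro Bochner_Integration.integral_cong refl prod.reindex_bij_betw[OF h, symmetric])
  also have "\<dots> = (\<Prod>i<card Z. \<integral>X. t (h i) ^ card (X \<inter> B (h i)) \<partial>Q)"
    using int hZ by (intro indep_vars_lebesgue_integral[OF _ ind2]) auto
  also have "\<dots> = (\<Prod>z\<in>Z. \<integral>X. t z ^ card (X \<inter> B z) \<partial>Q)"
    by (rule prod.reindex_bij_betw[OF h])
  also have "\<dots> = (\<Prod>z\<in>Z. exp (- (r * measure lborel (B z) * (1 - t z))))"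
  proof (rule prod.cong[OF refl])
    fix z assume z: "z \<in> Z"
    show "(\<integral>X. t z ^ card (X \<inter> B z) \<partial>Q) = exp (- (r * measure lborel (B z) * (1 - t z)))"
    proof (rule expectation_power_poisson[OF cm[OF z]])
      show "prob {X \<in> space Q. card (X \<inter> B z) = k}
        = (r * measure lborel (B z)) ^ k / fact k * exp (- (r * measure lborel (B z)))" for k
        using Q B[OF z] by (simp add: poisson_process_law_def)
    qed (use t[OF z] in auto)
  qed
  finally show ?thesis .
qed

section \<open>Cube volume and the exponential approximation of powers\<close>

lemma measure_lborel_hcube:
  assumes "0 \<le> L"
  shows "measure lborel (hcube (a :: 'a::euclidean_space) L) = L ^ DIM('a)"
proof (rule antisym)
  have c: "measure lborel (cbox a (a + L *\<^sub>R One)) = L ^ DIM('a)"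
    using assms by (subst content_cbox') (auto simp: inner_simps box_eq_empty)
  have fin: "emeasure lborel (cbox a (a + L *\<^sub>R One)) < \<infinity>" by (rule emeasure_lborel_cbox_finite)
  hence fmc: "cbox a (a + L *\<^sub>R One) \<in> fmeasurable lborel" by (intro fmeasurableI) auto
  show "measure lborel (hcube a L) \<le> L ^ DIM('a)"
    unfolding c[symmetric] by (rule measure_mono_fmeasurable[OF hcube_subset_cbox _ fmc]) simp
  have "box a (a + L *\<^sub>R One) \<subseteq> hcube a L" by (auto simp: box_def hcube_def inner_simps less_imp_le)
  moreover have "hcube a L \<in> fmeasurable lborel"
    by (rule fmeasurableI2[OF fmc hcube_subset_cbox]) simp
  ultimately have "measure lborel (box a (a + L *\<^sub>R One)) \<le> measure lborel (hcube a L)"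
    by (intro measure_mono_fmeasurable) auto
  moreover have "measure lborel (box a (a + L *\<^sub>R One)) = L ^ DIM('a)"
    using assms by (subst measure_lborel_box_eq) (auto simp: inner_simps)
  ultimately show "L ^ DIM('a) \<le> measure lborel (hcube a L)" by simp
qed

lemma abs_exp_minus_diff_le:
  fixes x y :: real
  assumes "0 \<le> x" "0 \<le> y"
  shows "\<bar>exp (- x) - exp (- y)\<bar> \<le> \<bar>x - y\<bar>"
proof -
  have *: "exp (- a) - exp (- b) \<le> b - a \<and> 0 \<le> exp (- a) - exp (- b)" if "0 \<le> a" "a \<le> b" for a b :: real
  proof
    have "exp (- a) - exp (- b) = exp (- a) * (1 - exp (- (b - a)))"
      by (simp add: algebra_simps exp_add[symmetric])
    also have "\<dots> \<le> 1 * (b - a)"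
    proof (rule mult_mono)
      show "1 - exp (- (b - a)) \<le> b - a" using exp_ge_add_one_self[of "- (b - a)"] by linarith
    qed (use that in auto)
    finally show "exp (- a) - exp (- b) \<le> b - a" by simp
    show "0 \<le> exp (- a) - exp (- b)" using that by simp
  qed
  show ?thesis using *[of x y] *[of y x] assms by (cases "x \<le> y") auto
qed

text \<open>From 1 - \<kappa> \<le> exp (-\<kappa>) \<le> 1 - \<kappa> + \<kappa>^2 and |x^n - y^n|
  \<le> n * |x - y| on the unit interval. The bound grows at most linearly in \<open>n\<close>, so
  it can be integrated when a count with only a finite first moment is substituted for
  \<open>n\<close>.\<close>

lemma power_one_minus_approx:
  fixes \<kappa> \<theta> :: real
  assumes \<kappa>: "0 \<le> \<kappa>" "\<kappa> \<le> 1" and "0 \<le> \<theta>"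
  shows "\<bar>(1 - \<kappa>) ^ n - exp (- \<theta>)\<bar> \<le> \<kappa>\<^sup>2 * n + \<bar>\<kappa> * n - \<theta>\<bar>"
proof -
  have "1 - \<kappa> \<le> exp (- \<kappa>)" using exp_ge_add_one_self[of "- \<kappa>"] by simp
  moreover have "exp (- \<kappa>) \<le> 1 - \<kappa> + \<kappa>\<^sup>2"
  proof -
    have "exp (- \<kappa>) \<le> 1 / (1 + \<kappa>)"
      using exp_ge_add_one_self[of \<kappa>] \<kappa> by (simp add: exp_minus field_simps)
    also have "\<dots> \<le> 1 - \<kappa> + \<kappa>\<^sup>2"
    proof -
      have "(1 - \<kappa> + \<kappa>\<^sup>2) * (1 + \<kappa>) = 1 + \<kappa> ^ 3" by (simp add: power2_eq_square power3_eq_cube algebra_simps)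
      hence "1 \<le> (1 - \<kappa> + \<kappa>\<^sup>2) * (1 + \<kappa>)" using \<kappa> by simp
      thus ?thesis using \<kappa> by (simp add: pos_divide_le_eq)
    qed
    finally show ?thesis .
  qed
  ultimately have d: "\<bar>(1 - \<kappa>) - exp (- \<kappa>)\<bar> \<le> \<kappa>\<^sup>2" by linarith
  have "\<bar>(1 - \<kappa>) ^ n - exp (- \<kappa>) ^ n\<bar> \<le> n * \<bar>(1 - \<kappa>) - exp (- \<kappa>)\<bar>"
    using norm_power_diff[of "1 - \<kappa>" "exp (- \<kappa>)" n] \<kappa> by simp
  also have "\<dots> \<le> n * \<kappa>\<^sup>2" using d by (intro mult_left_mono) auto
  finally have 1: "\<bar>(1 - \<kappa>) ^ n - exp (- (\<kappa> * n))\<bar> \<le> \<kappa>\<^sup>2 * n"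
    by (simp add: exp_of_nat_mult[symmetric] mult.commute)
  have 2: "\<bar>exp (- (\<kappa> * n)) - exp (- \<theta>)\<bar> \<le> \<bar>\<kappa> * n - \<theta>\<bar>"
    using assms by (intro abs_exp_minus_diff_le) auto
  from 1 2 show ?thesis by linarith
qed

section \<open>Rescaling\<close>

lemma measure_interval_pos:
  assumes \<nu>: "sets \<nu> = sets borel" "prob_space \<nu>" and supp: "0 \<in> measure_support \<nu>" and "0 < \<gamma>"
  shows "0 < measure \<nu> {-\<gamma>..\<gamma>::real}"
proof -
  interpret prob_space \<nu> by fact
  have "0 < emeasure \<nu> {-\<gamma><..<\<gamma>}" using supp \<open>0 < \<gamma>\<close> by (auto simp: measure_support_def)
  also have "\<dots> \<le> emeasure \<nu> {-\<gamma>..\<gamma>}" using \<nu>(1) by (intro emeasure_mono) auto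
  finally show ?thesis by (simp add: emeasure_eq_measure)
qed

lemma sets_nu_star [simp]: "sets (nu_star \<nu> \<gamma>) = sets borel"
  by (simp add: nu_star_def)

text \<open>The conditional law is put in product form, which separates the probability of keeping a
  mark from the law of a kept and rescaled mark.\<close>

lemma
  assumes \<nu>: "sets \<nu> = sets borel" "prob_space \<nu>" and pos: "0 < measure \<nu> {-\<gamma>..\<gamma>}"
  shows prob_space_nu_star: "prob_space (nu_star \<nu> \<gamma>)"
    and measure_nu_star: "I \<in> sets borel \<Longrightarrow>
      measure (nu_star \<nu> \<gamma>) I * measure \<nu> {-\<gamma>..\<gamma>} = measure \<nu> {E. \<bar>E\<bar> \<le> \<gamma> \<and> E / \<gamma> \<in> I}"
proof -
  interpret prob_space \<nu> by fact
  have e: "emeasure \<nu> {-\<gamma>..\<gamma>} \<noteq> 0" "emeasure \<nu> {-\<gamma>..\<gamma>} \<noteq> \<infinity>"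
    using pos by (auto simp: emeasure_eq_measure)
  have "(\<lambda>E. E / \<gamma>) \<in> borel_measurable borel" by simp
  hence m: "(\<lambda>E. E / \<gamma>) \<in> measurable (uniform_measure \<nu> {-\<gamma>..\<gamma>}) borel"
    using measurable_cong_sets[of "uniform_measure \<nu> {-\<gamma>..\<gamma>}" borel borel borel] \<nu>(1) by simp
  show "prob_space (nu_star \<nu> \<gamma>)"
    unfolding nu_star_def by (rule prob_space.prob_space_distr[OF prob_space_uniform_measure[OF e] m])
  assume I: "I \<in> sets borel"
  have sp: "space \<nu> = UNIV" using sets_eq_imp_space_eq[OF \<nu>(1)] by simp
  have "(\<lambda>E. E / \<gamma>) -` I \<in> sets borel" using measurable_sets[OF \<open>(\<lambda>E. E / \<gamma>) \<in> borel_measurable borel\<close> I] by simp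
  hence "measure (nu_star \<nu> \<gamma>) I = measure \<nu> ({-\<gamma>..\<gamma>} \<inter> (\<lambda>E. E / \<gamma>) -` I) / measure \<nu> {-\<gamma>..\<gamma>}"
    unfolding nu_star_def measure_distr[OF m I] using e \<nu>(1) sp by (subst measure_uniform_measure[symmetric]) auto
  moreover have "{-\<gamma>..\<gamma>} \<inter> (\<lambda>E. E / \<gamma>) -` I = {E. \<bar>E\<bar> \<le> \<gamma> \<and> E / \<gamma> \<in> I}" by auto
  ultimately show "measure (nu_star \<nu> \<gamma>) I * measure \<nu> {-\<gamma>..\<gamma>} = measure \<nu> {E. \<bar>E\<bar> \<le> \<gamma> \<and> E / \<gamma> \<in> I}"
    using pos by simp
qed

text \<open>Testing with the constant 1 gives the total mass of the limit, so the densities of the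
  two limit laws are never integrated.\<close>

lemma prob_space_weak_limit:
  fixes M :: "'i \<Rightarrow> real measure"
  assumes w: "weakly_converges euclideanreal M \<mu> F" and "F \<noteq> bot" and M: "\<forall>\<^sub>F i in F. prob_space (M i)"
  shows "prob_space \<mu>"
proof -
  have "((\<lambda>i. integral\<^sup>L (M i) (\<lambda>_. 1 :: real)) \<longlongrightarrow> integral\<^sup>L \<mu> (\<lambda>_. 1)) F"
    using w unfolding weakly_converges_def by (rule allE[where x = "\<lambda>_. 1"]) (auto simp: bounded_iff)
  moreover have "\<forall>\<^sub>F i in F. integral\<^sup>L (M i) (\<lambda>_. 1 :: real) = 1"
    using M by eventually_elim (simp add: prob_space.prob_space)
  ultimately have "((\<lambda>_. 1 :: real) \<longlongrightarrow> integral\<^sup>L \<mu> (\<lambda>_. 1)) F" by (rule Lim_transform_eventually)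
  hence "integral\<^sup>L \<mu> (\<lambda>_. 1 :: real) = 1" using \<open>F \<noteq> bot\<close> tendsto_unique[OF _ _ tendsto_const] by metis
  hence "measure \<mu> (space \<mu>) = 1" by simp
  \<comment> \<open>An infinite total mass would have \<open>measure\<close> 0 and is thereby
    excluded.\<close>
  hence "emeasure \<mu> (space \<mu>) = 1" by (cases "emeasure \<mu> (space \<mu>)") (auto simp: measure_def)
  thus ?thesis by (rule prob_spaceI)
qed

lemma hcube_real: "hcube a L = {a..<a + L :: real}"
  by (auto simp: hcube_def)

lemma frontier_hcube_real: "frontier (hcube (a::real) L) \<subseteq> {a, a + L}"
proof (cases "0 < L")
  case True
  hence "closure (hcube a L) = {a..a + L}" "interior (hcube a L) = {a<..<a + L}"
    unfolding hcube_real by (simp_all add: closure_atLeastLessThan interior_atLeastLessThan)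
  thus ?thesis by (auto simp: frontier_def)
qed (simp add: hcube_real)

text \<open>The two endpoints are null for the atomless limit, so the interval is a continuity set;
  the statement for sequences is transferred to the filter by testing along every sequence
  decreasing or otherwise tending to 0 from the right.\<close>

lemma weakly_converges_interval:
  assumes w: "weakly_converges euclideanreal M \<mu> (at_right 0)"
    and M: "\<And>\<gamma>. 0 < \<gamma> \<Longrightarrow> prob_space (M \<gamma>) \<and> sets (M \<gamma>) = sets borel"
    and \<mu>: "prob_space \<mu>" "sets \<mu> = sets borel" "\<And>x. emeasure \<mu> {x} = 0"
  shows "((\<lambda>\<gamma>::real. measure (M \<gamma>) (hcube a L)) \<longlongrightarrow> measure \<mu> (hcube a L)) (at_right 0)"
  unfolding tendsto_at_iff_sequentially o_def
proof (intro allI impI)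
  fix X :: "nat \<Rightarrow> real" assume X: "\<forall>i. X i \<in> {0<..} - {0}" "X \<longlonglongrightarrow> 0"
  have pos: "0 < X i" for i using X(1) by simp
  hence "X i \<noteq> 0" for i by (metis less_irrefl)
  hence flim: "filterlim X (at_right 0) sequentially"
    by (simp add: filterlim_at X(2) pos)
  have rM: "real_distribution (M (X n))" for n
    using M[of "X n"] X(1) by (auto simp: real_distribution_def real_distribution_axioms_def)
  have r\<mu>: "real_distribution \<mu>" using \<mu> by (simp add: real_distribution_def real_distribution_axioms_def)
  have wc: "weak_conv_m (\<lambda>n. M (X n)) \<mu>"
  proof (rule integral_bdd_continuous_conv_imp_weak_conv[OF rM r\<mu>])
    fix f :: "real \<Rightarrow> real" assume f: "\<And>x. isCont f x" "\<And>x. \<bar>f x\<bar> \<le> 1"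
    have "continuous_on UNIV f" using f(1) by (simp add: continuous_at_imp_continuous_on)
    moreover have "bounded (range f)" using f(2) by (auto simp: bounded_iff)
    ultimately have "((\<lambda>\<gamma>. integral\<^sup>L (M \<gamma>) f) \<longlongrightarrow> integral\<^sup>L \<mu> f) (at_right 0)"
      using w unfolding weakly_converges_def by simp
    from filterlim_compose[OF this flim] show "(\<lambda>n. integral\<^sup>L (M (X n)) f) \<longlonglongrightarrow> integral\<^sup>L \<mu> f" .
  qed
  have "emeasure \<mu> (frontier (hcube a L)) \<le> emeasure \<mu> {a, a + L}"
    using \<mu>(2) frontier_hcube_real by (intro emeasure_mono) auto
  also have "\<dots> \<le> emeasure \<mu> {a} + emeasure \<mu> {a + L}"
    using emeasure_subadditive[of "{a}" \<mu> "{a + L}"] \<mu>(2) by (simp add: insert_commute)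
  finally have "emeasure \<mu> (frontier (hcube a L)) = 0" by (simp add: \<mu>(3))
  from weak_conv_imp_continuity_set_conv[OF rM r\<mu> wc borel_hcube this]
  show "(\<lambda>n. measure (M (X n)) (hcube a L)) \<longlonglongrightarrow> measure \<mu> (hcube a L)" .
qed

section \<open>Counts of the rescaled configuration\<close>

lemma rescale_eq_image:
  "rescale l \<beta> w = (\<lambda>(x, E). (x /\<^sub>R l, \<beta> / l * E)) ` (w \<inter> UNIV \<times> {E. \<bar>E\<bar> \<le> l / \<beta>})"
  by (force simp: rescale_def)

text \<open>Rescaling is injective, so counts can be taken in the original configuration over
  preimages; the condition for keeping a point is absorbed into the set of marks.\<close>

lemma card_rescale:
  assumes "0 < l" "0 < \<beta>"
  shows "card (rescale l \<beta> w \<inter> B \<times> I)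
    = card (w \<inter> {x. x /\<^sub>R l \<in> B} \<times> {E. \<bar>E\<bar> \<le> l / \<beta> \<and> E / (l / \<beta>) \<in> I})"
proof -
  let ?\<phi> = "\<lambda>(x :: real^'n, E). (x /\<^sub>R l, \<beta> / l * E)"
  have inj: "inj ?\<phi>" using assms by (auto simp: inj_def)
  have "rescale l \<beta> w \<inter> B \<times> I = ?\<phi> ` (w \<inter> {x. x /\<^sub>R l \<in> B} \<times> {E. \<bar>E\<bar> \<le> l / \<beta> \<and> E / (l / \<beta>) \<in> I})"
    unfolding rescale_eq_image by (force simp: mult.commute)
  thus ?thesis by (simp only: card_image[OF inj_on_subset[OF inj subset_UNIV]])
qed

lemma rescale_in_marked_configs:
  assumes "0 < l" and w: "w \<in> marked_configs"
  shows "rescale l \<beta> w \<in> marked_configs"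
proof -
  have sub: "fst ` rescale l \<beta> w \<subseteq> (\<lambda>x. x /\<^sub>R l) ` (fst ` w)" by (force simp: rescale_def)
  have "finite (fst ` rescale l \<beta> w \<inter> B)" if B: "bounded B" for B
  proof (rule finite_subset)
    have "bounded ((\<lambda>x. l *\<^sub>R x) ` B)" by (rule bounded_scaling[OF B])
    hence "finite (fst ` w \<inter> (\<lambda>x. l *\<^sub>R x) ` B)" using w by (simp add: marked_configs_def configs_def)
    thus "finite ((\<lambda>x. x /\<^sub>R l) ` (fst ` w \<inter> (\<lambda>x. l *\<^sub>R x) ` B))" by simp
    show "fst ` rescale l \<beta> w \<inter> B \<subseteq> (\<lambda>x. x /\<^sub>R l) ` (fst ` w \<inter> (\<lambda>x. l *\<^sub>R x) ` B)"
    proof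
      fix y assume y: "y \<in> fst ` rescale l \<beta> w \<inter> B"
      then obtain x where x: "x \<in> fst ` w" "y = x /\<^sub>R l" using sub by blast
      moreover have "x = l *\<^sub>R y" using x(2) \<open>0 < l\<close> by simp
      ultimately show "y \<in> (\<lambda>x. x /\<^sub>R l) ` (fst ` w \<inter> (\<lambda>x. l *\<^sub>R x) ` B)" using y by blast
    qed
  qed
  moreover have "inj_on fst (rescale l \<beta> w)"
  proof (rule inj_onI)
    fix p q assume pq: "p \<in> rescale l \<beta> w" "q \<in> rescale l \<beta> w" "fst p = fst q"
    obtain x E where x: "p = (x /\<^sub>R l, \<beta> / l * E)" "(x, E) \<in> w" using pq(1) by (auto simp: rescale_def)
    obtain y E' where y: "q = (y /\<^sub>R l, \<beta> / l * E')" "(y, E') \<in> w" using pq(2) by (auto simp: rescale_def)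
    have "x = y" using pq(3) x(1) y(1) \<open>0 < l\<close> by simp
    moreover have "inj_on fst w" using w by (simp add: marked_configs_def)
    ultimately have "(x, E) = (y, E')" using x(2) y(2) by (intro inj_onD[of fst w]) auto
    thus "p = q" using x y by simp
  qed
  ultimately show ?thesis by (simp add: marked_configs_def configs_def)
qed

lemma hcube_scale_vimage:
  assumes "0 < l"
  shows "{x. x /\<^sub>R l \<in> hcube a L} = hcube (l *\<^sub>R a) (l * L)"
  using assms by (auto simp: hcube_def field_simps)

lemma borel_scaled_marks:
  fixes I :: "real set"
  assumes I: "I \<in> sets borel"
  shows "{E. \<bar>E\<bar> \<le> \<gamma> \<and> E / \<gamma> \<in> I} \<in> sets borel \<and> bounded {E. \<bar>E\<bar> \<le> \<gamma> \<and> E / \<gamma> \<in> I}"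
proof
  have "(\<lambda>E. E / \<gamma>) \<in> borel_measurable borel" by simp
  hence "(\<lambda>E. E / \<gamma>) -` I \<inter> space borel \<in> sets borel" using I by (rule measurable_sets)
  hence "{-\<gamma>..\<gamma>} \<inter> ((\<lambda>E. E / \<gamma>) -` I) \<in> sets borel" by simp
  also have "{-\<gamma>..\<gamma>} \<inter> ((\<lambda>E. E / \<gamma>) -` I) = {E. \<bar>E\<bar> \<le> \<gamma> \<and> E / \<gamma> \<in> I}" by auto
  finally show "{E. \<bar>E\<bar> \<le> \<gamma> \<and> E / \<gamma> \<in> I} \<in> sets borel" .
  show "bounded {E. \<bar>E\<bar> \<le> \<gamma> \<and> E / \<gamma> \<in> I}" by (auto simp: bounded_iff)
qed

lemma rescale_measurable:
  assumes "0 < l" "0 < \<beta>"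
  shows "rescale l \<beta> \<in> measurable marked_config_space marked_config_space"
proof (rule marked.measurable_into_MC)
  show "rescale l \<beta> w \<in> marked_configs" if "w \<in> space marked_config_space" for w
    using that rescale_in_marked_configs[OF assms(1)] by simp
  fix k and v :: "(real^'n) \<times> real"
  obtain a e where v: "v = (a, e)" by (cases v)
  show "(\<lambda>w. real (card (rescale l \<beta> w \<inter> cell k v))) \<in> borel_measurable marked_config_space"
    unfolding v cell_Times card_rescale[OF assms]
    using borel_scaled_marks[of "cell k e" "l / \<beta>"]
    by (intro marked.card_Int_measurable)
       (simp_all add: cell_def[where k=k and v=a] hcube_scale_vimage[OF assms(1)] borel_Times bounded_Times)
qed

lemma filterlim_powr_at_top:
  assumes "0 < (a::real)"
  shows "filterlim (\<lambda>x. x powr a) at_top at_top"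
proof -
  have "filterlim (\<lambda>x::real. exp (a * ln x)) at_top at_top"
    by (intro filterlim_compose[OF exp_at_top] filterlim_tendsto_pos_mult_at_top[OF tendsto_const assms] ln_at_top)
  moreover have "\<forall>\<^sub>F x in at_top. exp (a * ln x) = x powr a"
    using eventually_gt_at_top[of 0] by eventually_elim (simp add: powr_def)
  ultimately show ?thesis by (subst (asm) filterlim_cong[OF refl refl]) auto
qed

text \<open>Here \<mu> stands for either limit law: the argument runs on weak convergence and the
  absence of atoms, so one treatment covers both cases.\<close>

locale rescaled_spp = ergodic_spp P \<rho> for P :: "(real^'n) set measure" and \<rho> +
  fixes \<nu> \<mu> :: "real measure" and Q :: "(real^'n) set measure" and \<alpha> C lam :: real and l :: "real \<Rightarrow> real"
  assumes alpha: "0 \<le> \<alpha>" and rho: "0 < \<rho>" and C: "0 < C" and lam: "0 < lam"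
    and nu: "sets \<nu> = sets borel" "prob_space \<nu>" "0 \<in> measure_support \<nu>"
    and mu: "sets \<mu> = sets borel" "\<And>x. emeasure \<mu> {x} = 0"
    and conv: "weakly_converges euclideanreal (nu_star \<nu>) \<mu> (at_right 0)"
    and limC: "((\<lambda>\<gamma>. measure \<nu> {-\<gamma>..\<gamma>} / \<gamma> powr (\<alpha> + 1)) \<longlongrightarrow> C) (at_right 0)"
    and l_def: "l = (\<lambda>\<beta>. (lam / (C * \<rho>)) powr (1 / (\<alpha> + 1 + real CARD('n)))
                    * \<beta> powr ((\<alpha> + 1) / (\<alpha> + 1 + real CARD('n))))"
    and Q: "poisson_process_law lam Q"
begin

lemma spp_P: "spp_law P"
  by (simp add: spp_law_def sets_P prob_space_axioms)

lemma spp_Q: "spp_law Q"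
  using Q by (simp add: poisson_process_law_def)

lemma nu_star_prob: "0 < \<gamma> \<Longrightarrow> prob_space (nu_star \<nu> \<gamma>)"
  by (intro prob_space_nu_star measure_interval_pos nu)

lemma prob_mu: "prob_space \<mu>"
  using conv
proof (rule prob_space_weak_limit)
  show "\<forall>\<^sub>F \<gamma> in at_right 0. prob_space (nu_star \<nu> \<gamma>)"
    using eventually_at_right_less[of 0] by eventually_elim (rule nu_star_prob)
qed simp

lemma l_pos: "0 < \<beta> \<Longrightarrow> 0 < l \<beta>"
  using C rho lam by (simp add: l_def)

lemma l_at_top: "filterlim l at_top at_top"
  unfolding l_def using C rho lam alpha
  by (intro filterlim_tendsto_pos_mult_at_top[OF tendsto_const] filterlim_powr_at_top) auto

text \<open>The exponent of \<beta> in \<open>l\<close> is below 1, so the threshold for the marks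
  shrinks although the length scale grows.\<close>

lemma l_div_tendsto: "filterlim (\<lambda>\<beta>. l \<beta> / \<beta>) (at_right 0) at_top"
proof (rule tendsto_imp_filterlim_at_right)
  let ?a = "(\<alpha> + 1) / (\<alpha> + 1 + real CARD('n))"
  let ?c = "(lam / (C * \<rho>)) powr (1 / (\<alpha> + 1 + real CARD('n)))"
  have "?a - 1 < 0" using alpha by (simp add: field_simps)
  hence "((\<lambda>\<beta>::real. ?c * \<beta> powr (?a - 1)) \<longlongrightarrow> ?c * 0) at_top"
    by (intro tendsto_mult tendsto_const tendsto_neg_powr filterlim_ident)
  moreover have "\<forall>\<^sub>F \<beta> in at_top. ?c * \<beta> powr (?a - 1) = l \<beta> / \<beta>"
    using eventually_gt_at_top[of 0]
  proof eventually_elim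
    case (elim \<beta>)
    hence "\<beta> powr (?a - 1) = \<beta> powr ?a / \<beta>" by (simp add: powr_diff)
    thus ?case by (simp add: l_def)
  qed
  ultimately show "((\<lambda>\<beta>. l \<beta> / \<beta>) \<longlongrightarrow> 0) at_top" by (simp add: Lim_transform_eventually)
  show "\<forall>\<^sub>F \<beta> in at_top. 0 < l \<beta> / \<beta>"
    using eventually_gt_at_top[of 0] by eventually_elim (simp add: l_pos)
qed

text \<open>Raising \<open>l\<close> to the power \<alpha> + 1 + d clears both exponents in its
  definition; dividing by \<beta>^(\<alpha> + 1) then gives the balance equation.\<close>

lemma scale_identity:
  assumes "0 < \<beta>"
  shows "(l \<beta> / \<beta>) powr (\<alpha> + 1) * l \<beta> ^ CARD('n) = lam / (C * \<rho>)"
proof -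
  let ?D = "\<alpha> + 1 + real CARD('n)"
  have D: "0 < ?D" using alpha by simp
  have K: "0 < lam / (C * \<rho>)" using C rho lam by simp
  have lp: "0 < l \<beta>" by (rule l_pos[OF assms])
  have "l \<beta> powr ?D = (lam / (C * \<rho>)) powr (1 / ?D * ?D) * \<beta> powr ((\<alpha> + 1) / ?D * ?D)"
    unfolding l_def using K assms by (simp add: powr_mult powr_powr)
  moreover have "1 / ?D * ?D = 1" "(\<alpha> + 1) / ?D * ?D = \<alpha> + 1" using D by simp_all
  ultimately have lD: "l \<beta> powr ?D = lam / (C * \<rho>) * \<beta> powr (\<alpha> + 1)"
    by (simp only: powr_one[OF less_imp_le[OF K]])
  have "(l \<beta> / \<beta>) powr (\<alpha> + 1) * l \<beta> ^ CARD('n) = l \<beta> powr (\<alpha> + 1) * l \<beta> powr real CARD('n) / \<beta> powr (\<alpha> + 1)"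
    using lp assms by (simp add: powr_divide powr_realpow)
  also have "l \<beta> powr (\<alpha> + 1) * l \<beta> powr real CARD('n) = l \<beta> powr ?D" by (simp add: powr_add)
  finally show ?thesis using lD assms by simp
qed

text \<open>The chance that a mark is kept is of order l^(-d): by \<open>scale_identity\<close> the
  normalisation (l / \<beta>)^(\<alpha> + 1) of the small-mark probability can be traded for l^(-d),
  and \<open>C\<close> cancels.\<close>

lemma retention_tendsto:
  "((\<lambda>\<beta>. measure \<nu> {- (l \<beta> / \<beta>)..l \<beta> / \<beta>} * l \<beta> ^ CARD('n)) \<longlongrightarrow> lam / \<rho>) at_top"
proof (rule Lim_transform_eventually)
  have "((\<lambda>\<beta>. measure \<nu> {- (l \<beta> / \<beta>)..l \<beta> / \<beta>} / (l \<beta> / \<beta>) powr (\<alpha> + 1) * (lam / (C * \<rho>)))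
    \<longlongrightarrow> C * (lam / (C * \<rho>))) at_top"
    by (intro tendsto_mult tendsto_const filterlim_compose[OF limC l_div_tendsto])
  thus "((\<lambda>\<beta>. measure \<nu> {- (l \<beta> / \<beta>)..l \<beta> / \<beta>} / (l \<beta> / \<beta>) powr (\<alpha> + 1) * (lam / (C * \<rho>)))
    \<longlongrightarrow> lam / \<rho>) at_top" using C by simp
  show "\<forall>\<^sub>F \<beta> in at_top. measure \<nu> {- (l \<beta> / \<beta>)..l \<beta> / \<beta>} / (l \<beta> / \<beta>) powr (\<alpha> + 1) * (lam / (C * \<rho>))
    = measure \<nu> {- (l \<beta> / \<beta>)..l \<beta> / \<beta>} * l \<beta> ^ CARD('n)"
    using eventually_gt_at_top[of 0]
  proof eventually_elim
    case (elim \<beta>)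
    have "(l \<beta> / \<beta>) powr (\<alpha> + 1) \<noteq> 0" using l_pos[OF elim] elim by simp
    thus ?case unfolding scale_identity[OF elim, symmetric] by simp
  qed
qed

text \<open>The count is about \<rho> times the volume in L^1, and \<kappa> times the volume
  converges, so the power behaves like a deterministic exponential.\<close>

lemma power_count_tendsto:
  fixes \<kappa> :: "real \<Rightarrow> real" and a :: "real^'n"
  assumes b: "0 < b" and \<kappa>: "\<forall>\<^sub>F \<beta> in at_top. 0 \<le> \<kappa> \<beta> \<and> \<kappa> \<beta> \<le> 1"
    and U: "((\<lambda>\<beta>. \<kappa> \<beta> * l \<beta> ^ CARD('n)) \<longlongrightarrow> U) at_top" and "0 \<le> U"
  shows "((\<lambda>\<beta>. \<integral>X. \<bar>(1 - \<kappa> \<beta>) ^ card (X \<inter> hcube (l \<beta> *\<^sub>R a) (l \<beta> * b)) - exp (- (\<rho> * U * b ^ CARD('n)))\<bar> \<partial>P) \<longlongrightarrow> 0) at_top"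
proof -
  let ?d = "CARD('n)"
  define \<theta> where "\<theta> = \<rho> * U * b ^ ?d"
  have \<theta>0: "0 \<le> \<theta>" using rho \<open>0 \<le> U\<close> b by (simp add: \<theta>_def)
  define \<delta> where "\<delta> L = (\<integral>X. \<bar>F 0 L X / L ^ ?d - \<rho>\<bar> \<partial>P)" for L
  define u where "u \<beta> = \<kappa> \<beta> * (l \<beta> * b) ^ ?d" for \<beta>
  have lb: "filterlim (\<lambda>\<beta>. l \<beta> * b) at_top at_top"
    using filterlim_tendsto_pos_mult_at_top[OF tendsto_const b l_at_top] by (simp add: mult.commute)
  have \<delta>: "((\<lambda>\<beta>. \<delta> (l \<beta> * b)) \<longlongrightarrow> 0) at_top"
    unfolding \<delta>_def by (rule filterlim_compose[OF F_real_L1_limit lb])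
  have u: "(u \<longlongrightarrow> U * b ^ ?d) at_top"
    unfolding u_def[abs_def] power_mult_distrib mult.assoc[symmetric] by (intro tendsto_mult U tendsto_const)
  \<comment> \<open>The product of \<kappa> with a diverging volume converges, hence \<kappa> tends
    to 0.\<close>
  have "((\<lambda>\<beta>. u \<beta> * inverse ((l \<beta> * b) ^ ?d)) \<longlongrightarrow> U * b ^ ?d * 0) at_top"
    by (intro tendsto_mult u tendsto_inverse_0_at_top filterlim_pow_at_top lb) simp
  moreover have "\<forall>\<^sub>F \<beta> in at_top. u \<beta> * inverse ((l \<beta> * b) ^ ?d) = \<kappa> \<beta>"
    using eventually_gt_at_top[of 0]
  proof eventually_elim
    case (elim \<beta>)
    have "(l \<beta> * b) ^ ?d \<noteq> 0" using l_pos[OF elim] b by simp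
    thus ?case by (simp add: u_def)
  qed
  ultimately have \<kappa>0: "(\<kappa> \<longlongrightarrow> 0) at_top" by (simp add: Lim_transform_eventually)
  \<comment> \<open>The three summands are the quadratic error of the exponential approximation, the
    random fluctuation of the density, and the deterministic error of the exponent.\<close>
  let ?g = "\<lambda>\<beta>. \<kappa> \<beta> * u \<beta> * (\<rho> + \<delta> (l \<beta> * b)) + u \<beta> * \<delta> (l \<beta> * b) + \<bar>u \<beta> * \<rho> - \<theta>\<bar>"
  have "(?g \<longlongrightarrow> 0 * (U * b ^ ?d) * (\<rho> + 0) + U * b ^ ?d * 0 + \<bar>U * b ^ ?d * \<rho> - \<theta>\<bar>) at_top"
    by (intro tendsto_intros \<kappa>0 u \<delta>)
  hence g: "(?g \<longlongrightarrow> 0) at_top" by (simp add: \<theta>_def mult.commute)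
  show ?thesis
    unfolding \<theta>_def[symmetric]
  proof (rule Lim_null_comparison[OF _ g])
    show "\<forall>\<^sub>F \<beta> in at_top. norm (\<integral>X. \<bar>(1 - \<kappa> \<beta>) ^ card (X \<inter> hcube (l \<beta> *\<^sub>R a) (l \<beta> * b)) - exp (- \<theta>)\<bar> \<partial>P) \<le> ?g \<beta>"
      using \<kappa> eventually_gt_at_top[of 0]
    proof eventually_elim
      case (elim \<beta>)
      let ?L = "l \<beta> * b" and ?a = "l \<beta> *\<^sub>R a"
      have L: "0 < ?L ^ ?d" using l_pos[OF elim(2)] b by simp
      have u0: "0 \<le> u \<beta>" using elim(1) L by (simp add: u_def)
      have ku: "\<kappa> \<beta> = u \<beta> / ?L ^ ?d" 
        by (simp only: u_def nonzero_mult_div_cancel_right[OF less_imp_neq[OF L, symmetric]])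
      let ?r = "\<lambda>X. \<bar>F ?a ?L X / ?L ^ ?d - \<rho>\<bar>"
      have ri: "integrable P ?r" using integrable_F by simp
      have r\<delta>: "(\<integral>X. ?r X \<partial>P) = \<delta> ?L"
      proof -
        have "(\<lambda>X. \<bar>F 0 ?L X / ?L ^ ?d - \<rho>\<bar>) \<in> borel_measurable P" by simp
        from integral_translate[OF this, of ?a] show ?thesis by (simp add: F_translate \<delta>_def)
      qed
      have "(\<integral>X. \<bar>(1 - \<kappa> \<beta>) ^ card (X \<inter> hcube ?a ?L) - exp (- \<theta>)\<bar> \<partial>P)
        \<le> (\<integral>X. \<kappa> \<beta> * u \<beta> * (\<rho> + ?r X) + u \<beta> * ?r X + \<bar>u \<beta> * \<rho> - \<theta>\<bar> \<partial>P)"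
      proof (rule integral_mono)
        have "(\<lambda>X. \<bar>(1 - \<kappa> \<beta>) ^ card (X \<inter> hcube ?a ?L) - exp (- \<theta>)\<bar>) \<in> borel_measurable P"
          by (rule measurable_compose[OF card_measurable_hcube]) simp
        moreover have "\<bar>\<bar>(1 - \<kappa> \<beta>) ^ card (X \<inter> hcube ?a ?L) - exp (- \<theta>)\<bar>\<bar> \<le> 1" for X
        proof -
          have "0 \<le> (1 - \<kappa> \<beta>) ^ card (X \<inter> hcube ?a ?L)" "(1 - \<kappa> \<beta>) ^ card (X \<inter> hcube ?a ?L) \<le> 1"
            using elim(1) by (auto intro: power_le_one)
          moreover have "0 \<le> exp (- \<theta>)" "exp (- \<theta>) \<le> 1" using \<theta>0 by auto
          ultimately show ?thesis by linarith
        qed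
        ultimately show "integrable P (\<lambda>X. \<bar>(1 - \<kappa> \<beta>) ^ card (X \<inter> hcube ?a ?L) - exp (- \<theta>)\<bar>)"
          by (rule integrable_bounded)
        show "integrable P (\<lambda>X. \<kappa> \<beta> * u \<beta> * (\<rho> + ?r X) + u \<beta> * ?r X + \<bar>u \<beta> * \<rho> - \<theta>\<bar>)" using ri by simp
        fix X
        let ?m = "F ?a ?L X"
        have "\<bar>(1 - \<kappa> \<beta>) ^ card (X \<inter> hcube ?a ?L) - exp (- \<theta>)\<bar> \<le> (\<kappa> \<beta>)\<^sup>2 * ?m + \<bar>\<kappa> \<beta> * ?m - \<theta>\<bar>"
          unfolding F_def using elim(1) \<theta>0 by (intro power_one_minus_approx) auto
        moreover have "(\<kappa> \<beta>)\<^sup>2 * ?m \<le> \<kappa> \<beta> * u \<beta> * (\<rho> + ?r X)"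
        proof -
          have "(\<kappa> \<beta>)\<^sup>2 * ?m = \<kappa> \<beta> * u \<beta> * (?m / ?L ^ ?d)"
            by (simp add: ku power2_eq_square)
          also have "\<dots> \<le> \<kappa> \<beta> * u \<beta> * (\<rho> + ?r X)"
            using elim(1) u0 by (intro mult_left_mono) auto
          finally show ?thesis .
        qed
        moreover have "\<bar>\<kappa> \<beta> * ?m - \<theta>\<bar> \<le> u \<beta> * ?r X + \<bar>u \<beta> * \<rho> - \<theta>\<bar>"
        proof -
          have "\<kappa> \<beta> * ?m - \<theta> = u \<beta> * (?m / ?L ^ ?d - \<rho>) + (u \<beta> * \<rho> - \<theta>)" by (simp add: ku algebra_simps)
          also have "\<bar>\<dots>\<bar> \<le> \<bar>u \<beta> * (?m / ?L ^ ?d - \<rho>)\<bar> + \<bar>u \<beta> * \<rho> - \<theta>\<bar>" by (rule abs_triangle_ineq)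
          also have "\<bar>u \<beta> * (?m / ?L ^ ?d - \<rho>)\<bar> = u \<beta> * ?r X" using u0 by (simp add: abs_mult)
          finally show ?thesis .
        qed
        ultimately show "\<bar>(1 - \<kappa> \<beta>) ^ card (X \<inter> hcube ?a ?L) - exp (- \<theta>)\<bar>
          \<le> \<kappa> \<beta> * u \<beta> * (\<rho> + ?r X) + u \<beta> * ?r X + \<bar>u \<beta> * \<rho> - \<theta>\<bar>" by linarith
      qed
      also have "\<dots> = ?g \<beta>"
      proof -
        have "(\<integral>X. \<rho> + ?r X \<partial>P) = \<rho> + \<delta> ?L" using ri r\<delta> by (simp add: prob_space)
        thus ?thesis using ri r\<delta> by (simp add: prob_space)
      qed
      finally show ?case by simp
    qed
  qed
qed

lemma integral_rescaled_gf:
  fixes k :: nat and s :: "(real^'n) \<times> real \<Rightarrow> real"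
  defines "\<kappa> \<equiv> \<lambda>\<beta> a. \<Sum>e\<in>grid k. measure \<nu> {E. \<bar>E\<bar> \<le> l \<beta> / \<beta> \<and> E / (l \<beta> / \<beta>) \<in> cell k e} * (1 - s (a, e))"
  assumes "0 < \<beta>" and s: "\<And>v. v \<in> grid k \<Longrightarrow> 0 < s v \<and> s v \<le> 1"
  shows "integral\<^sup>L (distr (randomization P \<nu>) marked_config_space (rescale (l \<beta>) \<beta>)) (marked.gf (grid k) (cell k) s)
    = (\<integral>X. (\<Prod>a\<in>grid k. (1 - \<kappa> \<beta> a) ^ card (X \<inter> hcube (l \<beta> *\<^sub>R ((1 / 2 ^ k) *\<^sub>R a)) (l \<beta> * (1 / 2 ^ k)))) \<partial>P)"
proof -
  have l: "0 < l \<beta>" by (rule l_pos[OF \<open>0 < \<beta>\<close>])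
  let ?Z = "grid k :: (real^'n) set" and ?J = "grid k :: real set"
  let ?B = "\<lambda>a :: real^'n. {x. x /\<^sub>R l \<beta> \<in> cell k a}"
  let ?I = "\<lambda>e. {E. \<bar>E\<bar> \<le> l \<beta> / \<beta> \<and> E / (l \<beta> / \<beta>) \<in> cell k e}"
  have B: "?B a = hcube (l \<beta> *\<^sub>R ((1 / 2 ^ k) *\<^sub>R a)) (l \<beta> * (1 / 2 ^ k))" for a
    unfolding cell_def by (rule hcube_scale_vimage[OF l])
  have g: "marked.gf (grid k) (cell k) s (rescale (l \<beta>) \<beta> w)
    = marked.gf (?Z \<times> ?J) (\<lambda>i. ?B (fst i) \<times> ?I (snd i)) s w" for w
    unfolding marked.gf_def grid_Times
  proof (rule prod.cong[OF refl])
    fix v :: "(real^'n) \<times> real"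
    show "s v ^ card (rescale (l \<beta>) \<beta> w \<inter> cell k v) = s v ^ card (w \<inter> ?B (fst v) \<times> ?I (snd v))"
      using card_rescale[OF l \<open>0 < \<beta>\<close>, of w "cell k (fst v)" "cell k (snd v)"] cell_Times[of k "fst v" "snd v"] by simp
  qed
  have gm: "marked.gf (grid k) (cell k) s \<in> borel_measurable marked_config_space"
    by (rule marked.gf_measurable) simp_all
  have rm: "rescale (l \<beta>) \<beta> \<in> measurable (randomization P \<nu>) marked_config_space"
    using rescale_measurable[OF l \<open>0 < \<beta>\<close>] measurable_cong_sets[OF sets_randomization[OF spp_P nu(1,2)] refl] by blast
  have "integral\<^sup>L (distr (randomization P \<nu>) marked_config_space (rescale (l \<beta>) \<beta>)) (marked.gf (grid k) (cell k) s)
    = integral\<^sup>L (randomization P \<nu>) (marked.gf (?Z \<times> ?J) (\<lambda>i. ?B (fst i) \<times> ?I (snd i)) s)"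
    unfolding integral_distr[OF rm gm] g ..
  also have "\<dots> = (\<integral>X. (\<Prod>a\<in>?Z. (1 - (\<Sum>e\<in>?J. measure \<nu> (?I e) * (1 - s (a, e)))) ^ card (X \<inter> ?B a)) \<partial>P)"
  proof (rule integral_randomization_gf_product[OF spp_P])
    show "disjoint_family_on ?B ?Z"
      unfolding disjoint_family_on_def using disjoint_cells[of _ k] by blast
    show "disjoint_family_on ?I ?J"
      unfolding disjoint_family_on_def using disjoint_cells[of _ k] by blast
    show "?B a \<in> sets borel \<and> bounded (?B a)" for a unfolding B by simp
    show "?I e \<in> sets borel \<and> bounded (?I e)" for e by (rule borel_scaled_marks[OF borel_cell])
    show "0 \<le> s i \<and> s i \<le> 1" if "i \<in> ?Z \<times> ?J" for i
      using s[of i] that unfolding grid_Times by simp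
    have "(0::real) \<in> ?J" by (simp add: grid_def lattice_def)
    thus "?J \<noteq> {}" by blast
  qed (simp_all add: nu)
  finally show ?thesis unfolding \<kappa>_def B .
qed

lemma integral_limit_gf:
  fixes k :: nat and s :: "(real^'n) \<times> real \<Rightarrow> real"
  assumes s: "\<And>v. v \<in> grid k \<Longrightarrow> 0 < s v \<and> s v \<le> 1"
  shows "integral\<^sup>L (randomization Q \<mu>) (marked.gf (grid k) (cell k) s)
    = (\<Prod>a\<in>grid k. exp (- (lam * (1 / 2 ^ k) ^ CARD('n) * (\<Sum>e\<in>grid k. measure \<mu> (cell k e) * (1 - s (a, e))))))"
proof -
  let ?Z = "grid k :: (real^'n) set" and ?J = "grid k :: real set"
  let ?\<kappa> = "\<lambda>a. \<Sum>e\<in>?J. measure \<mu> (cell k e) * (1 - s (a, e))"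
  have dj: "disjoint_family_on (cell k) ?Z" "disjoint_family_on (cell k) ?J"
    unfolding disjoint_family_on_def using disjoint_cells[of _ k] by blast+
  have s': "0 \<le> s (a, e) \<and> s (a, e) \<le> 1" if "a \<in> ?Z" "e \<in> ?J" for a e
    using s[of "(a, e)"] that unfolding grid_Times by simp
  have "marked.gf (grid k) (cell k) s = marked.gf (?Z \<times> ?J) (\<lambda>i. cell k (fst i) \<times> cell k (snd i)) s"
    unfolding marked.gf_def[abs_def] grid_Times by (simp add: cell_Times[symmetric])
  hence "integral\<^sup>L (randomization Q \<mu>) (marked.gf (grid k) (cell k) s)
    = integral\<^sup>L (randomization Q \<mu>) (marked.gf (?Z \<times> ?J) (\<lambda>i. cell k (fst i) \<times> cell k (snd i)) s)"
    by (rule arg_cong)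
  also have "\<dots> = (\<integral>X. (\<Prod>a\<in>?Z. (1 - ?\<kappa> a) ^ card (X \<inter> cell k a)) \<partial>Q)"
  proof (rule integral_randomization_gf_product[OF spp_Q _ _ dj])
    have "(0::real) \<in> ?J" by (simp add: grid_def lattice_def)
    thus "?J \<noteq> {}" by blast
    show "0 \<le> s i \<and> s i \<le> 1" if "i \<in> ?Z \<times> ?J" for i using s'[of "fst i" "snd i"] that by auto
  qed (simp_all add: mu prob_mu)
  also have "\<dots> = (\<Prod>a\<in>?Z. exp (- (lam * measure lborel (cell k a) * (1 - (1 - ?\<kappa> a)))))"
  proof (rule poisson_gf[OF Q _ dj(1)])
    fix a assume a: "a \<in> ?Z"
    have "0 \<le> ?\<kappa> a" "?\<kappa> a \<le> 1"
      using s'[OF a] by (intro sum_measure_disjoint_bounds[OF mu(1) prob_mu _ dj(2)]; force)+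
    thus "0 \<le> 1 - ?\<kappa> a \<and> 1 - ?\<kappa> a \<le> 1" by simp
  qed simp_all
  also have "\<dots> = (\<Prod>a\<in>?Z. exp (- (lam * (1 / 2 ^ k) ^ CARD('n) * ?\<kappa> a)))"
    by (simp add: cell_def measure_lborel_hcube)
  finally show ?thesis .
qed

text \<open>Both generating functions are products over the spatial cells of the grid, one random
  before averaging over \<open>P\<close> and one deterministic; it remains to compare them factor by
  factor.\<close>

lemma weakly_converges_rescaled:
  "weakly_converges (vague_topology marked_configs)
     (\<lambda>\<beta>. distr (randomization P \<nu>) marked_config_space (rescale (l \<beta>) \<beta>)) (randomization Q \<mu>) at_top"
proof (rule marked.weakly_converges_gf)
  show "\<forall>\<^sub>F \<beta> in at_top. prob_space (distr (randomization P \<nu>) marked_config_space (rescale (l \<beta>) \<beta>))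
    \<and> sets (distr (randomization P \<nu>) marked_config_space (rescale (l \<beta>) \<beta>)) = sets marked_config_space"
    using eventually_gt_at_top[of 0]
  proof eventually_elim
    case (elim \<beta>)
    have "rescale (l \<beta>) \<beta> \<in> measurable (randomization P \<nu>) marked_config_space"
      using rescale_measurable[OF l_pos[OF elim] elim]
        measurable_cong_sets[OF sets_randomization[OF spp_P nu(1,2)] refl] by blast
    thus ?case using prob_space.prob_space_distr[OF prob_space_randomization[OF spp_P nu(1,2)]] by simp
  qed
  show "prob_space (randomization Q \<mu>)" by (rule prob_space_randomization[OF spp_Q mu(1) prob_mu])
  show "sets (randomization Q \<mu>) = sets marked_config_space" by (rule sets_randomization[OF spp_Q mu(1) prob_mu])
  fix k :: nat and s :: "(real^'n) \<times> real \<Rightarrow> real"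
  assume s: "\<And>v. v \<in> grid k \<Longrightarrow> 0 < s v \<and> s v \<le> 1"
  let ?Z = "grid k :: (real^'n) set" and ?J = "grid k :: real set" and ?b = "1 / 2 ^ k :: real"
  let ?M = "\<lambda>\<beta>. distr (randomization P \<nu>) marked_config_space (rescale (l \<beta>) \<beta>)"
  let ?I = "\<lambda>\<beta> e. {E. \<bar>E\<bar> \<le> l \<beta> / \<beta> \<and> E / (l \<beta> / \<beta>) \<in> cell k e}"
  define \<kappa> where "\<kappa> a \<beta> = (\<Sum>e\<in>?J. measure \<nu> (?I \<beta> e) * (1 - s (a, e)))" for a \<beta>
  define \<kappa>0 where "\<kappa>0 a = (\<Sum>e\<in>?J. measure \<mu> (cell k e) * (1 - s (a, e)))" for a
  have s': "0 \<le> 1 - s (a, e) \<and> 1 - s (a, e) \<le> 1" if "a \<in> ?Z" "e \<in> ?J" for a e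
    using s[of "(a, e)"] that unfolding grid_Times by simp
  have dI: "disjoint_family_on (?I \<beta>) ?J" for \<beta>
    unfolding disjoint_family_on_def using disjoint_cells[of _ k] by blast
  have dJ: "disjoint_family_on (cell k) ?J"
    unfolding disjoint_family_on_def using disjoint_cells[of _ k] by blast
  have \<kappa>01: "0 \<le> \<kappa> a \<beta> \<and> \<kappa> a \<beta> \<le> 1" if "a \<in> ?Z" for a \<beta>
    unfolding \<kappa>_def
    by (intro conjI sum_measure_disjoint_bounds[OF nu(1,2) finite_grid dI]
      conjunct1[OF borel_scaled_marks[OF borel_cell]] s'[OF that])
  have \<kappa>0_nonneg: "0 \<le> \<kappa>0 a" if "a \<in> ?Z" for a
    unfolding \<kappa>0_def by (rule sum_measure_disjoint_bounds(1)[OF mu(1) prob_mu finite_grid dJ borel_cell s'[OF that]])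
  have U: "((\<lambda>\<beta>. \<kappa> a \<beta> * l \<beta> ^ CARD('n)) \<longlongrightarrow> lam / \<rho> * \<kappa>0 a) at_top" for a
  proof (rule Lim_transform_eventually)
    let ?p = "\<lambda>\<beta>. measure \<nu> {- (l \<beta> / \<beta>)..l \<beta> / \<beta>}"
    have "((\<lambda>\<gamma>. measure (nu_star \<nu> \<gamma>) (cell k e)) \<longlongrightarrow> measure \<mu> (cell k e)) (at_right 0)" for e
      unfolding cell_def using nu_star_prob
      by (intro weakly_converges_interval[OF conv _ prob_mu mu]) simp
    from filterlim_compose[OF this l_div_tendsto]
    have "((\<lambda>\<beta>. measure (nu_star \<nu> (l \<beta> / \<beta>)) (cell k e)) \<longlongrightarrow> measure \<mu> (cell k e)) at_top" for e .
    thus "((\<lambda>\<beta>. (?p \<beta> * l \<beta> ^ CARD('n)) * (\<Sum>e\<in>?J. measure (nu_star \<nu> (l \<beta> / \<beta>)) (cell k e) * (1 - s (a, e))))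
      \<longlongrightarrow> lam / \<rho> * \<kappa>0 a) at_top"
      unfolding \<kappa>0_def by (intro tendsto_mult tendsto_sum tendsto_const retention_tendsto)
    show "\<forall>\<^sub>F \<beta> in at_top. (?p \<beta> * l \<beta> ^ CARD('n)) * (\<Sum>e\<in>?J. measure (nu_star \<nu> (l \<beta> / \<beta>)) (cell k e) * (1 - s (a, e)))
      = \<kappa> a \<beta> * l \<beta> ^ CARD('n)"
      using eventually_gt_at_top[of 0]
    proof eventually_elim
      case (elim \<beta>)
      have pos: "0 < ?p \<beta>" using l_pos[OF elim] elim by (intro measure_interval_pos nu) simp
      have "measure \<nu> (?I \<beta> e) = measure (nu_star \<nu> (l \<beta> / \<beta>)) (cell k e) * ?p \<beta>" for e
        by (rule measure_nu_star[OF nu(1,2) pos borel_cell, symmetric])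
      \<comment> \<open>With the retention probability factored out, what remains are probabilities
        under \<open>nu_star\<close>, which converge cell by cell.\<close>
      hence "\<kappa> a \<beta> = ?p \<beta> * (\<Sum>e\<in>?J. measure (nu_star \<nu> (l \<beta> / \<beta>)) (cell k e) * (1 - s (a, e)))"
        unfolding \<kappa>_def sum_distrib_left by (intro sum.cong refl) (simp only: mult_ac)
      thus ?case by (simp only: mult_ac)
    qed
  qed
  let ?h = "\<lambda>\<beta> a. hcube (l \<beta> *\<^sub>R (?b *\<^sub>R a)) (l \<beta> * ?b)"
  let ?\<theta> = "\<lambda>a. \<rho> * (lam / \<rho> * \<kappa>0 a) * ?b ^ CARD('n)"
  have \<theta>0: "0 \<le> ?\<theta> a" if "a \<in> ?Z" for a
    using \<kappa>0_nonneg[OF that] rho lam by simp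
  have lim: "((\<lambda>\<beta>. \<Sum>a\<in>?Z. \<integral>X. \<bar>(1 - \<kappa> a \<beta>) ^ card (X \<inter> ?h \<beta> a) - exp (- ?\<theta> a)\<bar> \<partial>P) \<longlongrightarrow> (\<Sum>a\<in>?Z. 0)) at_top"
  proof (intro tendsto_sum power_count_tendsto U)
    fix a assume a: "a \<in> ?Z"
    show "\<forall>\<^sub>F \<beta> in at_top. 0 \<le> \<kappa> a \<beta> \<and> \<kappa> a \<beta> \<le> 1" using \<kappa>01[OF a] by simp
    show "0 \<le> lam / \<rho> * \<kappa>0 a" using \<kappa>0_nonneg[OF a] rho lam by simp
  qed simp
  have L: "integral\<^sup>L (randomization Q \<mu>) (marked.gf (grid k) (cell k) s) = (\<Prod>a\<in>?Z. exp (- ?\<theta> a))"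
  proof -
    \<comment> \<open>The density \<rho> cancels, which leaves exactly the exponent of the
      randomized Poisson process.\<close>
    have "?\<theta> a = lam * ?b ^ CARD('n) * \<kappa>0 a" for a using rho by simp
    thus ?thesis unfolding \<kappa>0_def by (simp only: integral_limit_gf[of k s, OF s])
  qed
  show "((\<lambda>\<beta>. integral\<^sup>L (?M \<beta>) (marked.gf (grid k) (cell k) s))
      \<longlongrightarrow> integral\<^sup>L (randomization Q \<mu>) (marked.gf (grid k) (cell k) s)) at_top"
  proof (rule Lim_null[THEN iffD2], rule Lim_null_comparison)
    show "((\<lambda>\<beta>. \<Sum>a\<in>?Z. \<integral>X. \<bar>(1 - \<kappa> a \<beta>) ^ card (X \<inter> ?h \<beta> a) - exp (- ?\<theta> a)\<bar> \<partial>P) \<longlongrightarrow> 0) at_top"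
      using lim by simp
    show "\<forall>\<^sub>F \<beta> in at_top. norm (integral\<^sup>L (?M \<beta>) (marked.gf (grid k) (cell k) s)
        - integral\<^sup>L (randomization Q \<mu>) (marked.gf (grid k) (cell k) s))
      \<le> (\<Sum>a\<in>?Z. \<integral>X. \<bar>(1 - \<kappa> a \<beta>) ^ card (X \<inter> ?h \<beta> a) - exp (- ?\<theta> a)\<bar> \<partial>P)"
      using eventually_gt_at_top[of 0]
    proof eventually_elim
      case (elim \<beta>)
      let ?y = "\<lambda>X a. (1 - \<kappa> a \<beta>) ^ card (X \<inter> ?h \<beta> a)"
      have ym: "(\<lambda>X. ?y X a) \<in> borel_measurable P" for a
        by (rule measurable_compose[OF card_measurable_hcube]) simp
      have y01: "\<bar>?y X a\<bar> \<le> 1" if "a \<in> ?Z" for X a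
        using \<kappa>01[OF that, of \<beta>] by (simp add: power_abs[symmetric] power_le_one)
      have e01: "\<bar>exp (- ?\<theta> a)\<bar> \<le> 1" if "a \<in> ?Z" for a using \<theta>0[OF that] by simp
      have yi: "integrable P (\<lambda>X. ?y X a)" if "a \<in> ?Z" for a by (rule integrable_bounded[OF ym y01[OF that]])
      have pb: "\<bar>\<Prod>a\<in>?Z. ?y X a\<bar> \<le> 1" for X
        using y01 by (simp only: abs_prod) (intro prod_le_1, simp)
      have pi: "integrable P (\<lambda>X. \<Prod>a\<in>?Z. ?y X a)"
        using ym pb by (intro integrable_bounded[where M=1] borel_measurable_prod)
      have "integral\<^sup>L (?M \<beta>) (marked.gf (grid k) (cell k) s) = (\<integral>X. (\<Prod>a\<in>?Z. ?y X a) \<partial>P)"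
        unfolding \<kappa>_def by (rule integral_rescaled_gf[OF elim s])
      hence "norm (integral\<^sup>L (?M \<beta>) (marked.gf (grid k) (cell k) s)
          - integral\<^sup>L (randomization Q \<mu>) (marked.gf (grid k) (cell k) s))
        = \<bar>\<integral>X. (\<Prod>a\<in>?Z. ?y X a) - (\<Prod>a\<in>?Z. exp (- ?\<theta> a)) \<partial>P\<bar>"
        using pi unfolding L by (simp add: prob_space)
      also have "\<dots> \<le> (\<integral>X. \<bar>(\<Prod>a\<in>?Z. ?y X a) - (\<Prod>a\<in>?Z. exp (- ?\<theta> a))\<bar> \<partial>P)"
        by (rule integral_abs_bound)
      also have "\<dots> \<le> (\<integral>X. (\<Sum>a\<in>?Z. \<bar>?y X a - exp (- ?\<theta> a)\<bar>) \<partial>P)"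
      proof (rule integral_mono)
        show "integrable P (\<lambda>X. \<bar>(\<Prod>a\<in>?Z. ?y X a) - (\<Prod>a\<in>?Z. exp (- ?\<theta> a))\<bar>)" using pi by simp
        show "integrable P (\<lambda>X. \<Sum>a\<in>?Z. \<bar>?y X a - exp (- ?\<theta> a)\<bar>)" using yi by simp
        \<comment> \<open>All factors have absolute value at most 1, so the difference of the
          products telescopes into a sum of differences. Dependence between the counts in different
          cells thus causes no difficulty: the limiting factors are constants.\<close>
        show "\<bar>(\<Prod>a\<in>?Z. ?y X a) - (\<Prod>a\<in>?Z. exp (- ?\<theta> a))\<bar> \<le> (\<Sum>a\<in>?Z. \<bar>?y X a - exp (- ?\<theta> a)\<bar>)" for X
          using norm_prod_diff[of ?Z "?y X" "\<lambda>a. exp (- ?\<theta> a)"] y01 e01 by simp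
      qed
      also have "\<dots> = (\<Sum>a\<in>?Z. \<integral>X. \<bar>?y X a - exp (- ?\<theta> a)\<bar> \<partial>P)"
        using yi by (intro Bochner_Integration.integral_sum) simp
      finally show ?case .
    qed
  qed
qed

end

section \<open>The two limit laws of the marks have no atoms\<close>

lemma emeasure_density_lborel_singleton:
  assumes "f \<in> borel_measurable borel"
  shows "emeasure (density lborel f) {x :: real} = 0"
proof -
  have "{x} \<in> null_sets lborel" by (simp add: null_sets_def)
  hence "{x} \<in> null_sets (density lborel f)"
    using absolutely_continuousI_density[of f lborel] assms unfolding absolutely_continuous_def by auto
  thus ?thesis by auto
qed

theorem theorem8p2:
  fixes P :: "(real^'n) set measure" and Q :: "(real^'n) set measure"
    and \<nu> :: "real measure" and \<alpha> \<rho> C lam :: real and l :: "real \<Rightarrow> real"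
  assumes "\<alpha> \<ge> 0"
    and "spp_law P" and "ergodic P"
    and "\<rho> > 0" and "intensity P = ennreal \<rho>"
    and "prob_space \<nu>" and "sets \<nu> = sets borel" and "0 \<in> measure_support \<nu>"
    and "weakly_converges euclideanreal (nu_star \<nu>) (nu1_plus \<alpha>) (at_right 0) \<or>
         weakly_converges euclideanreal (nu_star \<nu>) (nu1 \<alpha>) (at_right 0)"
    and "((\<lambda>\<gamma>. measure \<nu> {-\<gamma>..\<gamma>} / \<gamma> powr (\<alpha> + 1)) \<longlongrightarrow> C) (at_right 0)" and "C > 0"
    and "lam > 0"
    and "l = (\<lambda>\<beta>. (lam / (C * \<rho>)) powr (1 / (\<alpha> + 1 + real CARD('n)))
                    * \<beta> powr ((\<alpha> + 1) / (\<alpha> + 1 + real CARD('n))))"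
    and "poisson_process_law lam Q"
  shows "(weakly_converges euclideanreal (nu_star \<nu>) (nu1_plus \<alpha>) (at_right 0) \<longrightarrow>
            weakly_converges (vague_topology marked_configs)
              (\<lambda>\<beta>. distr (randomization P \<nu>) marked_config_space (rescale (l \<beta>) \<beta>))
              (randomization Q (nu1_plus \<alpha>)) at_top) \<and>
         (weakly_converges euclideanreal (nu_star \<nu>) (nu1 \<alpha>) (at_right 0) \<longrightarrow>
            weakly_converges (vague_topology marked_configs)
              (\<lambda>\<beta>. distr (randomization P \<nu>) marked_config_space (rescale (l \<beta>) \<beta>))
              (randomization Q (nu1 \<alpha>)) at_top)"
proof -
  have main: "weakly_converges (vague_topology marked_configs)
      (\<lambda>\<beta>. distr (randomization P \<nu>) marked_config_space (rescale (l \<beta>) \<beta>)) (randomization Q \<mu>) at_top"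
    if "weakly_converges euclideanreal (nu_star \<nu>) \<mu> (at_right 0)"
      "sets \<mu> = sets borel" "\<And>x. emeasure \<mu> {x} = 0" for \<mu>
  proof -
    interpret prob_space P using \<open>spp_law P\<close> by (simp add: spp_law_def)
    interpret nu: prob_space \<nu> by fact
    interpret rescaled_spp P \<rho> \<nu> \<mu> Q \<alpha> C lam l
      by unfold_locales (use assms that in \<open>simp_all add: spp_law_def ergodic_def\<close>)
    show ?thesis by (rule weakly_converges_rescaled)
  qed
  have "sets (nu1_plus \<alpha>) = sets borel" "sets (nu1 \<alpha>) = sets borel"
    by (simp_all add: nu1_plus_def nu1_def)
  moreover have "emeasure (nu1_plus \<alpha>) {x} = 0" "emeasure (nu1 \<alpha>) {x} = 0" for x
    unfolding nu1_plus_def nu1_def by (intro emeasure_density_lborel_singleton; simp)+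
  ultimately show ?thesis using main by blast
qed

end
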